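(* Let $(M,g,J)$ be a locally conformal Kaehler manifold with Lee form $\omega$, Lee vector field $B_1$ and anti-Lee vector field $A=-JB_1$, let $(B,g_B)$ be a Riemannian manifold, and let $\pi$ be a Lagrangian Riemannian submersion from $M$ onto $B$. Assume $B_1\in\Gamma(\ker\pi_* )$. Then $\pi$ is a totally geodesic map if and only if $$\mathcal{T}_VJW+\tfrac12\omega(W)JV+\tfrac12 g(V,W)A=0$$ and $$\mathcal{A}_XJW+\tfrac12\omega(W)JX+\tfrac12\Omega(X,W)B_1=0$$ for all $X\in\Gamma((\ker\pi_* )^\bot)$ and $V,W\in\Gamma(\ker\pi_* )$.
   Context: Locally conformal Kaehler (l.c.K.) manifold: a Hermitian manifold $(M,J,g)$, with $\Omega(X,Y)=g(X,JY)$, for which there is a globally defined closed $1$-form $\omega$ (the Lee form) with $d\Omega=\omega\wedge\Omega$. The Lee vector field $B_1$ is defined by $g(X,B_1)=\omega(X)$; set $\theta=\omega\circ J$ and $A=-JB_1$. The Levi-Civita connection $\nabla$ of $g$ then satisfies $(\nabla_XJ)Y=\frac12\{\theta(Y)X-\omega(Y)JX-g(X,Y)A-\Omega(X,Y)B_1\}$. Riemannian submersion $\pi:(M,g)\to(B,g_B)$ (with $\dim M>\dim B$): a surjective smooth map of maximal rank whose differential $\pi_*$ preserves lengths of horizontal vectors. $\ker\pi_*$ is the vertical distribution, $(\ker\pi_* )^\bot$ the horizontal one; $\mathcal V,\mathcal H$ are the orthogonal projections onto them. O'Neill tensors: $\mathcal{A}_EF=\mathcal{H}\nabla_{\mathcal{H}E}\mathcal{V}F+\mathcal{V}\nabla_{\mathcal{H}E}\mathcal{H}F$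 and $\mathcal{T}_EF=\mathcal{H}\nabla_{\mathcal{V}E}\mathcal{V}F+\mathcal{V}\nabla_{\mathcal{V}E}\mathcal{H}F$. $\pi$ is Lagrangian if $J(\ker\pi_* )=(\ker\pi_* )^\bot$. Second fundamental form of $\pi$: $(\nabla\pi_* )(E,F)=\nabla^{\pi}_E\pi_*(F)-\pi_*(\nabla_EF)$, with $\nabla^\pi$ the pullback connection of the Levi-Civita connection of $B$. $\pi$ is called totally geodesic if $\nabla\pi_*=0$. *)

theory Defs
  imports "HOL-Analysis.Analysis" "HOL-Library.Function_Algebras"
begin

text \<open>
  Functions, tangent vectors and vector fields are added and scaled pointwise.
\<close>

instantiation "fun" :: (type, real_vector) real_vector
begin

definition scaleR_fun :: "real \<Rightarrow> ('a \<Rightarrow> 'b) \<Rightarrow> 'a \<Rightarrow> 'b"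
  where "scaleR_fun c f = (\<lambda>x. c *\<^sub>R f x)"

instance
  by standard (simp_all add: scaleR_fun_def fun_eq_iff algebra_simps)

end

lemma scaleR_fun_apply [simp]: "(c *\<^sub>R f) x = c *\<^sub>R f x"
  by (simp add: scaleR_fun_def)


section \<open>Smooth manifolds\<close>

text \<open>Only meaningful for open \<open>S\<close>, since \<open>frechet_derivative\<close> is taken \<open>at x\<close>.\<close>

primrec Ck_on :: "nat \<Rightarrow> 'a::euclidean_space set \<Rightarrow> ('a \<Rightarrow> 'b::real_normed_vector) \<Rightarrow> bool"
  where
    "Ck_on 0 S f \<longleftrightarrow> continuous_on S f"
  | "Ck_on (Suc k) S f \<longleftrightarrow>
       (\<forall>x\<in>S. f differentiable (at x)) \<and>
       (\<forall>v. Ck_on k S (\<lambda>x. frechet_derivative f (at x) v))"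

definition smooth_on :: "'a::euclidean_space set \<Rightarrow> ('a \<Rightarrow> 'b::real_normed_vector) \<Rightarrow> bool"
  where "smooth_on S f \<longleftrightarrow> (\<forall>k. Ck_on k S f)"

text \<open>
  A manifold is a whole type \<open>'m\<close> with an atlas of charts \<open>(U, \<phi>)\<close> into a Euclidean
  space \<open>'a\<close>; its dimension is \<open>DIM('a)\<close>, which is positive. Values of \<open>\<phi>\<close>
  outside \<open>U\<close> are irrelevant. The atlas need not be maximal.
\<close>

type_synonym ('m, 'a) atlas = "('m set \<times> ('m \<Rightarrow> 'a)) set"

definition is_chart :: "'m::topological_space set \<Rightarrow> ('m \<Rightarrow> 'a::euclidean_space) \<Rightarrow> bool"
  where "is_chart U \<phi> \<longleftrightarrow>
    open U \<and> open (\<phi> ` U) \<and> homeomorphism U (\<phi> ` U) \<phi> (inv_into U \<phi>)"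

definition smooth_manifold ::
    "('m::{t2_space, second_countable_topology}, 'a::euclidean_space) atlas \<Rightarrow> bool"
  where "smooth_manifold \<A> \<longleftrightarrow>
    (\<forall>(U, \<phi>) \<in> \<A>. is_chart U \<phi>) \<and>
    (\<Union>(U, \<phi>) \<in> \<A>. U) = UNIV \<and>
    (\<forall>(U, \<phi>) \<in> \<A>. \<forall>(V, \<psi>) \<in> \<A>. smooth_on (\<phi> ` (U \<inter> V)) (\<psi> \<circ> inv_into U \<phi>))"

definition C_infinity :: "('m, 'a::euclidean_space) atlas \<Rightarrow> ('m \<Rightarrow> real) set"
  where "C_infinity \<A> = {f. \<forall>(U, \<phi>) \<in> \<A>. smooth_on (\<phi> ` U) (f \<circ> inv_into U \<phi>)}"

definition smooth_map ::
    "('m::topological_space, 'a::euclidean_space) atlas \<Rightarrow>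
     ('n::topological_space, 'b::euclidean_space) atlas \<Rightarrow> ('m \<Rightarrow> 'n) \<Rightarrow> bool"
  where "smooth_map \<A> \<B> \<pi> \<longleftrightarrow>
    continuous_on UNIV \<pi> \<and>
    (\<forall>(U, \<phi>) \<in> \<A>. \<forall>(V, \<psi>) \<in> \<B>.
       smooth_on (\<phi> ` (U \<inter> \<pi> -` V)) (\<psi> \<circ> \<pi> \<circ> inv_into U \<phi>))"


section \<open>Tangent vectors, vector fields, forms\<close>

text \<open>
  Tangent vectors at \<open>p\<close> are the derivations at \<open>p\<close> of the algebra of smooth
  functions. To make them unique as HOL functions, they vanish on non-smooth arguments.
  Vector fields and forms are total functions, only constrained and used on tangent spaces.
\<close>

type_synonym 'm tvec = "('m \<Rightarrow> real) \<Rightarrow> real"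
type_synonym 'm vfield = "'m \<Rightarrow> 'm tvec"
type_synonym 'm form1 = "'m \<Rightarrow> 'm tvec \<Rightarrow> real"
type_synonym 'm form2 = "'m \<Rightarrow> 'm tvec \<Rightarrow> 'm tvec \<Rightarrow> real"
type_synonym 'm endo = "'m \<Rightarrow> 'm tvec \<Rightarrow> 'm tvec"

definition tangent_space :: "('m, 'a::euclidean_space) atlas \<Rightarrow> 'm \<Rightarrow> 'm tvec set"
  where "tangent_space \<A> p = {v.
    (\<forall>f \<in> C_infinity \<A>. \<forall>h \<in> C_infinity \<A>. v (f + h) = v f + v h) \<and>
    (\<forall>c. \<forall>f \<in> C_infinity \<A>. v (c *\<^sub>R f) = c * v f) \<and>
    (\<forall>f \<in> C_infinity \<A>. \<forall>h \<in> C_infinity \<A>. v (f * h) = v f * h p + f p * v h) \<and>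
    (\<forall>f. f \<notin> C_infinity \<A> \<longrightarrow> v f = 0)}"

definition deriv_along :: "'m vfield \<Rightarrow> ('m \<Rightarrow> real) \<Rightarrow> ('m \<Rightarrow> real)"
  where "deriv_along X f = (\<lambda>p. X p f)"

definition vector_fields :: "('m, 'a::euclidean_space) atlas \<Rightarrow> 'm vfield set"
  where "vector_fields \<A> = {X.
    (\<forall>p. X p \<in> tangent_space \<A> p) \<and>
    (\<forall>f \<in> C_infinity \<A>. deriv_along X f \<in> C_infinity \<A>)}"

definition fscale :: "('m \<Rightarrow> real) \<Rightarrow> ('m \<Rightarrow> 'v::real_vector) \<Rightarrow> ('m \<Rightarrow> 'v)"  (infixr \<open>\<cdot>\<close> 75)
  where "f \<cdot> X = (\<lambda>p. f p *\<^sub>R X p)"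

definition on_field :: "('m \<Rightarrow> 'v \<Rightarrow> 'w) \<Rightarrow> ('m \<Rightarrow> 'v) \<Rightarrow> ('m \<Rightarrow> 'w)"
  where "on_field L X = (\<lambda>p. L p (X p))"

definition on_fields2 :: "'m form2 \<Rightarrow> 'm vfield \<Rightarrow> 'm vfield \<Rightarrow> ('m \<Rightarrow> real)"
  where "on_fields2 b X Y = (\<lambda>p. b p (X p) (Y p))"

definition lie_bracket :: "('m, 'a::euclidean_space) atlas \<Rightarrow> 'm vfield \<Rightarrow> 'm vfield \<Rightarrow> 'm vfield"
  where "lie_bracket \<A> X Y = (\<lambda>p f.
    if f \<in> C_infinity \<A> then X p (deriv_along Y f) - Y p (deriv_along X f) else 0)"

definition linear_within :: "'v::real_vector set \<Rightarrow> ('v \<Rightarrow> 'w::real_vector) \<Rightarrow> bool"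
  where "linear_within T L \<longleftrightarrow>
    (\<forall>u\<in>T. \<forall>v\<in>T. L (u + v) = L u + L v) \<and> (\<forall>c. \<forall>u\<in>T. L (c *\<^sub>R u) = c *\<^sub>R L u)"

definition one_form :: "('m, 'a::euclidean_space) atlas \<Rightarrow> 'm form1 \<Rightarrow> bool"
  where "one_form \<A> \<omega> \<longleftrightarrow>
    (\<forall>p. linear_within (tangent_space \<A> p) (\<omega> p)) \<and>
    (\<forall>X \<in> vector_fields \<A>. on_field \<omega> X \<in> C_infinity \<A>)"

text \<open>
  Exterior derivatives and wedge product evaluated on vector fields, without the
  combinatorial factors 1/2 and 1/3. The equations \<open>d \<omega> = 0\<close> and
  \<open>d \<Omega> = \<omega> \<and> \<Omega>\<close> are the same in both normalizations.
\<close>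

definition ext_deriv1 ::
    "('m, 'a::euclidean_space) atlas \<Rightarrow> 'm form1 \<Rightarrow> 'm vfield \<Rightarrow> 'm vfield \<Rightarrow> ('m \<Rightarrow> real)"
  where "ext_deriv1 \<A> \<omega> X Y =
    deriv_along X (on_field \<omega> Y) - deriv_along Y (on_field \<omega> X)
    - on_field \<omega> (lie_bracket \<A> X Y)"

definition ext_deriv2 ::
    "('m, 'a::euclidean_space) atlas \<Rightarrow> 'm form2 \<Rightarrow>
     'm vfield \<Rightarrow> 'm vfield \<Rightarrow> 'm vfield \<Rightarrow> ('m \<Rightarrow> real)"
  where "ext_deriv2 \<A> \<Omega> X Y Z =
    deriv_along X (on_fields2 \<Omega> Y Z) - deriv_along Y (on_fields2 \<Omega> X Z)
    + deriv_along Z (on_fields2 \<Omega> X Y)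
    - on_fields2 \<Omega> (lie_bracket \<A> X Y) Z + on_fields2 \<Omega> (lie_bracket \<A> X Z) Y
    - on_fields2 \<Omega> (lie_bracket \<A> Y Z) X"

definition wedge12 ::
    "'m form1 \<Rightarrow> 'm form2 \<Rightarrow> 'm vfield \<Rightarrow> 'm vfield \<Rightarrow> 'm vfield \<Rightarrow> ('m \<Rightarrow> real)"
  where "wedge12 \<omega> \<Omega> X Y Z =
    on_field \<omega> X * on_fields2 \<Omega> Y Z - on_field \<omega> Y * on_fields2 \<Omega> X Z
    + on_field \<omega> Z * on_fields2 \<Omega> X Y"


section \<open>Riemannian, Hermitian and locally conformal Kaehler manifolds\<close>

definition riemannian_manifold ::
    "('m::{t2_space, second_countable_topology}, 'a::euclidean_space) atlas \<Rightarrow> 'm form2 \<Rightarrow> bool"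
  where "riemannian_manifold \<A> g \<longleftrightarrow>
    smooth_manifold \<A> \<and>
    (\<forall>p. \<forall>u \<in> tangent_space \<A> p. \<forall>v \<in> tangent_space \<A> p. g p u v = g p v u) \<and>
    (\<forall>p. \<forall>u \<in> tangent_space \<A> p. linear_within (tangent_space \<A> p) (g p u)) \<and>
    (\<forall>p. \<forall>u \<in> tangent_space \<A> p. u \<noteq> 0 \<longrightarrow> g p u u > 0) \<and>
    (\<forall>X \<in> vector_fields \<A>. \<forall>Y \<in> vector_fields \<A>. on_fields2 g X Y \<in> C_infinity \<A>)"

definition affine_connection ::
    "('m, 'a::euclidean_space) atlas \<Rightarrow> ('m vfield \<Rightarrow> 'm vfield \<Rightarrow> 'm vfield) \<Rightarrow> bool"
  where "affine_connection \<A> D \<longleftrightarrow>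
    (\<forall>X \<in> vector_fields \<A>. \<forall>Y \<in> vector_fields \<A>. D X Y \<in> vector_fields \<A>) \<and>
    (\<forall>X \<in> vector_fields \<A>. \<forall>Y \<in> vector_fields \<A>. \<forall>Z \<in> vector_fields \<A>.
       D (X + Y) Z = D X Z + D Y Z \<and> D X (Y + Z) = D X Y + D X Z) \<and>
    (\<forall>f \<in> C_infinity \<A>. \<forall>X \<in> vector_fields \<A>. \<forall>Y \<in> vector_fields \<A>.
       D (f \<cdot> X) Y = f \<cdot> D X Y \<and> D X (f \<cdot> Y) = deriv_along X f \<cdot> Y + f \<cdot> D X Y)"

definition levi_civita_connection ::
    "('m, 'a::euclidean_space) atlas \<Rightarrow> 'm form2 \<Rightarrow>
     ('m vfield \<Rightarrow> 'm vfield \<Rightarrow> 'm vfield) \<Rightarrow> bool"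
  where "levi_civita_connection \<A> g D \<longleftrightarrow>
    affine_connection \<A> D \<and>
    (\<forall>X \<in> vector_fields \<A>. \<forall>Y \<in> vector_fields \<A>. D X Y - D Y X = lie_bracket \<A> X Y) \<and>
    (\<forall>X \<in> vector_fields \<A>. \<forall>Y \<in> vector_fields \<A>. \<forall>Z \<in> vector_fields \<A>.
       deriv_along X (on_fields2 g Y Z) = on_fields2 g (D X Y) Z + on_fields2 g Y (D X Z))"

definition almost_complex_structure :: "('m, 'a::euclidean_space) atlas \<Rightarrow> 'm endo \<Rightarrow> bool"
  where "almost_complex_structure \<A> J \<longleftrightarrow>
    (\<forall>p. linear_within (tangent_space \<A> p) (J p) \<and> J p ` tangent_space \<A> p \<subseteq> tangent_space \<A> p) \<and>
    (\<forall>p. \<forall>u \<in> tangent_space \<A> p. J p (J p u) = - u) \<and>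
    (\<forall>X \<in> vector_fields \<A>. on_field J X \<in> vector_fields \<A>)"

text \<open>The Nijenhuis tensor; its vanishing is the integrability of \<open>J\<close>.\<close>

definition nijenhuis ::
    "('m, 'a::euclidean_space) atlas \<Rightarrow> 'm endo \<Rightarrow> 'm vfield \<Rightarrow> 'm vfield \<Rightarrow> 'm vfield"
  where "nijenhuis \<A> J X Y =
    lie_bracket \<A> (on_field J X) (on_field J Y) - on_field J (lie_bracket \<A> (on_field J X) Y)
    - on_field J (lie_bracket \<A> X (on_field J Y)) - lie_bracket \<A> X Y"

definition hermitian_manifold ::
    "('m::{t2_space, second_countable_topology}, 'a::euclidean_space) atlas \<Rightarrow>
     'm form2 \<Rightarrow> 'm endo \<Rightarrow> bool"
  where "hermitian_manifold \<A> g J \<longleftrightarrow>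
    riemannian_manifold \<A> g \<and> almost_complex_structure \<A> J \<and>
    (\<forall>X \<in> vector_fields \<A>. \<forall>Y \<in> vector_fields \<A>. nijenhuis \<A> J X Y = 0) \<and>
    (\<forall>p. \<forall>u \<in> tangent_space \<A> p. \<forall>v \<in> tangent_space \<A> p. g p (J p u) (J p v) = g p u v)"

definition fundamental_form :: "'m form2 \<Rightarrow> 'm endo \<Rightarrow> 'm form2"
  where "fundamental_form g J = (\<lambda>p u v. g p u (J p v))"

definition lcK_manifold ::
    "('m::{t2_space, second_countable_topology}, 'a::euclidean_space) atlas \<Rightarrow>
     'm form2 \<Rightarrow> 'm endo \<Rightarrow> 'm form1 \<Rightarrow> bool"
  where "lcK_manifold \<A> g J \<omega> \<longleftrightarrow>
    hermitian_manifold \<A> g J \<and> one_form \<A> \<omega> \<and>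
    (\<forall>X \<in> vector_fields \<A>. \<forall>Y \<in> vector_fields \<A>. ext_deriv1 \<A> \<omega> X Y = 0) \<and>
    (\<forall>X \<in> vector_fields \<A>. \<forall>Y \<in> vector_fields \<A>. \<forall>Z \<in> vector_fields \<A>.
       ext_deriv2 \<A> (fundamental_form g J) X Y Z = wedge12 \<omega> (fundamental_form g J) X Y Z)"

definition lee_vector_field ::
    "('m, 'a::euclidean_space) atlas \<Rightarrow> 'm form2 \<Rightarrow> 'm form1 \<Rightarrow> 'm vfield \<Rightarrow> bool"
  where "lee_vector_field \<A> g \<omega> B1 \<longleftrightarrow>
    B1 \<in> vector_fields \<A> \<and>
    (\<forall>X \<in> vector_fields \<A>. on_fields2 g X B1 = on_field \<omega> X)"

definition anti_lee_vector_field :: "'m endo \<Rightarrow> 'm vfield \<Rightarrow> 'm vfield"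
  where "anti_lee_vector_field J B1 = - on_field J B1"


section \<open>Riemannian submersions\<close>

text \<open>
  The differential does not mention the base point, which is implicit in the derivation.
\<close>

definition differential ::
    "('n, 'b::euclidean_space) atlas \<Rightarrow> ('m \<Rightarrow> 'n) \<Rightarrow> 'm tvec \<Rightarrow> 'n tvec"
  where "differential \<B> \<pi> v = (\<lambda>h. if h \<in> C_infinity \<B> then v (h \<circ> \<pi>) else 0)"

definition vertical_space ::
    "('m, 'a::euclidean_space) atlas \<Rightarrow> ('n, 'b::euclidean_space) atlas \<Rightarrow> ('m \<Rightarrow> 'n) \<Rightarrow>
     'm \<Rightarrow> 'm tvec set"
  where "vertical_space \<A> \<B> \<pi> p = {v \<in> tangent_space \<A> p. differential \<B> \<pi> v = 0}"

definition horizontal_space ::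
    "('m, 'a::euclidean_space) atlas \<Rightarrow> 'm form2 \<Rightarrow> ('n, 'b::euclidean_space) atlas \<Rightarrow>
     ('m \<Rightarrow> 'n) \<Rightarrow> 'm \<Rightarrow> 'm tvec set"
  where "horizontal_space \<A> g \<B> \<pi> p =
    {v \<in> tangent_space \<A> p. \<forall>w \<in> vertical_space \<A> \<B> \<pi> p. g p v w = 0}"

definition sections :: "('m, 'a::euclidean_space) atlas \<Rightarrow> ('m \<Rightarrow> 'm tvec set) \<Rightarrow> 'm vfield set"
  where "sections \<A> S = {X \<in> vector_fields \<A>. \<forall>p. X p \<in> S p}"

definition riemannian_submersion ::
    "('m::{t2_space, second_countable_topology}, 'a::euclidean_space) atlas \<Rightarrow> 'm form2 \<Rightarrow>
     ('n::{t2_space, second_countable_topology}, 'b::euclidean_space) atlas \<Rightarrow> 'n form2 \<Rightarrow>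
     ('m \<Rightarrow> 'n) \<Rightarrow> bool"
  where "riemannian_submersion \<A> g \<B> g\<^sub>B \<pi> \<longleftrightarrow>
    riemannian_manifold \<A> g \<and> riemannian_manifold \<B> g\<^sub>B \<and> DIM('a) > DIM('b) \<and>
    smooth_map \<A> \<B> \<pi> \<and> surj \<pi> \<and>
    (\<forall>p. differential \<B> \<pi> ` tangent_space \<A> p = tangent_space \<B> (\<pi> p)) \<and>
    (\<forall>p. \<forall>v \<in> horizontal_space \<A> g \<B> \<pi> p.
       g\<^sub>B (\<pi> p) (differential \<B> \<pi> v) (differential \<B> \<pi> v) = g p v v)"

definition lagrangian_riemannian_submersion ::
    "('m::{t2_space, second_countable_topology}, 'a::euclidean_space) atlas \<Rightarrow> 'm form2 \<Rightarrow>
     'm endo \<Rightarrow>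
     ('n::{t2_space, second_countable_topology}, 'b::euclidean_space) atlas \<Rightarrow> 'n form2 \<Rightarrow>
     ('m \<Rightarrow> 'n) \<Rightarrow> bool"
  where "lagrangian_riemannian_submersion \<A> g J \<B> g\<^sub>B \<pi> \<longleftrightarrow>
    riemannian_submersion \<A> g \<B> g\<^sub>B \<pi> \<and>
    (\<forall>p. J p ` vertical_space \<A> \<B> \<pi> p = horizontal_space \<A> g \<B> \<pi> p)"

definition ver_proj ::
    "('m, 'a::euclidean_space) atlas \<Rightarrow> 'm form2 \<Rightarrow> ('n, 'b::euclidean_space) atlas \<Rightarrow>
     ('m \<Rightarrow> 'n) \<Rightarrow> 'm endo"
  where "ver_proj \<A> g \<B> \<pi> p v =
    (THE u. u \<in> vertical_space \<A> \<B> \<pi> p \<and> v - u \<in> horizontal_space \<A> g \<B> \<pi> p)"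

definition hor_proj ::
    "('m, 'a::euclidean_space) atlas \<Rightarrow> 'm form2 \<Rightarrow> ('n, 'b::euclidean_space) atlas \<Rightarrow>
     ('m \<Rightarrow> 'n) \<Rightarrow> 'm endo"
  where "hor_proj \<A> g \<B> \<pi> p v = v - ver_proj \<A> g \<B> \<pi> p v"

definition oneill_A ::
    "('m, 'a::euclidean_space) atlas \<Rightarrow> 'm form2 \<Rightarrow> ('n, 'b::euclidean_space) atlas \<Rightarrow>
     ('m \<Rightarrow> 'n) \<Rightarrow> ('m vfield \<Rightarrow> 'm vfield \<Rightarrow> 'm vfield) \<Rightarrow> 'm vfield \<Rightarrow> 'm vfield \<Rightarrow> 'm vfield"
  where "oneill_A \<A> g \<B> \<pi> D E F =
    (let \<V> = on_field (ver_proj \<A> g \<B> \<pi>); \<H> = on_field (hor_proj \<A> g \<B> \<pi>)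
     in \<H> (D (\<H> E) (\<V> F)) + \<V> (D (\<H> E) (\<H> F)))"

definition oneill_T ::
    "('m, 'a::euclidean_space) atlas \<Rightarrow> 'm form2 \<Rightarrow> ('n, 'b::euclidean_space) atlas \<Rightarrow>
     ('m \<Rightarrow> 'n) \<Rightarrow> ('m vfield \<Rightarrow> 'm vfield \<Rightarrow> 'm vfield) \<Rightarrow> 'm vfield \<Rightarrow> 'm vfield \<Rightarrow> 'm vfield"
  where "oneill_T \<A> g \<B> \<pi> D E F =
    (let \<V> = on_field (ver_proj \<A> g \<B> \<pi>); \<H> = on_field (hor_proj \<A> g \<B> \<pi>)
     in \<H> (D (\<V> E) (\<V> F)) + \<V> (D (\<V> E) (\<H> F)))"


section \<open>The second fundamental form of a map\<close>

text \<open>Smooth sections of the pullback bundle \<open>\<pi>\<^sup>* TB\<close>.\<close>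

definition fields_along ::
    "('m, 'a::euclidean_space) atlas \<Rightarrow> ('n, 'b::euclidean_space) atlas \<Rightarrow> ('m \<Rightarrow> 'n) \<Rightarrow>
     ('m \<Rightarrow> 'n tvec) set"
  where "fields_along \<A> \<B> \<pi> = {Z.
    (\<forall>p. Z p \<in> tangent_space \<B> (\<pi> p)) \<and>
    (\<forall>h \<in> C_infinity \<B>. (\<lambda>p. Z p h) \<in> C_infinity \<A>)}"

text \<open>
  The pullback along \<open>\<pi>\<close> of a connection \<open>D\<^sub>B\<close> on the target is the connection on
  \<open>\<pi>\<^sup>* TB\<close> that agrees on \<open>Y \<circ> \<pi>\<close> with the derivative of \<open>Y\<close> in direction
  \<open>\<pi>\<^sub>*(E p)\<close>. As \<open>D\<^sub>B\<close> takes a vector field in its first argument, \<open>X\<close> below is any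
  field that extends this tangent vector.
\<close>

definition pullback_connection ::
    "('m, 'a::euclidean_space) atlas \<Rightarrow> ('n, 'b::euclidean_space) atlas \<Rightarrow> ('m \<Rightarrow> 'n) \<Rightarrow>
     ('n vfield \<Rightarrow> 'n vfield \<Rightarrow> 'n vfield) \<Rightarrow>
     ('m vfield \<Rightarrow> ('m \<Rightarrow> 'n tvec) \<Rightarrow> ('m \<Rightarrow> 'n tvec)) \<Rightarrow> bool"
  where "pullback_connection \<A> \<B> \<pi> D\<^sub>B P \<longleftrightarrow>
    (\<forall>E \<in> vector_fields \<A>. \<forall>Z \<in> fields_along \<A> \<B> \<pi>. P E Z \<in> fields_along \<A> \<B> \<pi>) \<and>
    (\<forall>E \<in> vector_fields \<A>. \<forall>F \<in> vector_fields \<A>. \<forall>Z \<in> fields_along \<A> \<B> \<pi>.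
       P (E + F) Z = P E Z + P F Z) \<and>
    (\<forall>E \<in> vector_fields \<A>. \<forall>Y \<in> fields_along \<A> \<B> \<pi>. \<forall>Z \<in> fields_along \<A> \<B> \<pi>.
       P E (Y + Z) = P E Y + P E Z) \<and>
    (\<forall>f \<in> C_infinity \<A>. \<forall>E \<in> vector_fields \<A>. \<forall>Z \<in> fields_along \<A> \<B> \<pi>.
       P (f \<cdot> E) Z = f \<cdot> P E Z \<and> P E (f \<cdot> Z) = deriv_along E f \<cdot> Z + f \<cdot> P E Z) \<and>
    (\<forall>E \<in> vector_fields \<A>. \<forall>X \<in> vector_fields \<B>. \<forall>Y \<in> vector_fields \<B>. \<forall>p.
       X (\<pi> p) = differential \<B> \<pi> (E p) \<longrightarrow> P E (Y \<circ> \<pi>) p = D\<^sub>B X Y (\<pi> p))"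

definition push_field ::
    "('n, 'b::euclidean_space) atlas \<Rightarrow> ('m \<Rightarrow> 'n) \<Rightarrow> 'm vfield \<Rightarrow> ('m \<Rightarrow> 'n tvec)"
  where "push_field \<B> \<pi> F = (\<lambda>p. differential \<B> \<pi> (F p))"

definition map_second_fundamental_form ::
    "('n, 'b::euclidean_space) atlas \<Rightarrow> ('m \<Rightarrow> 'n) \<Rightarrow> ('m vfield \<Rightarrow> 'm vfield \<Rightarrow> 'm vfield) \<Rightarrow>
     ('m vfield \<Rightarrow> ('m \<Rightarrow> 'n tvec) \<Rightarrow> ('m \<Rightarrow> 'n tvec)) \<Rightarrow>
     'm vfield \<Rightarrow> 'm vfield \<Rightarrow> ('m \<Rightarrow> 'n tvec)"
  where "map_second_fundamental_form \<B> \<pi> D P E F =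
    P E (push_field \<B> \<pi> F) - push_field \<B> \<pi> (D E F)"

definition totally_geodesic_map ::
    "('m, 'a::euclidean_space) atlas \<Rightarrow> ('n, 'b::euclidean_space) atlas \<Rightarrow> ('m \<Rightarrow> 'n) \<Rightarrow>
     ('m vfield \<Rightarrow> 'm vfield \<Rightarrow> 'm vfield) \<Rightarrow>
     ('m vfield \<Rightarrow> ('m \<Rightarrow> 'n tvec) \<Rightarrow> ('m \<Rightarrow> 'n tvec)) \<Rightarrow> bool"
  where "totally_geodesic_map \<A> \<B> \<pi> D P \<longleftrightarrow>
    (\<forall>E \<in> vector_fields \<A>. \<forall>F \<in> vector_fields \<A>.
       map_second_fundamental_form \<B> \<pi> D P E F = 0)"

end

(* Since pi_* W = 0 for vertical W, the second fundamental form of pi on (E, W) is -pi_*(D_E W).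
   On horizontal lifts of gradients it vanishes by Koszul's formula; near every point these lifts
   and the vertical fields span all fields, so pi is totally geodesic iff D_E W is vertical for
   vertical W and horizontal or vertical E.  The formula for D J then gives, for vertical V, W and
   horizontal X,
     T_V JW = (J H D_V W),   A_X JW = (J H D_X W) - 1/2 (omega(W) JX + Omega(X,W) B1),
   H being the horizontal projection.  Hence the second equation says that D_X W is vertical.  In
   the first one T_V JW is vertical and the other two terms are horizontal, so it says that D_V W
   is vertical and omega(W) JV + g(V,W) A = 0.  The latter is automatic when pi is totally geodesic:
   metric compatibility turns H D_X = 0 on vertical fields into A_X JW = 0, so that
   omega(W) JX + Omega(X,W) B1 = 0, and one takes X = JV. *)

theory Submission
  imports Defs
begin

text \<open>The obstacle is that all objects are global: tangent vectors are derivations of the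
  algebra of globally smooth functions, and \<open>D\<close> and \<open>D\<^sub>B\<close> act on
  globally defined fields. Local frames are replaced by global fields that form a frame only where
  none of them vanishes. Denominators are cleared by a function that is nonzero at the given point,
  and tensoriality allows division by its value there. Bump functions and Hadamard's lemma supply
  the coordinate fields.

  Gradients of \<open>h \<circ> \<pi>\<close> serve as basic fields because their smoothness and
  their relation to gradients on the base follow from duality alone. On a pair (vertical V, basic X)
  the second fundamental form is reduced to the pair (X, V), since [V, X] is vertical.

  \<open>lcK_manifold\<close> provides integrability of J, d\<omega> = 0 and d\<Omega> = \<omega>
  \<and> \<Omega>, not the formula for D J. The latter comes from 2 g((D_X J)Y, Z) = d\<Omega>(X,
  JY, JZ) - d\<Omega>(X, Y, Z), valid when the Nijenhuis tensor vanishes.\<close>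

section \<open>Calculus of smooth functions\<close>

lemma Ck_on_subset: "Ck_on k S f \<Longrightarrow> T \<subseteq> S \<Longrightarrow> Ck_on k T f"
proof (induction k arbitrary: f)
  case 0
  then show ?case by (auto intro: continuous_on_subset)
next
  case (Suc k)
  then show ?case by (auto simp: subset_iff)
qed

lemma Ck_on_local:
  "(\<And>x. x \<in> S \<Longrightarrow> \<exists>T. open T \<and> x \<in> T \<and> Ck_on k T f) \<Longrightarrow> Ck_on k S f"
proof (induction k arbitrary: f)
  case 0
  show ?case
    unfolding Ck_on.simps
  proof (rule continuous_at_imp_continuous_on, rule ballI)
    show "isCont f x" if "x \<in> S" for x
      using 0[OF that] continuous_on_eq_continuous_at by auto
  qed
next
  case (Suc k)
  show ?case
    unfolding Ck_on.simps
  proof (intro conjI ballI allI)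
    show "f differentiable at x" if "x \<in> S" for x
      using Suc.prems[OF that] by auto
    show "Ck_on k S (\<lambda>x. frechet_derivative f (at x) v)" for v
    proof (rule Suc.IH)
      show "\<exists>T. open T \<and> x \<in> T \<and> Ck_on k T (\<lambda>x. frechet_derivative f (at x) v)" if "x \<in> S" for x
        using Suc.prems[OF that] by auto
    qed
  qed
qed

lemma has_derivative_cong_open:
  assumes "open S" "x \<in> S" "\<And>y. y \<in> S \<Longrightarrow> f y = g y"
  shows "(f has_derivative D) (at x) \<longleftrightarrow> (g has_derivative D) (at x)"
proof
  show "(f has_derivative D) (at x) \<Longrightarrow> (g has_derivative D) (at x)"
    by (erule has_derivative_transform_within_open[OF _ assms(1,2)]) (simp add: assms(3))
  show "(g has_derivative D) (at x) \<Longrightarrow> (f has_derivative D) (at x)"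
    by (erule has_derivative_transform_within_open[OF _ assms(1,2)]) (simp add: assms(3))
qed

text \<open>Holds also where no derivative exists: \<open>frechet_derivative\<close> is a choice
  among the derivatives at the point, and both functions have the same ones.\<close>

lemma frechet_derivative_cong_open:
  assumes "open S" "x \<in> S" "\<And>y. y \<in> S \<Longrightarrow> f y = g y"
  shows "frechet_derivative f (at x) = frechet_derivative g (at x)"
  unfolding frechet_derivative_def by (simp add: has_derivative_cong_open[OF assms])

lemma Ck_on_cong:
  assumes "open S" and "\<And>x. x \<in> S \<Longrightarrow> f x = g x"
  shows "Ck_on k S f \<longleftrightarrow> Ck_on k S g"
  using assms(2)
proof (induction k arbitrary: f g)
  case 0
  then show ?case by (auto intro!: continuous_on_cong)
next
  case (Suc k)
  have "f differentiable at x \<longleftrightarrow> g differentiable at x" if "x \<in> S" for x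
    unfolding differentiable_def
    by (simp add: has_derivative_cong_open[OF assms(1) that Suc.prems])
  moreover have "Ck_on k S (\<lambda>x. frechet_derivative f (at x) v)
      \<longleftrightarrow> Ck_on k S (\<lambda>x. frechet_derivative g (at x) v)" for v
    by (intro Suc.IH) (simp add: frechet_derivative_cong_open[OF assms(1) _ Suc.prems])
  ultimately show ?case by auto
qed

text \<open>Allows an explicit formula for the derivative in place of
  \<open>frechet_derivative\<close>. Openness of \<open>S\<close> makes the two agree near each
  point, so they have the same higher derivatives.\<close>

lemma Ck_on_Suc_I:
  assumes "open S" "\<And>x. x \<in> S \<Longrightarrow> (f has_derivative f' x) (at x)"
    "\<And>v. Ck_on k S (\<lambda>x. f' x v)"
  shows "Ck_on (Suc k) S f"
  unfolding Ck_on.simps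
proof (intro conjI ballI allI)
  show "f differentiable at x" if "x \<in> S" for x
    using assms(2)[OF that] differentiable_def by blast
  show "Ck_on k S (\<lambda>x. frechet_derivative f (at x) v)" for v
    by (rule Ck_on_cong[OF assms(1), THEN iffD1, OF _ assms(3)])
      (simp add: frechet_derivative_at[OF assms(2), symmetric])
qed

lemma Ck_on_SucD:
  assumes "Ck_on (Suc k) S f" and "x \<in> S"
  shows "(f has_derivative frechet_derivative f (at x)) (at x)"
  using assms frechet_derivative_works by auto

lemma Ck_on_Suc_imp: "Ck_on (Suc k) S f \<Longrightarrow> Ck_on k S f"
proof (induction k arbitrary: f)
  case 0
  then show ?case
    by (auto intro!: continuous_at_imp_continuous_on differentiable_imp_continuous_within)
next
  case (Suc k)
  from Suc.prems have "f differentiable at x" if "x \<in> S" for x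
    using that by auto
  moreover have "Ck_on k S (\<lambda>x. frechet_derivative f (at x) v)" for v
    using Suc.prems by (intro Suc.IH) auto
  ultimately show ?case by simp
qed

lemma Ck_on_imp_continuous_on: "Ck_on k S f \<Longrightarrow> continuous_on S f"
proof (induction k)
  case (Suc k)
  then show ?case using Ck_on_Suc_imp by blast
qed simp

lemma Ck_on_const: "Ck_on k S (\<lambda>x. c)"
proof (induction k arbitrary: c)
  case (Suc k)
  show ?case using Suc by (simp)
qed simp

lemma Ck_on_bounded_linear_compose:
  assumes "open S" "bounded_linear L"
  shows "Ck_on k S f \<Longrightarrow> Ck_on k S (\<lambda>x. L (f x))"
proof (induction k arbitrary: f)
  case 0
  then show ?case using assms(2) by (auto intro: linear_continuous_on_compose bounded_linear.continuous_on)
next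
  case (Suc k)
  show ?case
  proof (rule Ck_on_Suc_I[OF assms(1)])
    show "((\<lambda>x. L (f x)) has_derivative (\<lambda>v. L (frechet_derivative f (at x) v))) (at x)"
      if "x \<in> S" for x
      using bounded_linear.has_derivative[OF assms(2) Ck_on_SucD[OF Suc.prems that]] .
    show "Ck_on k S (\<lambda>x. L (frechet_derivative f (at x) v))" for v
      using Suc.prems by (intro Suc.IH) auto
  qed
qed

lemma Ck_on_id: "open S \<Longrightarrow> Ck_on k S (\<lambda>x. x)"
proof (cases k)
  case (Suc m)
  assume "open S"
  then show ?thesis
    unfolding Suc by (intro Ck_on_Suc_I[where f' = "\<lambda>x v. v"] Ck_on_const) (auto)
qed simp

lemma Ck_on_add:
  assumes "open S"
  shows "Ck_on k S f \<Longrightarrow> Ck_on k S g \<Longrightarrow> Ck_on k S (\<lambda>x. f x + g x)"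
proof (induction k arbitrary: f g)
  case 0
  then show ?case by (auto intro: continuous_on_add)
next
  case (Suc k)
  show ?case
  proof (rule Ck_on_Suc_I[OF assms])
    show "((\<lambda>x. f x + g x) has_derivative
        (\<lambda>v. frechet_derivative f (at x) v + frechet_derivative g (at x) v)) (at x)"
      if "x \<in> S" for x
      using has_derivative_add[OF Ck_on_SucD[OF Suc.prems(1) that] Ck_on_SucD[OF Suc.prems(2) that]] .
    show "Ck_on k S (\<lambda>x. frechet_derivative f (at x) v + frechet_derivative g (at x) v)" for v
      using Suc.prems by (intro Suc.IH) auto
  qed
qed

lemma Ck_on_sum:
  assumes "open S" and "\<And>i. i \<in> I \<Longrightarrow> Ck_on k S (f i)"
  shows "Ck_on k S (\<lambda>x. \<Sum>i\<in>I. f i x)"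
  using assms(2)
  by (induction I rule: infinite_finite_induct) (auto intro: Ck_on_const Ck_on_add[OF assms(1)])

lemma Ck_on_mult:
  fixes f g :: "'a::euclidean_space \<Rightarrow> real"
  assumes "open S"
  shows "Ck_on k S f \<Longrightarrow> Ck_on k S g \<Longrightarrow> Ck_on k S (\<lambda>x. f x * g x)"
proof (induction k arbitrary: f g)
  case 0
  then show ?case by (auto intro: continuous_on_mult)
next
  case (Suc k)
  show ?case
  proof (rule Ck_on_Suc_I[OF assms])
    show "((\<lambda>x. f x * g x) has_derivative
        (\<lambda>v. f x * frechet_derivative g (at x) v + frechet_derivative f (at x) v * g x)) (at x)"
      if "x \<in> S" for x
      using has_derivative_mult[OF Ck_on_SucD[OF Suc.prems(1) that] Ck_on_SucD[OF Suc.prems(2) that]] .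
    have "Ck_on k S f" "Ck_on k S g" using Suc.prems Ck_on_Suc_imp by blast+
    then show "Ck_on k S (\<lambda>x. f x * frechet_derivative g (at x) v
        + frechet_derivative f (at x) v * g x)" for v
      using Suc.prems by (intro Ck_on_add[OF assms] Suc.IH) auto
  qed
qed

lemma Ck_on_inverse:
  fixes f :: "'a::euclidean_space \<Rightarrow> real"
  assumes "open S" and nz: "\<And>x. x \<in> S \<Longrightarrow> f x \<noteq> 0"
  shows "Ck_on k S f \<Longrightarrow> Ck_on k S (\<lambda>x. inverse (f x))"
proof (induction k)
  case 0
  then show ?case using nz by (auto intro: continuous_on_inverse)
next
  case (Suc k)
  show ?case
  proof (rule Ck_on_Suc_I[OF assms(1)])
    show "((\<lambda>x. inverse (f x)) has_derivative
        (\<lambda>v. -1 * (inverse (f x) * frechet_derivative f (at x) v * inverse (f x)))) (at x)"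
      if "x \<in> S" for x
      using Deriv.has_derivative_inverse[OF nz[OF that] Ck_on_SucD[OF Suc.prems that]] by simp
    have "Ck_on k S (\<lambda>x. inverse (f x))"
      using Suc Ck_on_Suc_imp by blast
    then show "Ck_on k S (\<lambda>x. -1 * (inverse (f x) * frechet_derivative f (at x) v * inverse (f x)))" for v
      using Suc.prems by (intro Ck_on_mult[OF assms(1)] Ck_on_const) auto
  qed
qed

text \<open>The chain rule is expanded in the standard basis. The derivative then becomes a sum of
  products of components of h' with partial derivatives of \<open>f\<close> composed with
  \<open>h\<close>, and the induction hypothesis applies to the latter.\<close>

lemma Ck_on_compose:
  fixes f :: "'b::euclidean_space \<Rightarrow> real" and h :: "'a::euclidean_space \<Rightarrow> 'b"
  assumes "open S" and "h ` S \<subseteq> T"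
  shows "Ck_on k T f \<Longrightarrow> Ck_on k S h \<Longrightarrow> Ck_on k S (\<lambda>x. f (h x))"
proof (induction k arbitrary: f)
  case 0
  then show ?case using assms(2) by (auto intro: continuous_on_compose2)
next
  case (Suc k)
  let ?F = "\<lambda>y. frechet_derivative f (at y)" and ?H = "\<lambda>x. frechet_derivative h (at x)"
  show ?case
  proof (rule Ck_on_Suc_I[OF assms(1)])
    show "((\<lambda>x. f (h x)) has_derivative (\<lambda>v. \<Sum>i\<in>Basis. (?H x v \<bullet> i) * ?F (h x) i)) (at x)"
      if "x \<in> S" for x
    proof -
      have F: "(f has_derivative ?F (h x)) (at (h x))"
        using Ck_on_SucD[OF Suc.prems(1)] that assms(2) by auto
      then have lin: "linear (?F (h x))" by (rule has_derivative_linear)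
      have repr: "?F (h x) w = (\<Sum>i\<in>Basis. (w \<bullet> i) * ?F (h x) i)" for w
      proof -
        have "?F (h x) w = ?F (h x) (\<Sum>i\<in>Basis. (w \<bullet> i) *\<^sub>R i)"
          by (simp only: euclidean_representation)
        also have "\<dots> = (\<Sum>i\<in>Basis. ?F (h x) ((w \<bullet> i) *\<^sub>R i))"
          by (rule linear_sum[OF lin])
        finally show ?thesis by (simp only: linear_cmul[OF lin] real_scaleR_def)
      qed
      have "((\<lambda>x. f (h x)) has_derivative (\<lambda>v. ?F (h x) (?H x v))) (at x)"
        using has_derivative_compose[OF Ck_on_SucD[OF Suc.prems(2) that] F] .
      then show ?thesis unfolding repr[of "?H x _"] .
    qed
    have h: "Ck_on k S h" using Suc.prems Ck_on_Suc_imp by blast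
    show "Ck_on k S (\<lambda>x. \<Sum>i\<in>Basis. (?H x v \<bullet> i) * ?F (h x) i)" for v
      using Suc.prems h assms(1)
      by (intro Ck_on_sum Ck_on_mult Suc.IH Ck_on_bounded_linear_compose[OF _ bounded_linear_inner_left]) auto
  qed
qed

section \<open>Differentiability of all orders\<close>

lemma smooth_on_subset: "smooth_on S f \<Longrightarrow> T \<subseteq> S \<Longrightarrow> smooth_on T f"
  unfolding smooth_on_def using Ck_on_subset by blast

lemma smooth_on_local:
  "(\<And>x. x \<in> S \<Longrightarrow> \<exists>T. open T \<and> x \<in> T \<and> smooth_on T f) \<Longrightarrow> smooth_on S f"
  unfolding smooth_on_def
proof
  fix k
  assume "\<And>x. x \<in> S \<Longrightarrow> \<exists>T. open T \<and> x \<in> T \<and> (\<forall>k. Ck_on k T f)"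
  then show "Ck_on k S f" by (intro Ck_on_local) blast
qed

lemma smooth_on_cong:
  assumes "open S" "\<And>x. x \<in> S \<Longrightarrow> f x = g x" "smooth_on S f"
  shows "smooth_on S g"
  using assms(3) unfolding smooth_on_def by (simp add: Ck_on_cong[OF assms(1,2)])

lemma smooth_on_const: "smooth_on S (\<lambda>x. c)"
  by (simp add: smooth_on_def Ck_on_const)

lemma smooth_on_id: "open S \<Longrightarrow> smooth_on S (\<lambda>x. x)"
  by (simp add: smooth_on_def Ck_on_id)

lemma smooth_on_bounded_linear_compose:
  "open S \<Longrightarrow> bounded_linear L \<Longrightarrow> smooth_on S f \<Longrightarrow> smooth_on S (\<lambda>x. L (f x))"
  by (simp add: smooth_on_def Ck_on_bounded_linear_compose)

lemma smooth_on_add: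
  "open S \<Longrightarrow> smooth_on S f \<Longrightarrow> smooth_on S g \<Longrightarrow> smooth_on S (\<lambda>x. f x + g x)"
  by (simp add: smooth_on_def Ck_on_add)

lemma smooth_on_mult:
  fixes f g :: "'a::euclidean_space \<Rightarrow> real"
  shows "open S \<Longrightarrow> smooth_on S f \<Longrightarrow> smooth_on S g \<Longrightarrow> smooth_on S (\<lambda>x. f x * g x)"
  by (simp add: smooth_on_def Ck_on_mult)

lemma smooth_on_inverse:
  fixes f :: "'a::euclidean_space \<Rightarrow> real"
  shows "open S \<Longrightarrow> (\<And>x. x \<in> S \<Longrightarrow> f x \<noteq> 0) \<Longrightarrow> smooth_on S f \<Longrightarrow> smooth_on S (\<lambda>x. inverse (f x))"
  by (simp add: smooth_on_def Ck_on_inverse)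

lemma smooth_on_compose:
  fixes f :: "'b::euclidean_space \<Rightarrow> real" and h :: "'a::euclidean_space \<Rightarrow> 'b"
  shows "open S \<Longrightarrow> h ` S \<subseteq> T \<Longrightarrow> smooth_on T f \<Longrightarrow> smooth_on S h \<Longrightarrow> smooth_on S (\<lambda>x. f (h x))"
  unfolding smooth_on_def by (blast intro: Ck_on_compose)

lemma smooth_on_frechet_derivative:
  "smooth_on S f \<Longrightarrow> smooth_on S (\<lambda>x. frechet_derivative f (at x) v)"
  unfolding smooth_on_def
proof
  show "Ck_on k S (\<lambda>x. frechet_derivative f (at x) v)" if "\<forall>k. Ck_on k S f" for k
    using that[rule_format, of "Suc k"] by simp
qed

lemma smooth_on_has_derivative:
  "smooth_on S f \<Longrightarrow> x \<in> S \<Longrightarrow> (f has_derivative frechet_derivative f (at x)) (at x)"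
  unfolding smooth_on_def using Ck_on_SucD by blast

lemma smooth_on_imp_continuous_on: "smooth_on S f \<Longrightarrow> continuous_on S f"
  unfolding smooth_on_def by (metis Ck_on.simps(1))

section \<open>Bump functions and Hadamard's lemma\<close>

text \<open>The factors \<open>1 / x ^ k\<close> give a family whose derivatives are again linear
  combinations of its members, so smoothness follows by induction on the order with \<open>k\<close>
  arbitrary.\<close>

definition exp_tail :: "nat \<Rightarrow> real \<Rightarrow> real"
  where "exp_tail k x = (if x > 0 then exp (- 1 / x) / x ^ k else 0)"

lemma exp_tail_has_real_derivative:
  "(exp_tail k has_real_derivative exp_tail (k + 2) x - real k * exp_tail (k + 1) x) (at x)"
proof (cases "x = 0")
  case True
  have "((\<lambda>y. exp_tail k y / y) \<longlongrightarrow> 0) (at_left 0)"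
    by (rule tendsto_eventually) (auto simp: exp_tail_def eventually_at_filter)
  \<comment> \<open>With u = 1/y the difference quotient at 0 is u^(k+1) / exp u, and the
    exponential wins as u tends to infinity.\<close>
  moreover have "((\<lambda>y::real. inverse y ^ Suc k / exp (inverse y)) \<longlongrightarrow> 0) (at_right 0)"
    using filterlim_compose[OF tendsto_power_div_exp_0 filterlim_inverse_at_top_right] .
  then have "((\<lambda>y. exp_tail k y / y) \<longlongrightarrow> 0) (at_right 0)"
    by (rule Lim_transform_eventually) (auto simp: exp_tail_def eventually_at_filter exp_minus field_simps)
  ultimately have "((\<lambda>y. exp_tail k y / y) \<longlongrightarrow> 0) (at 0)"
    by (rule filterlim_split_at)
  then show ?thesis
    using True by (simp add: has_field_derivative_iff exp_tail_def)
next
  case False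
  show ?thesis
  proof (cases "x > 0")
    case True
    have "((\<lambda>x. exp (- 1 / x) / x ^ k) has_real_derivative
        (exp (- 1 / x) * (1 / x\<^sup>2) * x ^ k - exp (- 1 / x) * (real k * x ^ (k - 1))) / (x ^ k * x ^ k)) (at x)"
      using True by (auto intro!: derivative_eq_intros simp: power2_eq_square)
    moreover have "(exp (- 1 / x) * (1 / x\<^sup>2) * x ^ k - exp (- 1 / x) * (real k * x ^ (k - 1))) / (x ^ k * x ^ k)
        = exp_tail (k + 2) x - real k * exp_tail (k + 1) x"
      using True by (cases k) (simp_all add: exp_tail_def power_add power2_eq_square diff_divide_distrib)
    ultimately have "((\<lambda>x. exp (- 1 / x) / x ^ k) has_real_derivative
        exp_tail (k + 2) x - real k * exp_tail (k + 1) x) (at x)"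
      by (simp only:)
    then show ?thesis
      by (rule has_field_derivative_transform_within_open[where S = "{0<..}"])
        (use True in \<open>auto simp: exp_tail_def\<close>)
  next
    case neg: False
    have "((\<lambda>x. 0) has_real_derivative 0) (at x)"
      by simp
    then have "(exp_tail k has_real_derivative 0) (at x)"
      by (rule has_field_derivative_transform_within_open[where S = "{..<0}"])
        (use neg False in \<open>auto simp: exp_tail_def\<close>)
    then show ?thesis
      using neg by (simp add: exp_tail_def)
  qed
qed

lemma Ck_on_exp_tail: "Ck_on m UNIV (exp_tail k)"
proof (induction m arbitrary: k)
  case 0
  show ?case
    by (auto intro!: continuous_at_imp_continuous_on DERIV_isCont[OF exp_tail_has_real_derivative])
next
  case (Suc m)
  show ?case
  proof (rule Ck_on_Suc_I)
    show "(exp_tail k has_derivative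
        (\<lambda>v. (exp_tail (k + 2) x + (- real k) * exp_tail (k + 1) x) * v)) (at x)" for x
      using exp_tail_has_real_derivative[of k x] by (simp add: has_field_derivative_def)
    show "Ck_on m UNIV (\<lambda>x. (exp_tail (k + 2) x + (- real k) * exp_tail (k + 1) x) * v)" for v
      by (intro Ck_on_mult Ck_on_add Ck_on_const Suc.IH) auto
  qed simp
qed

lemma smooth_bump_exists:
  fixes c :: "'a::euclidean_space"
  assumes "r > 0"
  obtains b :: "'a \<Rightarrow> real" where "smooth_on UNIV b" "b c = 1" "\<And>x. b x \<noteq> 0 \<Longrightarrow> x \<in> ball c r"
proof
  \<comment> \<open>Positive exactly where |x - c| < r; the second factor normalises the value at
    the centre to 1.\<close>
  define b where "b x = exp_tail 0 (r\<^sup>2 + - ((x - c) \<bullet> (x - c))) * inverse (exp_tail 0 (r\<^sup>2))" for x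
  have inner_self: "(x - c) \<bullet> (x - c) = (\<Sum>i\<in>Basis. ((x + - c) \<bullet> i) * ((x + - c) \<bullet> i))" for x
    by (subst euclidean_inner) simp
  have "smooth_on UNIV (\<lambda>x. r\<^sup>2 + - (\<Sum>i\<in>Basis. ((x + - c) \<bullet> i) * ((x + - c) \<bullet> i)))"
    unfolding smooth_on_def
    by (intro allI Ck_on_add Ck_on_const Ck_on_sum Ck_on_mult Ck_on_id
        Ck_on_bounded_linear_compose[OF _ bounded_linear_minus[OF bounded_linear_ident]]
        Ck_on_bounded_linear_compose[OF _ bounded_linear_inner_left]) auto
  then have *: "smooth_on UNIV (\<lambda>x. r\<^sup>2 + - ((x - c) \<bullet> (x - c)))"
    by (simp add: inner_self)
  show "smooth_on UNIV b"
    unfolding b_def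
    by (intro smooth_on_mult smooth_on_const smooth_on_compose[OF _ _ _ *, where T = UNIV])
      (auto simp: smooth_on_def Ck_on_exp_tail)
  show "b c = 1"
    using assms by (simp add: b_def exp_tail_def)
  show "x \<in> ball c r" if "b x \<noteq> 0" for x
  proof -
    have "(x - c) \<bullet> (x - c) < r\<^sup>2"
      using that by (auto simp: b_def exp_tail_def split: if_splits)
    then have "(norm (x - c))\<^sup>2 < r\<^sup>2"
      by (simp add: power2_norm_eq_inner)
    then show ?thesis
      using assms by (simp add: dist_norm norm_minus_commute power2_less_imp_less)
  qed
qed

text \<open>Differentiation under the integral sign turns \<open>f (c + t *\<^sub>R (x - c))\<close>
  into \<open>t\<close> times a partial derivative. The weight \<open>t ^ m\<close> absorbs this
  factor, so the induction runs with \<open>m\<close> arbitrary.\<close>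

lemma Ck_on_radial_integral:
  fixes f :: "'a::euclidean_space \<Rightarrow> real" and c :: 'a
  shows "Ck_on k (ball c r) f \<Longrightarrow>
    Ck_on k (ball c r) (\<lambda>x. integral (cbox 0 1) (\<lambda>t. t ^ m * f (c + t *\<^sub>R (x - c))))"
proof (induction k arbitrary: f m)
  have seg: "c + t *\<^sub>R (x - c) \<in> ball c r" if "x \<in> ball c r" "t \<in> cbox 0 1" for x t
  proof -
    have "t * norm (x - c) \<le> 1 * norm (x - c)"
      using that by (intro mult_right_mono) auto
    then show ?thesis
      using that by (simp add: dist_norm norm_minus_commute)
  qed
  have cont: "continuous_on (ball c r \<times> cbox 0 1) (\<lambda>(x, t). t ^ m * h (c + t *\<^sub>R (x - c)))"
    if "continuous_on (ball c r) h" for h :: "'a \<Rightarrow> real" and m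
    unfolding split_beta
    by (intro continuous_intros continuous_on_compose2[OF that]) (auto intro: seg)
  {
    case 0
    then show ?case
      unfolding Ck_on.simps by (intro integral_continuous_on_param cont)
  next
    case (Suc k)
    let ?F = "\<lambda>y. frechet_derivative f (at y)"
    have F: "(f has_derivative ?F y) (at y)" if "y \<in> ball c r" for y
      using Ck_on_SucD[OF Suc.prems that] .
    \<comment> \<open>Leibniz' rule takes the derivative as a continuous family of bounded linear
      maps; its continuity is then checked on basis vectors only.\<close>
    define fx where "fx x t = Blinfun (\<lambda>v. t ^ m * ?F (c + t *\<^sub>R (x - c)) (t *\<^sub>R v))" for x t
    have fx: "blinfun_apply (fx x t) = (\<lambda>v. t ^ m * ?F (c + t *\<^sub>R (x - c)) (t *\<^sub>R v))"
      and fx_deriv: "((\<lambda>x. t ^ m * f (c + t *\<^sub>R (x - c))) has_derivative blinfun_apply (fx x t)) (at x)"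
      if "x \<in> ball c r" "t \<in> cbox 0 1" for x t
    proof -
      have "((\<lambda>x. c + t *\<^sub>R (x - c)) has_derivative (\<lambda>v. t *\<^sub>R v)) (at x)"
        by (auto intro!: derivative_eq_intros)
      then have "((\<lambda>x. f (c + t *\<^sub>R (x - c))) has_derivative
          (\<lambda>v. ?F (c + t *\<^sub>R (x - c)) (t *\<^sub>R v))) (at x)"
        by (rule has_derivative_compose) (rule F[OF seg[OF that]])
      then have "((\<lambda>x. t ^ m * f (c + t *\<^sub>R (x - c))) has_derivative
          (\<lambda>v. t ^ m * ?F (c + t *\<^sub>R (x - c)) (t *\<^sub>R v))) (at x)"
        by (rule has_derivative_mult_right)
      then show "blinfun_apply (fx x t) = (\<lambda>v. t ^ m * ?F (c + t *\<^sub>R (x - c)) (t *\<^sub>R v))"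
        "((\<lambda>x. t ^ m * f (c + t *\<^sub>R (x - c))) has_derivative blinfun_apply (fx x t)) (at x)"
        unfolding fx_def by (simp_all add: bounded_linear_Blinfun_apply has_derivative_bounded_linear)
    qed
    have fx_eq: "fx x t v = t ^ Suc m * ?F (c + t *\<^sub>R (x - c)) v"
      if "x \<in> ball c r" "t \<in> cbox 0 1" for x t v
      using linear_scale[OF has_derivative_linear[OF F[OF seg[OF that]]]] by (simp add: fx[OF that])
    have cont_fx: "continuous_on (ball c r \<times> cbox 0 1) (\<lambda>(x, t). fx x t)"
    proof (rule continuous_on_blinfun_componentwise)
      fix i :: 'a
      have "Ck_on k (ball c r) (\<lambda>y. ?F y i)"
        using Suc.prems by auto
      then have "continuous_on (ball c r) (\<lambda>y. ?F y i)"
        by (rule Ck_on_imp_continuous_on)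
      from cont[OF this, of "Suc m"]
      show "continuous_on (ball c r \<times> cbox 0 1) (\<lambda>p. blinfun_apply (case p of (x, t) \<Rightarrow> fx x t) i)"
        by (rule continuous_on_eq) (auto simp: fx_eq simp del: power_Suc)
    qed
    show ?case
    proof (rule Ck_on_Suc_I)
      fix x
      assume x: "x \<in> ball c r"
      have cf: "continuous_on (ball c r) f"
        using Ck_on_Suc_imp[OF Suc.prems] by (rule Ck_on_imp_continuous_on)
      have der: "((\<lambda>x. integral (cbox 0 1) (\<lambda>t. t ^ m * f (c + t *\<^sub>R (x - c)))) has_derivative
          blinfun_apply (integral (cbox 0 1) (fx x))) (at x within ball c r)"
      proof (rule leibniz_rule[OF _ _ cont_fx x convex_ball])
        show "((\<lambda>x. t ^ m * f (c + t *\<^sub>R (x - c))) has_derivative blinfun_apply (fx y t))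
            (at y within ball c r)" if "y \<in> ball c r" "t \<in> cbox 0 1" for y t
          using fx_deriv[OF that] has_derivative_at_withinI by blast
        show "(\<lambda>t. t ^ m * f (c + t *\<^sub>R (y - c))) integrable_on cbox 0 1" if "y \<in> ball c r" for y
          using that
          by (intro integrable_continuous continuous_intros continuous_on_compose2[OF cf]) (auto intro: seg)
      qed
      have apply_eq: "blinfun_apply (integral (cbox 0 1) (fx x)) v
          = integral (cbox 0 1) (\<lambda>t. t ^ Suc m * ?F (c + t *\<^sub>R (x - c)) v)" for v
      proof -
        have "fx x integrable_on cbox 0 1"
          by (intro integrable_continuous continuous_on_compose2[OF cont_fx, of _ "\<lambda>t. (x, t)", simplified])
            (use x in \<open>auto intro!: continuous_intros\<close>)
        then have "integral (cbox 0 1) (\<lambda>t. fx x t v) = blinfun_apply (integral (cbox 0 1) (fx x)) v"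
          using integral_linear[OF _ blinfun.bounded_linear_left] by (simp add: o_def)
        moreover have "integral (cbox 0 1) (\<lambda>t. fx x t v)
            = integral (cbox 0 1) (\<lambda>t. t ^ Suc m * ?F (c + t *\<^sub>R (x - c)) v)"
          by (rule Henstock_Kurzweil_Integration.integral_cong) (rule fx_eq[OF x])
        ultimately show ?thesis
          by (simp only:)
      qed
      show "((\<lambda>x. integral (cbox 0 1) (\<lambda>t. t ^ m * f (c + t *\<^sub>R (x - c)))) has_derivative
          (\<lambda>v. integral (cbox 0 1) (\<lambda>t. t ^ Suc m * ?F (c + t *\<^sub>R (x - c)) v))) (at x)"
        using der unfolding ext[OF apply_eq] at_within_open[OF x open_ball] .
    next
      show "Ck_on k (ball c r) (\<lambda>x. integral (cbox 0 1) (\<lambda>t. t ^ Suc m * ?F (c + t *\<^sub>R (x - c)) v))" for v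
        using Suc.prems by (intro Suc.IH) auto
    qed simp
  }
qed

text \<open>The fundamental theorem of calculus along the segment from \<open>c\<close> to
  \<open>x\<close>: \<open>h i\<close> is the mean of the i-th partial derivative over that segment.
  This is what makes a derivation at a point depend on first derivatives only.\<close>

lemma hadamard:
  fixes f :: "'a::euclidean_space \<Rightarrow> real"
  assumes "smooth_on (ball c r) f" and "r > 0"
  obtains h where "\<And>i. smooth_on (ball c r) (h i)"
    "\<And>i. h i c = frechet_derivative f (at c) i"
    "\<And>x. x \<in> ball c r \<Longrightarrow> f x = f c + (\<Sum>i\<in>Basis. ((x - c) \<bullet> i) * h i x)"
proof
  let ?F = "\<lambda>y. frechet_derivative f (at y)"
  \<comment> \<open>The trivial weight \<open>t ^ 0\<close> is the instance m = 0 of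
    \<open>Ck_on_radial_integral\<close>.\<close>
  define h where "h i x = integral (cbox 0 1) (\<lambda>t. t ^ 0 * ?F (c + t *\<^sub>R (x - c)) i)" for i x
  show "smooth_on (ball c r) (h i)" for i
    using smooth_on_frechet_derivative[OF assms(1)]
    unfolding smooth_on_def h_def by (intro allI Ck_on_radial_integral) simp
  show "h i c = ?F c i" for i
    by (simp add: h_def)
  fix x
  assume x: "x \<in> ball c r"
  have seg: "c + t *\<^sub>R (x - c) \<in> ball c r" if "t \<in> {0..1}" for t
  proof -
    have "t * norm (x - c) \<le> 1 * norm (x - c)"
      using that by (intro mult_right_mono) auto
    then show ?thesis
      using x that by (simp add: dist_norm norm_minus_commute)
  qed
  have F: "(f has_derivative ?F (c + t *\<^sub>R (x - c))) (at (c + t *\<^sub>R (x - c)))" if "t \<in> {0..1}" for t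
    using smooth_on_has_derivative[OF assms(1) seg[OF that]] .
  have "((\<lambda>t. ?F (c + t *\<^sub>R (x - c)) (x - c)) has_integral
      f (c + 1 *\<^sub>R (x - c)) - f (c + 0 *\<^sub>R (x - c))) {0..1}"
  proof (rule fundamental_theorem_of_calculus)
    show "((\<lambda>t. f (c + t *\<^sub>R (x - c))) has_vector_derivative ?F (c + t *\<^sub>R (x - c)) (x - c))
        (at t within {0..1})" if "t \<in> {0..1}" for t
    proof -
      have "((\<lambda>t. c + t *\<^sub>R (x - c)) has_derivative (\<lambda>s. s *\<^sub>R (x - c))) (at t within {0..1})"
        by (auto intro!: derivative_eq_intros)
      then have "((\<lambda>t. f (c + t *\<^sub>R (x - c))) has_derivative
          (\<lambda>s. ?F (c + t *\<^sub>R (x - c)) (s *\<^sub>R (x - c)))) (at t within {0..1})"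
        by (rule has_derivative_compose) (rule F[OF that])
      then show ?thesis
        using linear_scale[OF has_derivative_linear[OF F[OF that]]]
        by (simp add: has_vector_derivative_def)
    qed
  qed simp
  then have "f x - f c = integral {0..1} (\<lambda>t. ?F (c + t *\<^sub>R (x - c)) (x - c))"
    by (simp add: integral_unique)
  also have "\<dots> = integral {0..1} (\<lambda>t. \<Sum>i\<in>Basis. ((x - c) \<bullet> i) * ?F (c + t *\<^sub>R (x - c)) i)"
  proof (rule Henstock_Kurzweil_Integration.integral_cong)
    fix t :: real
    assume t: "t \<in> {0..1}"
    note lin = has_derivative_linear[OF F[OF t]]
    have "?F (c + t *\<^sub>R (x - c)) (\<Sum>i\<in>Basis. ((x - c) \<bullet> i) *\<^sub>R i)
        = (\<Sum>i\<in>Basis. ((x - c) \<bullet> i) * ?F (c + t *\<^sub>R (x - c)) i)"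
      by (simp only: linear_sum[OF lin] linear_scale[OF lin] real_scaleR_def)
    then show "?F (c + t *\<^sub>R (x - c)) (x - c) = (\<Sum>i\<in>Basis. ((x - c) \<bullet> i) * ?F (c + t *\<^sub>R (x - c)) i)"
      by (simp only: euclidean_representation)
  qed
  also have "\<dots> = (\<Sum>i\<in>Basis. integral {0..1} (\<lambda>t. ((x - c) \<bullet> i) * ?F (c + t *\<^sub>R (x - c)) i))"
  proof (rule integral_sum)
    fix i :: 'a
    have "continuous_on (ball c r) (\<lambda>y. ?F y i)"
      using smooth_on_frechet_derivative[OF assms(1)] by (rule smooth_on_imp_continuous_on)
    moreover have "continuous_on {0..1} (\<lambda>t. c + t *\<^sub>R (x - c))"
      by (intro continuous_intros)
    ultimately have "continuous_on {0..1} (\<lambda>t. ?F (c + t *\<^sub>R (x - c)) i)"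
      by (rule continuous_on_compose2) (use seg in blast)
    then show "(\<lambda>t. ((x - c) \<bullet> i) * ?F (c + t *\<^sub>R (x - c)) i) integrable_on {0..1}"
      by (intro integrable_continuous_interval continuous_on_mult continuous_on_const)
  qed simp
  finally show "f x = f c + (\<Sum>i\<in>Basis. ((x - c) \<bullet> i) * h i x)"
    by (simp add: h_def)
qed

section \<open>Smooth functions and tangent vectors on a manifold\<close>

lemma frechet_derivative_eqI: "(f has_derivative D) (at x) \<Longrightarrow> frechet_derivative f (at x) = D"
  by (metis frechet_derivative_at)

lemma sum_fun_apply: "(\<Sum>i\<in>I. f i) x = (\<Sum>i\<in>I. f i x)"
  for f :: "'i \<Rightarrow> 'x \<Rightarrow> 'y::comm_monoid_add"
  by (induction I rule: infinite_finite_induct) simp_all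

locale manifold =
  fixes \<A> :: "('m::{t2_space, second_countable_topology}, 'a::euclidean_space) atlas"
  assumes smooth_manifold: "smooth_manifold \<A>"
begin

abbreviation "C \<equiv> C_infinity \<A>"
abbreviation "T \<equiv> tangent_space \<A>"
abbreviation "VF \<equiv> vector_fields \<A>"

lemma chart_is_chart: "(U, \<phi>) \<in> \<A> \<Longrightarrow> is_chart U \<phi>"
  using smooth_manifold unfolding smooth_manifold_def by auto

lemma chart_at: obtains U \<phi> where "(U, \<phi>) \<in> \<A>" "p \<in> U"
proof -
  have "p \<in> (\<Union>(U, \<phi>) \<in> \<A>. U)"
    using smooth_manifold unfolding smooth_manifold_def by auto
  then show ?thesis
    using that by auto
qed

lemma
  assumes "(U, \<phi>) \<in> \<A>"
  shows chart_open: "open U" "open (\<phi> ` U)"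
    and chart_continuous: "continuous_on U \<phi>" "continuous_on (\<phi> ` U) (inv_into U \<phi>)"
    and chart_inv: "\<And>q. q \<in> U \<Longrightarrow> inv_into U \<phi> (\<phi> q) = q"
  using chart_is_chart[OF assms] unfolding is_chart_def homeomorphism_def by auto

lemma chart_image_open:
  assumes "(U, \<phi>) \<in> \<A>" "open W"
  shows "open (\<phi> ` (U \<inter> W))"
proof -
  have "\<phi> ` (U \<inter> W) = \<phi> ` U \<inter> inv_into U \<phi> -` W"
    using chart_inv[OF assms(1)] by (auto simp: image_iff)
  then show ?thesis
    using continuous_open_preimage[OF chart_continuous(2) chart_open(2)] assms by auto
qed

text \<open>One chart around each point suffices: the transition maps carry smoothness over to every
  other chart of the atlas.\<close>

lemma C_infinityI_local:
  assumes "\<And>p. \<exists>U \<phi> W. (U, \<phi>) \<in> \<A> \<and> open W \<and> p \<in> W \<and> W \<subseteq> U \<and> smooth_on (\<phi> ` W) (f \<circ> inv_into U \<phi>)"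
  shows "f \<in> C"
  unfolding C_infinity_def
proof (safe, rule smooth_on_local)
  fix V \<psi> x
  assume V: "(V, \<psi>) \<in> \<A>" and "x \<in> \<psi> ` V"
  then obtain p where p: "p \<in> V" "x = \<psi> p" by auto
  from assms[of p] obtain U \<phi> W where
    W: "(U, \<phi>) \<in> \<A>" "open W" "p \<in> W" "W \<subseteq> U" "smooth_on (\<phi> ` W) (f \<circ> inv_into U \<phi>)" by blast
  let ?S = "\<psi> ` (V \<inter> W)"
  have S: "open ?S" "x \<in> ?S" using chart_image_open[OF V W(2)] p W by auto
  have "smooth_on (\<psi> ` (V \<inter> U)) (\<phi> \<circ> inv_into V \<psi>)"
    using smooth_manifold V W(1) unfolding smooth_manifold_def by fast
  then have hs: "smooth_on ?S (\<phi> \<circ> inv_into V \<psi>)"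
    by (rule smooth_on_subset) (use W in auto)
  have "smooth_on ?S (\<lambda>y. (f \<circ> inv_into U \<phi>) ((\<phi> \<circ> inv_into V \<psi>) y))"
    by (rule smooth_on_compose[OF S(1) _ W(5) hs]) (auto simp: chart_inv[OF V])
  moreover have "(f \<circ> inv_into U \<phi>) ((\<phi> \<circ> inv_into V \<psi>) y) = (f \<circ> inv_into V \<psi>) y" if "y \<in> ?S" for y
    using that W(4) chart_inv[OF V] chart_inv[OF W(1)] by auto
  ultimately have "smooth_on ?S (f \<circ> inv_into V \<psi>)"
    by (rule smooth_on_cong[OF S(1), rotated])
  then show "\<exists>T. open T \<and> x \<in> T \<and> smooth_on T (f \<circ> inv_into V \<psi>)" using S by blast
qed

lemma C_infinity_smooth_on: "f \<in> C \<Longrightarrow> (U, \<phi>) \<in> \<A> \<Longrightarrow> smooth_on (\<phi> ` U) (f \<circ> inv_into U \<phi>)"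
  unfolding C_infinity_def by auto

lemma C_const: "(\<lambda>p. c) \<in> C"
  unfolding C_infinity_def by (auto simp: o_def smooth_on_const)

lemma C_add: "f \<in> C \<Longrightarrow> h \<in> C \<Longrightarrow> (\<lambda>p. f p + h p) \<in> C"
  unfolding C_infinity_def
  by (auto simp: o_def split_beta intro!: smooth_on_add chart_open(2) dest!: bspec)

lemma C_mult: "f \<in> C \<Longrightarrow> h \<in> C \<Longrightarrow> (\<lambda>p. f p * h p) \<in> C"
  unfolding C_infinity_def
  by (auto simp: o_def split_beta intro!: smooth_on_mult chart_open(2) dest!: bspec)

lemma C_minus: "f \<in> C \<Longrightarrow> (\<lambda>p. - f p) \<in> C"
  using C_mult[OF C_const[of "-1"]] by simp

lemma C_sum: "(\<And>i. i \<in> I \<Longrightarrow> f i \<in> C) \<Longrightarrow> (\<lambda>p. \<Sum>i\<in>I. f i p) \<in> C"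
  by (induction I rule: infinite_finite_induct) (simp_all add: C_const C_add)

lemma C_prod: "(\<And>i. i \<in> I \<Longrightarrow> f i \<in> C) \<Longrightarrow> (\<lambda>p. \<Prod>i\<in>I. f i p) \<in> C"
  by (induction I rule: infinite_finite_induct) (simp_all add: C_const C_mult)

lemma C_plus_fun: "f \<in> C \<Longrightarrow> h \<in> C \<Longrightarrow> f + h \<in> C"
  using C_add by (simp add: plus_fun_def)

lemma C_times_fun: "f \<in> C \<Longrightarrow> h \<in> C \<Longrightarrow> f * h \<in> C"
  using C_mult by (simp add: times_fun_def)

lemma C_scaleR_fun: "f \<in> C \<Longrightarrow> c *\<^sub>R f \<in> C"
  using C_mult[OF C_const[of c]] by (simp add: scaleR_fun_def)

lemma C_infinity_continuous:
  assumes "f \<in> C" "(U, \<phi>) \<in> \<A>"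
  shows "continuous_on U f"
proof -
  have "continuous_on U (\<lambda>q. (f \<circ> inv_into U \<phi>) (\<phi> q))"
    by (rule continuous_on_compose2[OF smooth_on_imp_continuous_on[OF C_infinity_smooth_on[OF assms]]
          chart_continuous(1)[OF assms(2)]]) simp
  then show ?thesis
    by (rule continuous_on_eq) (simp add: chart_inv[OF assms(2)])
qed

text \<open>Near \<open>p\<close> one has u = (N u) / N. The multiplier may change with
  \<open>p\<close>, which suits functions given by quotients whose denominators can vanish
  elsewhere.\<close>

lemma C_infinity_divide:
  assumes "\<And>p. \<exists>N\<in>C. N p \<noteq> 0 \<and> (\<lambda>q. N q * u q) \<in> C"
  shows "u \<in> C"
proof (rule C_infinityI_local)
  fix p
  obtain N where N: "N \<in> C" "N p \<noteq> 0" "(\<lambda>q. N q * u q) \<in> C" using assms by blast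
  obtain U \<phi> where U: "(U, \<phi>) \<in> \<A>" "p \<in> U" by (rule chart_at)
  let ?W = "U \<inter> N -` (- {0})"
  have W: "open ?W" "p \<in> ?W" "?W \<subseteq> U"
    using continuous_open_preimage[OF C_infinity_continuous[OF N(1) U(1)] chart_open(1)[OF U(1)]] N U by auto
  have op: "open (\<phi> ` ?W)"
    using chart_image_open[OF U(1) W(1)] by (simp add: Int_left_absorb)
  have "smooth_on (\<phi> ` ?W) (\<lambda>x. ((\<lambda>q. N q * u q) \<circ> inv_into U \<phi>) x * inverse ((N \<circ> inv_into U \<phi>) x))"
    using op chart_inv[OF U(1)]
    by (intro smooth_on_mult smooth_on_inverse smooth_on_subset[OF C_infinity_smooth_on[OF _ U(1)]] N) auto
  moreover have "((\<lambda>q. N q * u q) \<circ> inv_into U \<phi>) x * inverse ((N \<circ> inv_into U \<phi>) x) = (u \<circ> inv_into U \<phi>) x"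
    if "x \<in> \<phi> ` ?W" for x
    using that chart_inv[OF U(1)] by (auto simp: field_simps)
  ultimately have "smooth_on (\<phi> ` ?W) (u \<circ> inv_into U \<phi>)"
    by (rule smooth_on_cong[OF op, rotated])
  then show "\<exists>U \<phi> W. (U, \<phi>) \<in> \<A> \<and> open W \<and> p \<in> W \<and> W \<subseteq> U \<and> smooth_on (\<phi> ` W) (u \<circ> inv_into U \<phi>)"
    using U W by blast
qed

text \<open>The only delicate points lie outside \<open>U\<close>. The preimage of \<open>K\<close>
  is compact, hence closed because the manifold is Hausdorff, so such a point has a neighbourhood on
  which the function is zero.\<close>

lemma C_infinity_extend_by_zero:
  fixes u :: "'a \<Rightarrow> real"
  assumes U: "(U, \<phi>) \<in> \<A>" and u: "smooth_on (\<phi> ` U) u" and K: "compact K" "K \<subseteq> \<phi> ` U"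
    and u0: "\<And>x. x \<notin> K \<Longrightarrow> u x = 0"
  shows "(\<lambda>q. if q \<in> U then u (\<phi> q) else 0) \<in> C" (is "?f \<in> C")
proof (rule C_infinityI_local)
  fix p
  show "\<exists>U \<phi> W. (U, \<phi>) \<in> \<A> \<and> open W \<and> p \<in> W \<and> W \<subseteq> U \<and> smooth_on (\<phi> ` W) (?f \<circ> inv_into U \<phi>)"
  proof (cases "p \<in> U")
    case True
    have "smooth_on (\<phi> ` U) (?f \<circ> inv_into U \<phi>)"
      by (rule smooth_on_cong[OF chart_open(2)[OF U] _ u]) (auto simp: chart_inv[OF U])
    then show ?thesis
      using True U chart_open(1)[OF U] by blast
  next
    case False
    obtain V \<psi> where V: "(V, \<psi>) \<in> \<A>" "p \<in> V" by (rule chart_at)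
    let ?L = "inv_into U \<phi> ` K"
    have "closed ?L"
      using K chart_continuous(2)[OF U] by (intro compact_imp_closed compact_continuous_image)
        (auto intro: continuous_on_subset)
    then have W: "open (V - ?L)" "V \<inter> (V - ?L) = V - ?L"
      using chart_open(1)[OF V(1)] by auto
    have "?L \<subseteq> U" using K(2) chart_inv[OF U] by auto
    have op: "open (\<psi> ` (V - ?L))"
      using chart_image_open[OF V(1) W(1)] W(2) by simp
    have "(?f \<circ> inv_into V \<psi>) x = 0" if "x \<in> \<psi> ` (V - ?L)" for x
    proof -
      from that obtain q where q: "q \<in> V" "q \<notin> ?L" "x = \<psi> q" by auto
      have "\<phi> q \<notin> K" if "q \<in> U"
        using that q(2) chart_inv[OF U that] by (metis image_eqI)
      then show ?thesis using q chart_inv[OF V(1)] u0 by auto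
    qed
    then have "smooth_on (\<psi> ` (V - ?L)) (?f \<circ> inv_into V \<psi>)"
      by (intro smooth_on_cong[OF op _ smooth_on_const[of _ 0]]) (rule sym)
    moreover have "p \<in> V - ?L" using V False \<open>?L \<subseteq> U\<close> by auto
    ultimately show ?thesis using V W(1) by blast
  qed
qed

section \<open>Tangent vectors as derivations\<close>

lemma
  assumes "v \<in> T p"
  shows T_add: "\<And>f h. f \<in> C \<Longrightarrow> h \<in> C \<Longrightarrow> v (f + h) = v f + v h"
    and T_scale: "\<And>c f. f \<in> C \<Longrightarrow> v (c *\<^sub>R f) = c * v f"
    and T_mult: "\<And>f h. f \<in> C \<Longrightarrow> h \<in> C \<Longrightarrow> v (f * h) = v f * h p + f p * v h"
    and T_outside: "\<And>f. f \<notin> C \<Longrightarrow> v f = 0"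
  using assms unfolding tangent_space_def by auto

lemma T_const:
  assumes "v \<in> T p"
  shows "v (\<lambda>q. c) = 0"
proof -
  have "(1 :: 'm \<Rightarrow> real) \<in> C" using C_const[of 1] by (simp add: one_fun_def)
  moreover have "(1 :: 'm \<Rightarrow> real) * 1 = 1" "(\<lambda>q. c) = c *\<^sub>R (1 :: 'm \<Rightarrow> real)"
    by (simp_all add: fun_eq_iff)
  ultimately show ?thesis
    using T_mult[OF assms, of 1 1] T_scale[OF assms, of 1 c] by simp
qed

lemma T_sum:
  assumes "v \<in> T p"
  shows "(\<And>i. i \<in> I \<Longrightarrow> f i \<in> C) \<Longrightarrow> v (\<Sum>i\<in>I. f i) = (\<Sum>i\<in>I. v (f i)) \<and> (\<Sum>i\<in>I. f i) \<in> C"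
proof (induction I rule: infinite_finite_induct)
  case (insert i I)
  have "f i \<in> C" "sum f I \<in> C" "v (sum f I) = (\<Sum>i\<in>I. v (f i))"
    using insert by blast+
  then show ?case
    using T_add[OF assms, of "f i" "sum f I"] C_plus_fun[of "f i" "sum f I"]
    by (simp only: sum.insert[OF insert.hyps] simp_thms)
qed (use T_const[OF assms, of 0] C_const[of 0] in \<open>simp_all add: zero_fun_def\<close>)

lemma T_zero: "0 \<in> T p"
  unfolding tangent_space_def by simp

lemma T_plus: "u \<in> T p \<Longrightarrow> v \<in> T p \<Longrightarrow> u + v \<in> T p"
  unfolding tangent_space_def by (simp add: algebra_simps)

lemma T_scaleR: "u \<in> T p \<Longrightarrow> c *\<^sub>R u \<in> T p"
  unfolding tangent_space_def by (simp add: algebra_simps)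

lemma T_subspace: "subspace (T p)"
  by (simp add: subspace_def T_zero T_plus T_scaleR)

lemma VF_T: "X \<in> VF \<Longrightarrow> X p \<in> T p"
  unfolding vector_fields_def by auto

lemma VF_C: "X \<in> VF \<Longrightarrow> f \<in> C \<Longrightarrow> (\<lambda>p. X p f) \<in> C"
  unfolding vector_fields_def deriv_along_def by auto

lemma VF_I: "(\<And>p. X p \<in> T p) \<Longrightarrow> (\<And>f. f \<in> C \<Longrightarrow> (\<lambda>p. X p f) \<in> C) \<Longrightarrow> X \<in> VF"
  unfolding vector_fields_def deriv_along_def by auto

definition coord_vec :: "'m set \<Rightarrow> ('m \<Rightarrow> 'a) \<Rightarrow> 'a \<Rightarrow> 'm \<Rightarrow> 'm tvec"
  where "coord_vec U \<phi> i q f =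
    (if f \<in> C then frechet_derivative (f \<circ> inv_into U \<phi>) (at (\<phi> q)) i else 0)"

lemma coord_vec_T:
  assumes U: "(U, \<phi>) \<in> \<A>" and q: "q \<in> U"
  shows "coord_vec U \<phi> i q \<in> T q"
proof -
  have D: "((f \<circ> inv_into U \<phi>) has_derivative frechet_derivative (f \<circ> inv_into U \<phi>) (at (\<phi> q))) (at (\<phi> q))"
    if "f \<in> C" for f
    using smooth_on_has_derivative[OF C_infinity_smooth_on[OF that U]] q by auto
  have "frechet_derivative ((f + h) \<circ> inv_into U \<phi>) (at (\<phi> q)) =
      (\<lambda>v. frechet_derivative (f \<circ> inv_into U \<phi>) (at (\<phi> q)) v + frechet_derivative (h \<circ> inv_into U \<phi>) (at (\<phi> q)) v)"
    if "f \<in> C" "h \<in> C" for f h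
    by (intro frechet_derivative_eqI) (use has_derivative_add[OF D[OF that(1)] D[OF that(2)]] in \<open>simp add: o_def\<close>)
  moreover have "frechet_derivative ((c *\<^sub>R f) \<circ> inv_into U \<phi>) (at (\<phi> q)) =
      (\<lambda>v. c * frechet_derivative (f \<circ> inv_into U \<phi>) (at (\<phi> q)) v)" if "f \<in> C" for f c
    by (intro frechet_derivative_eqI) (use has_derivative_mult_right[OF D[OF that]] in \<open>simp add: o_def\<close>)
  moreover have "frechet_derivative ((f * h) \<circ> inv_into U \<phi>) (at (\<phi> q)) =
      (\<lambda>v. f q * frechet_derivative (h \<circ> inv_into U \<phi>) (at (\<phi> q)) v + frechet_derivative (f \<circ> inv_into U \<phi>) (at (\<phi> q)) v * h q)"
    if "f \<in> C" "h \<in> C" for f h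
    by (intro frechet_derivative_eqI)
      (use has_derivative_mult[OF D[OF that(1)] D[OF that(2)]] chart_inv[OF U q] in \<open>simp add: o_def\<close>)
  ultimately show ?thesis
    unfolding tangent_space_def coord_vec_def
    by (simp add: C_plus_fun C_times_fun C_scaleR_fun)
qed

text \<open>Partial derivatives and coordinates of a chart, cut off by a bump function to become
  global. The frame relations are therefore asserted at \<open>p\<close> only.\<close>

lemma coordinate_frame:
  fixes p :: 'm
  obtains e :: "'a \<Rightarrow> 'm vfield" and y :: "'a \<Rightarrow> 'm \<Rightarrow> real"
  where "\<And>i. e i \<in> VF" "\<And>i. y i \<in> C"
    "\<And>i j. i \<in> Basis \<Longrightarrow> j \<in> Basis \<Longrightarrow> e i p (y j) = (if i = j then 1 else 0)"
    "\<And>v. v \<in> T p \<Longrightarrow> v = (\<Sum>i\<in>Basis. v (y i) *\<^sub>R e i p)"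
proof -
  obtain U \<phi> where U: "(U, \<phi>) \<in> \<A>" "p \<in> U" by (rule chart_at)
  define c where "c = \<phi> p"
  have "c \<in> \<phi> ` U" using U c_def by auto
  then obtain r where r: "r > 0" "ball c r \<subseteq> \<phi> ` U"
    using chart_open(2)[OF U(1)] open_contains_ball by blast
  \<comment> \<open>Half the radius leaves room between the support of the bump and the boundary of
    the ball, so products with functions smooth on the ball extend smoothly by zero.\<close>
  define K where "K = cball c (r / 2)"
  have K: "compact K" "K \<subseteq> ball c r" "K \<subseteq> \<phi> ` U" using r by (auto simp: K_def)
  obtain b :: "'a \<Rightarrow> real" where b: "smooth_on UNIV b" "b c = 1" "\<And>x. b x \<noteq> 0 \<Longrightarrow> x \<in> ball c (r / 2)"
    using smooth_bump_exists[of "r / 2" c] r by auto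
  have b0: "b x = 0" if "x \<notin> K" for x
    using b(3)[of x] that by (auto simp: K_def)
  define ext where "ext u q = (if q \<in> U then u (\<phi> q) else 0)" for u :: "'a \<Rightarrow> real" and q
  have bsm: "smooth_on (\<phi> ` U) (\<lambda>x. b x * h x)" if "smooth_on (ball c r) h" for h :: "'a \<Rightarrow> real"
  proof (rule smooth_on_local)
    fix x assume "x \<in> \<phi> ` U"
    show "\<exists>T. open T \<and> x \<in> T \<and> smooth_on T (\<lambda>x. b x * h x)"
    proof (cases "x \<in> ball c r")
      case True
      have "smooth_on (ball c r) (\<lambda>x. b x * h x)"
        using that by (intro smooth_on_mult) (auto intro: smooth_on_subset[OF b(1)])
      then show ?thesis using True by blast
    next
      case False
      have op: "open (- K)" using K(1) by (simp add: compact_imp_closed open_Compl)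
      have "smooth_on (- K) (\<lambda>x. b x * h x)"
        by (rule smooth_on_cong[OF op _ smooth_on_const[of _ 0]]) (simp add: b0)
      then show ?thesis using False K(2) op by blast
    qed
  qed
  have ext_C: "ext (\<lambda>x. b x * h x) \<in> C" if "smooth_on (ball c r) h" for h
    unfolding ext_def by (rule C_infinity_extend_by_zero[OF U(1) bsm[OF that] K(1,3)]) (simp add: b0)
  \<comment> \<open>The last factor enforces the convention that tangent vectors vanish on
    non-smooth arguments.\<close>
  define e where "e i q f = ext (\<lambda>x. b x * frechet_derivative (f \<circ> inv_into U \<phi>) (at x) i) q * (if f \<in> C then 1 else 0)"
    for i q f
  define y where "y i = ext (\<lambda>x. b x * ((x - c) \<bullet> i))" for i
  have e_eq: "e i q = (if q \<in> U then b (\<phi> q) *\<^sub>R coord_vec U \<phi> i q else 0)" for i q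
    by (rule ext) (simp add: e_def ext_def coord_vec_def)
  have e_p: "e i p = coord_vec U \<phi> i p" for i
    using U(2) b(2) by (simp add: e_eq c_def)
  have eVF: "e i \<in> VF" for i
  proof (rule VF_I)
    show "e i q \<in> T q" for q
      by (simp add: e_eq T_zero T_scaleR coord_vec_T[OF U(1)])
    show "(\<lambda>q. e i q f) \<in> C" if "f \<in> C" for f
      using ext_C[OF smooth_on_subset[OF smooth_on_frechet_derivative[OF C_infinity_smooth_on[OF that U(1)]] r(2)]] that
      by (simp add: e_def)
  qed
  have lin: "smooth_on (ball c r) (\<lambda>x. (x + - c) \<bullet> i)" for i
    by (intro smooth_on_bounded_linear_compose[OF _ bounded_linear_inner_left] smooth_on_add smooth_on_id smooth_on_const) auto
  have yC: "y i \<in> C" for i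
    using ext_C[OF lin] by (simp add: y_def)
  have ey: "e i p (y j) = i \<bullet> j" for i j
  proof -
    have "((y j \<circ> inv_into U \<phi>) has_derivative (\<lambda>v. v \<bullet> j)) (at c)"
    proof (rule has_derivative_transform_within_open[OF _ chart_open(2)[OF U(1)] \<open>c \<in> \<phi> ` U\<close>])
      show "b x * ((x - c) \<bullet> j) = (y j \<circ> inv_into U \<phi>) x" if "x \<in> \<phi> ` U" for x
        using that chart_inv[OF U(1)] by (auto simp: y_def ext_def)
      have "((\<lambda>x. (x - c) \<bullet> j) has_derivative (\<lambda>v. v \<bullet> j)) (at c)"
        by (auto intro!: derivative_eq_intros)
      from has_derivative_mult[OF smooth_on_has_derivative[OF b(1)] this]
      show "((\<lambda>x. b x * ((x - c) \<bullet> j)) has_derivative (\<lambda>v. v \<bullet> j)) (at c)"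
        by (simp add: b(2))
    qed
    then show ?thesis
      using yC by (simp add: e_p coord_vec_def c_def frechet_derivative_eqI)
  qed
  have expand: "v = (\<Sum>i\<in>Basis. v (y i) *\<^sub>R e i p)" if v: "v \<in> T p" for v
  proof
    fix f
    show "v f = (\<Sum>i\<in>Basis. v (y i) *\<^sub>R e i p) f"
    proof (cases "f \<in> C")
      case False
      then show ?thesis
        using T_outside[OF v] by (simp add: e_def sum_fun_apply)
    next
      case f: True
      obtain h where h: "\<And>i. smooth_on (ball c r) (h i)"
        "\<And>i. h i c = frechet_derivative (f \<circ> inv_into U \<phi>) (at c) i"
        "\<And>x. x \<in> ball c r \<Longrightarrow> (f \<circ> inv_into U \<phi>) x = (f \<circ> inv_into U \<phi>) c + (\<Sum>i\<in>Basis. ((x - c) \<bullet> i) * h i x)"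
        by (rule hadamard[OF smooth_on_subset[OF C_infinity_smooth_on[OF f U(1)] r(2)] r(1)]) (rule that)
      define k where "k i = ext (\<lambda>x. b x * h i x)" for i
      define \<beta> where "\<beta> = ext (\<lambda>x. b x * 1)"
      define F where "F = f + (\<lambda>q. - f p)"
      have mem: "k i \<in> C" "\<beta> \<in> C" "F \<in> C" "\<beta> * \<beta> \<in> C" for i
        unfolding k_def \<beta>_def F_def
        by (intro ext_C h smooth_on_const C_plus_fun f C_const C_times_fun)+
      have at_p: "\<beta> p = 1" "F p = 0" "y i p = 0" "k i p = h i c" for i
        using U(2) b(2) by (simp_all add: \<beta>_def F_def y_def k_def ext_def c_def)
      \<comment> \<open>\<open>y i\<close> and \<open>k i\<close> each carry one bump factor, so
        Hadamard's expansion of \<open>F = f - f p\<close> becomes a global identity after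
        multiplication by \<open>\<beta>\<close> twice. As \<open>F p = 0\<close> and
        \<open>\<beta> p = 1\<close>, the product rule shows that \<open>v\<close> does not notice
        these factors.\<close>
      have "F * (\<beta> * \<beta>) = (\<Sum>i\<in>Basis. y i * k i)"
      proof
        fix q
        show "(F * (\<beta> * \<beta>)) q = (\<Sum>i\<in>Basis. y i * k i) q"
        proof (cases "q \<in> U \<and> \<phi> q \<in> ball c r")
          case True
          then have "f q = f p + (\<Sum>i\<in>Basis. ((\<phi> q - c) \<bullet> i) * h i (\<phi> q))"
            using h(3)[of "\<phi> q"] chart_inv[OF U(1)] U(2) by (simp add: c_def)
          then show ?thesis
            using True by (simp add: F_def \<beta>_def y_def k_def ext_def sum_fun_apply sum_distrib_left mult_ac)
        next
          case False
          then have "\<phi> q \<notin> K" if "q \<in> U" using that K(2) by blast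
          then show ?thesis
            by (auto simp: F_def \<beta>_def y_def k_def ext_def sum_fun_apply b0)
        qed
      qed
      moreover have "v (F * (\<beta> * \<beta>)) = v f"
        using T_mult[OF v mem(3,4)] T_add[OF v f C_const] T_const[OF v] at_p by (simp add: F_def)
      moreover have "v (\<Sum>i\<in>Basis. y i * k i) = (\<Sum>i\<in>Basis. v (y i) * h i c)"
        using T_sum[OF v C_times_fun[OF yC mem(1)], of "\<lambda>i. i" "\<lambda>i. i" Basis]
          T_mult[OF v yC mem(1)] at_p by simp
      ultimately show ?thesis
        using f h(2) by (simp add: sum_fun_apply e_p coord_vec_def c_def)
    qed
  qed
  show ?thesis
    by (rule that[OF eVF yC _ expand]) (simp_all add: ey inner_Basis)
qed

end

section \<open>Frames and gradients on a Riemannian manifold\<close>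

lemma linear_within_sum:
  assumes "subspace S" "linear_within S L" "\<And>i. i \<in> I \<Longrightarrow> x i \<in> S"
  shows "L (\<Sum>i\<in>I. c i *\<^sub>R x i) = (\<Sum>i\<in>I. c i *\<^sub>R L (x i))"
proof -
  have L0: "L 0 = 0"
  proof -
    have "L (0 *\<^sub>R 0) = 0 *\<^sub>R L 0"
      using assms(2) subspace_0[OF assms(1)] unfolding linear_within_def by blast
    then show ?thesis by simp
  qed
  from assms(3) show ?thesis
  proof (induction I rule: infinite_finite_induct)
    case (insert i I)
    have "(\<Sum>i\<in>I. c i *\<^sub>R x i) \<in> S" "c i *\<^sub>R x i \<in> S" "x i \<in> S"
      using insert.prems assms(1) by (auto intro: subspace_sum subspace_scale)
    then show ?case
      using assms(2) insert unfolding linear_within_def by simp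
  qed (simp_all add: L0)
qed

locale inner_product_within =
  fixes S :: "'v::real_vector set" and b :: "'v \<Rightarrow> 'v \<Rightarrow> real"
  assumes S: "subspace S"
    and sym: "\<And>u v. u \<in> S \<Longrightarrow> v \<in> S \<Longrightarrow> b u v = b v u"
    and lin: "\<And>u. u \<in> S \<Longrightarrow> linear_within S (b u)"
    and pos: "\<And>u. u \<in> S \<Longrightarrow> u \<noteq> 0 \<Longrightarrow> b u u > 0"
begin

lemma independent_orthogonal:
  assumes "finite A" "A \<subseteq> S" "0 \<notin> A" "\<And>u v. u \<in> A \<Longrightarrow> v \<in> A \<Longrightarrow> u \<noteq> v \<Longrightarrow> b u v = 0"
  shows "independent A"
proof (rule independent_if_scalars_zero[OF assms(1)])
  fix f x
  assume f: "(\<Sum>y\<in>A. f y *\<^sub>R y) = 0" and x: "x \<in> A"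
  have "0 = b x (0 *\<^sub>R 0)"
    using lin[of x] x assms(2) subspace_0[OF S] unfolding linear_within_def by fastforce
  also have "\<dots> = b x (\<Sum>y\<in>A. f y *\<^sub>R y)"
    by (simp add: f)
  also have "\<dots> = (\<Sum>y\<in>A. f y *\<^sub>R b x y)"
    using x assms(2) by (intro linear_within_sum[OF S lin]) auto
  also have "\<dots> = (\<Sum>y\<in>A. if y = x then f x * b x x else 0)"
    using x assms(4) by (intro sum.cong) auto
  also have "\<dots> = f x * b x x"
    using assms(1) x by simp
  finally show "f x = 0"
    using pos[of x] x assms(2,3) by (metis less_irrefl mult_eq_0_iff subsetD)
qed

text \<open>A nonzero remainder after subtracting the projections would be orthogonal to all
  \<open>e i\<close>, giving card I + 1 independent vectors in the span of at most card I. The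
  quotients replace normalisation, which would need square roots.\<close>

lemma orthogonal_expansion:
  assumes B: "finite B" "S \<subseteq> span B" "card B \<le> card I" and I: "finite I"
    and e: "\<And>i. i \<in> I \<Longrightarrow> e i \<in> S" "\<And>i. i \<in> I \<Longrightarrow> e i \<noteq> 0"
    and orth: "\<And>i j. i \<in> I \<Longrightarrow> j \<in> I \<Longrightarrow> i \<noteq> j \<Longrightarrow> b (e i) (e j) = 0"
    and v: "v \<in> S"
  shows "v = (\<Sum>i\<in>I. (b v (e i) / b (e i) (e i)) *\<^sub>R e i)"
proof (rule ccontr)
  let ?s = "\<Sum>i\<in>I. (b v (e i) / b (e i) (e i)) *\<^sub>R e i"
  assume "v \<noteq> ?s"
  define r where "r = v + (-1) *\<^sub>R ?s"
  have r0: "r \<noteq> 0" using \<open>v \<noteq> ?s\<close> by (simp add: r_def)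
  have s: "?s \<in> S" using e(1) S by (auto intro: subspace_sum subspace_scale)
  have r: "r \<in> S" unfolding r_def using s v S by (intro subspace_add subspace_scale)
  have re: "b (e k) r = 0" if k: "k \<in> I" for k
  proof -
    have "b (e k) r = b (e k) v + b (e k) ((-1) *\<^sub>R ?s)"
      using lin[OF e(1)[OF k]] v subspace_scale[OF S s, of "-1"] unfolding linear_within_def r_def by blast
    also have "b (e k) ((-1) *\<^sub>R ?s) = (-1) *\<^sub>R b (e k) ?s"
      using lin[OF e(1)[OF k]] s unfolding linear_within_def by blast
    also have "b (e k) ?s = (\<Sum>i\<in>I. (b v (e i) / b (e i) (e i)) *\<^sub>R b (e k) (e i))"
      by (rule linear_within_sum[OF S lin[OF e(1)[OF k]] e(1)])
    also have "\<dots> = (\<Sum>i\<in>I. if i = k then b v (e k) else 0)"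
      using orth[OF k] pos[OF e(1)[OF k] e(2)[OF k]] by (intro sum.cong) auto
    finally show ?thesis
      using I k sym[OF v e(1)[OF k]] by simp
  qed
  \<comment> \<open>If two distinct indices gave the same vector, orthogonality would make its
    squared length zero.\<close>
  have inj: "inj_on e I"
    using orth pos[OF e] by (metis inj_onI less_irrefl e)
  have "r \<notin> e ` I"
    using re pos[OF r r0] by fastforce
  then have card: "card (insert r (e ` I)) = Suc (card I)"
    using I card_image[OF inj] by simp
  have "independent (insert r (e ` I))"
  proof (rule independent_orthogonal)
    show "b u w = 0" if "u \<in> insert r (e ` I)" "w \<in> insert r (e ` I)" "u \<noteq> w" for u w
      using that re orth sym[OF r] e(1) by auto
  qed (use I e r r0 in auto)
  moreover have "insert r (e ` I) \<subseteq> span B"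
    using r e(1) B(2) by auto
  ultimately have "card (insert r (e ` I)) \<le> card B"
    using independent_span_bound[OF B(1)] by blast
  then show False
    using card B(3) by simp
qed

end

context manifold
begin

lemma T_minus: "u \<in> T p \<Longrightarrow> - u \<in> T p"
  using T_scaleR[of u p "-1"] by simp

lemma T_diff: "u \<in> T p \<Longrightarrow> v \<in> T p \<Longrightarrow> u - v \<in> T p"
  by (rule subspace_diff[OF T_subspace])

section \<open>The module of vector fields\<close>

lemma VF_zero: "0 \<in> VF"
  by (rule VF_I) (simp_all add: T_zero C_const)

lemma VF_plus: "X \<in> VF \<Longrightarrow> Y \<in> VF \<Longrightarrow> X + Y \<in> VF"
  by (rule VF_I) (simp_all add: T_plus VF_T C_add VF_C)

lemma VF_fscale: "f \<in> C \<Longrightarrow> X \<in> VF \<Longrightarrow> f \<cdot> X \<in> VF"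
  by (rule VF_I) (simp_all add: fscale_def T_scaleR VF_T C_mult VF_C)

lemma VF_scaleR: "X \<in> VF \<Longrightarrow> c *\<^sub>R X \<in> VF"
  using VF_fscale[OF C_const[of c]] by (simp add: fscale_def scaleR_fun_def)

lemma VF_minus: "X \<in> VF \<Longrightarrow> - X \<in> VF"
  using VF_scaleR[of X "-1"] by simp

lemma VF_diff: "X \<in> VF \<Longrightarrow> Y \<in> VF \<Longrightarrow> X - Y \<in> VF"
  using VF_plus[OF _ VF_minus, of X Y] by simp

lemma VF_sum: "(\<And>i. i \<in> I \<Longrightarrow> X i \<in> VF) \<Longrightarrow> (\<Sum>i\<in>I. X i) \<in> VF"
  by (induction I rule: infinite_finite_induct) (metis VF_zero VF_plus sum.infinite sum.empty sum.insert insert_iff)+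

text \<open>Transports a property closed under smooth linear combinations from generating fields to
  everything built from them. The empty set qualifies, which is why \<open>submodule_sum\<close>
  asks for a nonempty index set.\<close>

definition submodule :: "'m vfield set \<Rightarrow> bool"
  where "submodule M \<longleftrightarrow> M \<subseteq> VF \<and> (\<forall>F\<in>M. \<forall>G\<in>M. F + G \<in> M) \<and> (\<forall>f\<in>C. \<forall>F\<in>M. f \<cdot> F \<in> M)"

lemma submodule_plus: "submodule M \<Longrightarrow> F \<in> M \<Longrightarrow> G \<in> M \<Longrightarrow> F + G \<in> M"
  unfolding submodule_def by blast

lemma submodule_fscale: "submodule M \<Longrightarrow> f \<in> C \<Longrightarrow> F \<in> M \<Longrightarrow> f \<cdot> F \<in> M"
  unfolding submodule_def by blast

lemma submodule_sum:
  assumes "submodule M" "finite I" "I \<noteq> {}" "\<And>i. i \<in> I \<Longrightarrow> F i \<in> M"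
  shows "(\<Sum>i\<in>I. F i) \<in> M"
  using assms(2,3,4)
proof (induction I rule: finite_ne_induct)
  case (insert i I)
  then show ?case
    using assms(1) unfolding submodule_def by (metis insert_iff sum.insert)
qed simp

lemma tangent_space_finite_dim:
  obtains B where "finite B" "T p \<subseteq> span B" "card B \<le> DIM('a)"
proof -
  obtain e :: "'a \<Rightarrow> 'm vfield" and y :: "'a \<Rightarrow> 'm \<Rightarrow> real"
    where ey: "\<And>v. v \<in> T p \<Longrightarrow> v = (\<Sum>i\<in>Basis. v (y i) *\<^sub>R e i p)"
    by (rule coordinate_frame[of p]) (rule that)
  have "v \<in> span ((\<lambda>i. e i p) ` Basis)" if "v \<in> T p" for v
    by (subst ey[OF that]) (intro span_sum span_scale span_base imageI)
  then show ?thesis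
    by (intro that[of "(\<lambda>i. e i p) ` Basis"]) (auto intro: card_image_le)
qed

end

locale riemannian = manifold \<A>
  for \<A> :: "('m::{t2_space, second_countable_topology}, 'a::euclidean_space) atlas" +
  fixes g :: "'m form2"
  assumes riemannian: "riemannian_manifold \<A> g"
begin

lemma g_inner_product: "inner_product_within (T p) (g p)"
  using riemannian unfolding riemannian_manifold_def by unfold_locales (auto simp: T_subspace)

lemma g_sym: "u \<in> T p \<Longrightarrow> v \<in> T p \<Longrightarrow> g p u v = g p v u"
  using riemannian unfolding riemannian_manifold_def by blast

lemma g_linear: "u \<in> T p \<Longrightarrow> linear_within (T p) (g p u)"
  using riemannian unfolding riemannian_manifold_def by blast

lemma g_pos: "u \<in> T p \<Longrightarrow> u \<noteq> 0 \<Longrightarrow> g p u u > 0"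
  using riemannian unfolding riemannian_manifold_def by blast

lemma g_C: "X \<in> VF \<Longrightarrow> Y \<in> VF \<Longrightarrow> (\<lambda>p. g p (X p) (Y p)) \<in> C"
  using riemannian unfolding riemannian_manifold_def on_fields2_def by blast

lemma g_add_right: "u \<in> T p \<Longrightarrow> v \<in> T p \<Longrightarrow> w \<in> T p \<Longrightarrow> g p u (v + w) = g p u v + g p u w"
  using g_linear unfolding linear_within_def by blast

lemma g_scale_right: "u \<in> T p \<Longrightarrow> v \<in> T p \<Longrightarrow> g p u (c *\<^sub>R v) = c * g p u v"
  using g_linear unfolding linear_within_def by simp

lemma g_add_left: "u \<in> T p \<Longrightarrow> v \<in> T p \<Longrightarrow> w \<in> T p \<Longrightarrow> g p (u + v) w = g p u w + g p v w"
  using g_add_right[of w p u v] g_sym by (simp add: T_plus)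

lemma g_scale_left: "u \<in> T p \<Longrightarrow> v \<in> T p \<Longrightarrow> g p (c *\<^sub>R u) v = c * g p u v"
  using g_scale_right[of v p u] g_sym by (simp add: T_scaleR)

lemma g_minus_right: "u \<in> T p \<Longrightarrow> v \<in> T p \<Longrightarrow> g p u (- v) = - g p u v"
  using g_scale_right[of u p v "-1"] by simp

lemma g_minus_left: "u \<in> T p \<Longrightarrow> v \<in> T p \<Longrightarrow> g p (- u) v = - g p u v"
  using g_scale_left[of u p v "-1"] by simp

lemma g_diff_right: "u \<in> T p \<Longrightarrow> v \<in> T p \<Longrightarrow> w \<in> T p \<Longrightarrow> g p u (v - w) = g p u v - g p u w"
  using g_add_right[of u p v "- w"] by (simp add: g_minus_right T_minus)

lemma g_diff_left: "u \<in> T p \<Longrightarrow> v \<in> T p \<Longrightarrow> w \<in> T p \<Longrightarrow> g p (u - v) w = g p u w - g p v w"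
  using g_add_left[of u p "- v" w] by (simp add: g_minus_left T_minus)

lemma g_zero_right: "u \<in> T p \<Longrightarrow> g p u 0 = 0"
  using g_scale_right[of u p 0 0] by (simp add: T_zero)

lemma g_zero_left: "u \<in> T p \<Longrightarrow> g p 0 u = 0"
  using g_scale_left[of 0 p u 0] by (simp add: T_zero)

lemmas g_simps = g_add_left g_add_right g_scale_left g_scale_right g_minus_left g_minus_right
  g_diff_left g_diff_right g_zero_left g_zero_right

lemma g_eq_0_iff: "u \<in> T p \<Longrightarrow> g p u u = 0 \<longleftrightarrow> u = 0"
  using g_pos[of u p] g_zero_left[of 0 p] by (cases "u = 0") (auto simp: T_zero)

lemma g_eqI:
  assumes "u \<in> T p" "v \<in> T p" "\<And>w. w \<in> T p \<Longrightarrow> g p u w = g p v w"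
  shows "u = v"
  using g_eq_0_iff[of "u - v" p] assms by (simp add: g_diff_left T_diff)

text \<open>
  Gram--Schmidt without division: multiplying by the squared lengths of the previous fields
  keeps everything globally smooth, at the price of zeros away from \<open>p\<close>.
\<close>

lemma gram_schmidt_fields:
  fixes X :: "'i \<Rightarrow> 'm vfield" and l :: "'i \<Rightarrow> 'm tvec \<Rightarrow> real"
  assumes I: "finite I" and X: "\<And>i. i \<in> I \<Longrightarrow> X i \<in> VF"
    and l: "\<And>i. i \<in> I \<Longrightarrow> linear_within (T p) (l i)"
    and lX: "\<And>i j. i \<in> I \<Longrightarrow> j \<in> I \<Longrightarrow> l i (X j p) = (if i = j then 1 else 0)"
  obtains Y where "\<And>i. i \<in> I \<Longrightarrow> Y i \<in> VF" "\<And>i. i \<in> I \<Longrightarrow> Y i p \<noteq> 0"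
    "\<And>i j q. i \<in> I \<Longrightarrow> j \<in> I \<Longrightarrow> i \<noteq> j \<Longrightarrow> g q (Y i q) (Y j q) = 0"
    "\<And>i M. i \<in> I \<Longrightarrow> submodule M \<Longrightarrow> X ` I \<subseteq> M \<Longrightarrow> Y i \<in> M"
proof -
  have "\<exists>Y. \<forall>i\<in>K. Y i \<in> VF \<and> Y i p \<noteq> 0 \<and> (\<forall>j\<in>K. i \<noteq> j \<longrightarrow> (\<forall>q. g q (Y i q) (Y j q) = 0))
      \<and> (\<forall>M. submodule M \<longrightarrow> X ` K \<subseteq> M \<longrightarrow> Y i \<in> M)" if "finite K" "K \<subseteq> I" for K
    using that
  proof (induction K)
    case (insert k K)
    then have "K \<subseteq> I" by auto
    from insert.IH[OF this] obtain Y where YK: "\<forall>i\<in>K. Y i \<in> VF \<and> Y i p \<noteq> 0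
        \<and> (\<forall>j\<in>K. i \<noteq> j \<longrightarrow> (\<forall>q. g q (Y i q) (Y j q) = 0))
        \<and> (\<forall>M. submodule M \<longrightarrow> X ` K \<subseteq> M \<longrightarrow> Y i \<in> M)"
      by (elim exE)
    have Y: "\<And>i. i \<in> K \<Longrightarrow> Y i \<in> VF" "\<And>i. i \<in> K \<Longrightarrow> Y i p \<noteq> 0"
      "\<And>i j q. i \<in> K \<Longrightarrow> j \<in> K \<Longrightarrow> i \<noteq> j \<Longrightarrow> g q (Y i q) (Y j q) = 0"
      "\<And>i M. i \<in> K \<Longrightarrow> submodule M \<Longrightarrow> X ` K \<subseteq> M \<Longrightarrow> Y i \<in> M"
      using YK by blast+
    have k: "k \<in> I" "k \<notin> K" and KI: "K \<subseteq> I" using insert by auto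
    \<comment> \<open>Since \<open>k\<close> is not in \<open>K\<close>, \<open>N k\<close> is the
      full product of squared lengths, and \<open>N i\<close> times the squared length of
      \<open>Y i\<close> equals \<open>N k\<close>. Hence the coefficients \<open>a i\<close> cancel
      the component of \<open>N k \<cdot> X k\<close> along \<open>Y i\<close> exactly.\<close>
    define N where "N i q = (\<Prod>j\<in>K - {i}. g q (Y j q) (Y j q))" for i q
    define a where "a i q = - (N i q * g q (X k q) (Y i q))" for i q
    define Z where "Z = N k \<cdot> X k + (\<Sum>i\<in>K. a i \<cdot> Y i)"
    define s where "s q = (\<Sum>i\<in>K. a i q *\<^sub>R Y i q)" for q
    have NC: "N i \<in> C" and aC: "i \<in> K \<Longrightarrow> a i \<in> C" for i
      unfolding N_def a_def using Y(1) X[OF k(1)]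
      by (auto intro!: C_prod g_C C_minus C_mult)
    have ZVF: "Z \<in> VF"
      unfolding Z_def using Y(1) X[OF k(1)] NC aC by (intro VF_plus VF_fscale VF_sum)
    have Zq: "Z q = N k q *\<^sub>R X k q + s q" for q
      by (simp add: s_def Z_def fscale_def sum_fun_apply)
    have sT: "s q \<in> T q" for q
      unfolding s_def using Y(1) by (intro subspace_sum[OF T_subspace] T_scaleR VF_T)
    have orth: "g q (Y i q) (Z q) = 0" if i: "i \<in> K" for i q
    proof -
      have "g q (Y i q) (s q) = (\<Sum>j\<in>K. a j q *\<^sub>R g q (Y i q) (Y j q))"
        unfolding s_def using Y(1) i by (intro linear_within_sum[OF T_subspace g_linear] VF_T) auto
      also have "\<dots> = (\<Sum>j\<in>K. if j = i then a i q * g q (Y i q) (Y i q) else 0)"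
        using Y(3) i by (intro sum.cong) auto
      also have "\<dots> = - (N i q * g q (Y i q) (Y i q) * g q (X k q) (Y i q))"
        using insert.hyps(1) i by (simp add: a_def)
      also have "N i q * g q (Y i q) (Y i q) = N k q"
        unfolding N_def using insert.hyps(1) i k(2)
        by (simp add: prod.remove[of K i] mult.commute)
      finally show ?thesis
        using Y(1)[OF i] X[OF k(1)] sT g_sym[of "Y i q" q "X k q"]
        by (simp add: Zq g_simps T_scaleR VF_T)
    qed
    have Zp: "Z p \<noteq> 0"
    proof -
      have "l k (Y i p) = 0" if i: "i \<in> K" for i
      proof -
        \<comment> \<open>The functional \<open>l k\<close> annihilates the earlier
          \<open>X i\<close> at \<open>p\<close>, hence all fields generated by them. It therefore
          sees only the multiple of \<open>X k\<close> in \<open>Z\<close>, which proves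
          \<open>Z p \<noteq> 0\<close>.\<close>
        let ?M = "{F \<in> VF. l k (F p) = 0}"
        have "submodule ?M"
          using l[OF k(1)] unfolding submodule_def linear_within_def
          by (auto simp: VF_plus VF_fscale VF_T fscale_def[of _ _, THEN fun_cong])
        moreover have "X ` K \<subseteq> ?M"
          using X KI lX[OF k(1)] k(2) by auto
        ultimately show ?thesis using Y(4)[OF i] by blast
      qed
      then have "l k (s p) = 0"
        unfolding s_def using linear_within_sum[OF T_subspace l[OF k(1)], of K "\<lambda>i. Y i p" "\<lambda>i. a i p"] Y(1) by (simp add: VF_T)
      then have "l k (Z p) = N k p"
        using l[OF k(1)] lX[OF k(1) k(1)] sT[of p] X[OF k(1)] unfolding linear_within_def
        by (simp add: Zq T_scaleR VF_T)
      moreover have "N k p \<noteq> 0"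
        unfolding N_def using Y(1,2) insert.hyps(1) g_eq_0_iff[OF VF_T] by auto
      moreover have "l k 0 = 0"
        using linear_within_sum[OF T_subspace l[OF k(1)], of "{}"] by simp
      ultimately show ?thesis by auto
    qed
    have ZM: "Z \<in> M" if M: "submodule M" "X ` insert k K \<subseteq> M" for M
    proof -
      have XM: "X k \<in> M" and YM: "\<And>i. i \<in> K \<Longrightarrow> Y i \<in> M" using M Y(4) by auto
      have NX: "N k \<cdot> X k \<in> M" and aY: "\<And>i. i \<in> K \<Longrightarrow> a i \<cdot> Y i \<in> M"
        using XM YM NC aC by (auto intro: submodule_fscale[OF M(1)])
      show ?thesis
      proof (cases "K = {}")
        case True
        then show ?thesis using NX by (simp add: Z_def)
      next
        case False
        show ?thesis
          unfolding Z_def by (rule submodule_plus[OF M(1) NX submodule_sum[OF M(1) insert.hyps(1) False aY]])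
      qed
    qed
    let ?Y = "Y(k := Z)"
    have Yi: "?Y i = Y i" if "i \<in> K" for i
      using that k(2) by auto
    have orth': "g q (Z q) (Y i q) = 0" if "i \<in> K" for i q
      using orth[OF that] g_sym[OF VF_T[OF ZVF] VF_T[OF Y(1)[OF that]]] by simp
    show ?case
    proof (intro exI[of _ ?Y] ballI conjI allI impI)
      fix i
      assume "i \<in> insert k K"
      then consider "i = k" | "i \<in> K" by blast
      note cases_i = this
      show "?Y i \<in> VF"
        using cases_i
      proof cases
        case 1
        show ?thesis unfolding 1 fun_upd_same by (rule ZVF)
      next
        case 2
        show ?thesis unfolding Yi[OF 2] by (rule Y(1)[OF 2])
      qed
      show "?Y i p \<noteq> 0"
        using cases_i
      proof cases
        case 1
        show ?thesis unfolding 1 fun_upd_same by (rule Zp)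
      next
        case 2
        show ?thesis unfolding Yi[OF 2] by (rule Y(2)[OF 2])
      qed
      show "?Y i \<in> M" if M: "submodule M" "X ` insert k K \<subseteq> M" for M
        using cases_i
      proof cases
        case 1
        show ?thesis unfolding 1 fun_upd_same by (rule ZM[OF M])
      next
        case 2
        show ?thesis unfolding Yi[OF 2] using M by (intro Y(4)[OF 2]) auto
      qed
      show "g q (?Y i q) (?Y j q) = 0" if j: "j \<in> insert k K" and ij: "i \<noteq> j" for j q
        using cases_i
      proof cases
        case 1
        then have "j \<in> K" using j ij by auto
        show ?thesis unfolding 1 fun_upd_same Yi[OF \<open>j \<in> K\<close>] by (rule orth'[OF \<open>j \<in> K\<close>])
      next
        case 2
        show ?thesis
        proof (cases "j = k")
          case True
          show ?thesis unfolding True fun_upd_same Yi[OF 2] by (rule orth[OF 2])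
        next
          case False
          then have "j \<in> K" using j by auto
          show ?thesis unfolding Yi[OF \<open>j \<in> K\<close>] Yi[OF 2] by (rule Y(3)[OF 2 \<open>j \<in> K\<close> ij])
        qed
      qed
    qed
  qed simp
  from this[OF I] obtain Y where "\<forall>i\<in>I. Y i \<in> VF \<and> Y i p \<noteq> 0 \<and> (\<forall>j\<in>I. i \<noteq> j \<longrightarrow> (\<forall>q. g q (Y i q) (Y j q) = 0))
      \<and> (\<forall>M. submodule M \<longrightarrow> X ` I \<subseteq> M \<longrightarrow> Y i \<in> M)"
    by auto
  then show ?thesis
    by (intro that[of Y]) simp_all
qed

text \<open>Gram-Schmidt applied to the coordinate fields at \<open>p\<close>, with the coordinate
  functions as dual functionals. The expansion is valid at every point where no field vanishes, thus
  near \<open>p\<close> and not just at \<open>p\<close>.\<close>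

lemma orthogonal_frame:
  fixes p :: 'm
  obtains e :: "'a \<Rightarrow> 'm vfield" where "\<And>i. i \<in> Basis \<Longrightarrow> e i \<in> VF" "\<And>i. i \<in> Basis \<Longrightarrow> e i p \<noteq> 0"
    "\<And>q v. \<forall>i\<in>Basis. e i q \<noteq> 0 \<Longrightarrow> v \<in> T q \<Longrightarrow>
      v = (\<Sum>i\<in>Basis. (g q v (e i q) / g q (e i q) (e i q)) *\<^sub>R e i q)"
    "\<And>q i j. i \<in> Basis \<Longrightarrow> j \<in> Basis \<Longrightarrow> i \<noteq> j \<Longrightarrow> g q (e i q) (e j q) = 0"
proof -
  obtain x :: "'a \<Rightarrow> 'm vfield" and y :: "'a \<Rightarrow> 'm \<Rightarrow> real"
    where x: "\<And>i. x i \<in> VF" and y: "\<And>i. y i \<in> C"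
      and xy: "\<And>i j. i \<in> Basis \<Longrightarrow> j \<in> Basis \<Longrightarrow> x i p (y j) = (if i = j then 1 else 0)"
    by (rule coordinate_frame[of p]) (rule that)
  have lx: "\<And>i j. i \<in> Basis \<Longrightarrow> j \<in> Basis \<Longrightarrow> x j p (y i) = (if i = j then 1 else 0)"
    using xy by auto
  have ly: "linear_within (T p) (\<lambda>v. v (y i))" for i
    by (simp add: linear_within_def)
  obtain e :: "'a \<Rightarrow> 'm vfield" where e: "\<And>i. i \<in> Basis \<Longrightarrow> e i \<in> VF" "\<And>i. i \<in> Basis \<Longrightarrow> e i p \<noteq> 0"
    "\<And>i j q. i \<in> Basis \<Longrightarrow> j \<in> Basis \<Longrightarrow> i \<noteq> j \<Longrightarrow> g q (e i q) (e j q) = 0"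
    by (rule gram_schmidt_fields[where I = Basis and X = x and p = p and l = "\<lambda>i v. v (y i)", OF finite_Basis x ly lx],
        assumption, assumption) (rule that)
  show ?thesis
  proof (rule that[OF e(1,2) _ e(3)])
    fix q v
    assume "\<forall>i\<in>Basis. e i q \<noteq> 0" "v \<in> T q"
    moreover obtain B where "finite B" "T q \<subseteq> span B" "card B \<le> DIM('a)"
      by (rule tangent_space_finite_dim)
    ultimately show "v = (\<Sum>i\<in>Basis. (g q v (e i q) / g q (e i q) (e i q)) *\<^sub>R e i q)"
      using e by (intro inner_product_within.orthogonal_expansion[OF g_inner_product, of B]) (auto simp: VF_T)
  qed
qed

section \<open>Gradients\<close>

definition grad :: "('m \<Rightarrow> real) \<Rightarrow> 'm vfield"
  where "grad f q = (THE v. v \<in> T q \<and> (\<forall>w\<in>T q. g q v w = w f))"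

lemma
  assumes "f \<in> C"
  shows grad_T: "grad f q \<in> T q" and g_grad_left: "w \<in> T q \<Longrightarrow> g q (grad f q) w = w f"
proof -
  obtain e :: "'a \<Rightarrow> 'm vfield" where e: "\<And>i. i \<in> Basis \<Longrightarrow> e i \<in> VF" "\<And>i. i \<in> Basis \<Longrightarrow> e i q \<noteq> 0"
    "\<And>s v. \<forall>i\<in>Basis. e i s \<noteq> 0 \<Longrightarrow> v \<in> T s \<Longrightarrow>
      v = (\<Sum>i\<in>Basis. (g s v (e i s) / g s (e i s) (e i s)) *\<^sub>R e i s)"
    by (rule orthogonal_frame[of q]) (rule that)
  \<comment> \<open>The vector whose inner products with the orthogonal basis are the values
    \<open>e i q f\<close>; this gives existence, and \<open>g_eqI\<close> gives uniqueness.\<close>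
  let ?v = "\<Sum>i\<in>Basis. (e i q f / g q (e i q) (e i q)) *\<^sub>R e i q"
  have v: "?v \<in> T q"
    using e(1) by (intro subspace_sum[OF T_subspace] T_scaleR VF_T)
  have gv: "g q ?v w = w f" if w: "w \<in> T q" for w
  proof -
    have "g q ?v w = g q w ?v" by (rule g_sym[OF v w])
    also have "\<dots> = (\<Sum>i\<in>Basis. (e i q f / g q (e i q) (e i q)) *\<^sub>R g q w (e i q))"
      using e(1) by (intro linear_within_sum[OF T_subspace g_linear[OF w]] VF_T)
    also have "\<dots> = (\<Sum>i\<in>Basis. (g q w (e i q) / g q (e i q) (e i q)) *\<^sub>R e i q) f"
      by (simp add: sum_fun_apply mult.commute)
    also have "\<dots> = w f"
      using e(2,3) w by simp
    finally show ?thesis .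
  qed
  have "\<exists>!v. v \<in> T q \<and> (\<forall>w\<in>T q. g q v w = w f)"
    using v gv by (intro ex1I[of _ ?v]) (auto intro!: g_eqI)
  from theI'[OF this] show "grad f q \<in> T q" "w \<in> T q \<Longrightarrow> g q (grad f q) w = w f"
    unfolding grad_def by auto
qed

lemma g_grad_right: "f \<in> C \<Longrightarrow> w \<in> T q \<Longrightarrow> g q w (grad f q) = w f"
  using g_sym[OF grad_T, of f w q] g_grad_left by simp

lemma grad_VF:
  assumes f: "f \<in> C"
  shows "grad f \<in> VF"
proof (rule VF_I)
  show "grad f q \<in> T q" for q by (rule grad_T[OF f])
  fix h
  assume h: "h \<in> C"
  show "(\<lambda>q. grad f q h) \<in> C"
  proof (rule C_infinity_divide)
    fix p
    obtain e :: "'a \<Rightarrow> 'm vfield" where e: "\<And>i. i \<in> Basis \<Longrightarrow> e i \<in> VF" "\<And>i. i \<in> Basis \<Longrightarrow> e i p \<noteq> 0"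
      "\<And>q v. \<forall>i\<in>Basis. e i q \<noteq> 0 \<Longrightarrow> v \<in> T q \<Longrightarrow>
        v = (\<Sum>i\<in>Basis. (g q v (e i q) / g q (e i q) (e i q)) *\<^sub>R e i q)"
      by (rule orthogonal_frame[of p]) (rule that)
    define N where "N q = (\<Prod>i\<in>Basis. g q (e i q) (e i q))" for q
    define N' where "N' i q = (\<Prod>j\<in>Basis - {i}. g q (e j q) (e j q))" for i q
    have C: "N \<in> C" "i \<in> Basis \<Longrightarrow> N' i \<in> C" for i
      unfolding N_def N'_def using e(1) by (auto intro!: C_prod g_C)
    have Np: "N p \<noteq> 0"
      unfolding N_def using e(1,2) g_eq_0_iff[OF VF_T] by auto
    \<comment> \<open>One factor \<open>N\<close> clears the denominators of the expansion. The
      other makes both sides zero where the frame degenerates and no expansion is available, so the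
      identity holds at every point.\<close>
    have "N q * N q * grad f q h = N q * (\<Sum>i\<in>Basis. N' i q * (e i q f * e i q h))" for q
    proof (cases "N q = 0")
      case False
      then have nz: "g q (e i q) (e i q) \<noteq> 0" if "i \<in> Basis" for i
        using that by (auto simp: N_def)
      then have "\<forall>i\<in>Basis. e i q \<noteq> 0"
        using g_zero_left[OF T_zero] by metis
      from e(3)[OF this grad_T[OF f]]
      have "grad f q h = (\<Sum>i\<in>Basis. (g q (grad f q) (e i q) / g q (e i q) (e i q)) *\<^sub>R e i q) h"
        by simp
      also have "\<dots> = (\<Sum>i\<in>Basis. e i q f / g q (e i q) (e i q) * e i q h)"
        using e(1) by (simp add: sum_fun_apply g_grad_left[OF f] VF_T)
      finally have "N q * grad f q h = (\<Sum>i\<in>Basis. N q * (e i q f / g q (e i q) (e i q) * e i q h))"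
        by (simp add: sum_distrib_left)
      also have "\<dots> = (\<Sum>i\<in>Basis. N' i q * (e i q f * e i q h))"
      proof (rule sum.cong)
        fix i :: 'a
        assume i: "i \<in> Basis"
        have "N q = g q (e i q) (e i q) * N' i q"
          unfolding N_def N'_def using i by (simp add: prod.remove)
        then show "N q * (e i q f / g q (e i q) (e i q) * e i q h) = N' i q * (e i q f * e i q h)"
          using nz[OF i] by simp
      qed simp
      finally show ?thesis by simp
    qed simp
    moreover have "(\<lambda>q. N q * (\<Sum>i\<in>Basis. N' i q * (e i q f * e i q h))) \<in> C"
      by (rule C_mult[OF C(1) C_sum[OF C_mult[OF C(2) C_mult[OF VF_C[OF e(1) f] VF_C[OF e(1) h]]]]])
    ultimately have "(\<lambda>q. N q * N q * grad f q h) \<in> C" by (simp only:)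
    then show "\<exists>N\<in>C. N p \<noteq> 0 \<and> (\<lambda>q. N q * grad f q h) \<in> C"
      using Np C_mult[OF C(1) C(1)] by (intro bexI[of _ "\<lambda>q. N q * N q"]) auto
  qed
qed

end

section \<open>The covariant derivative of the complex structure\<close>

context manifold
begin

lemma T_uminus_fun: "v \<in> T p \<Longrightarrow> f \<in> C \<Longrightarrow> v (\<lambda>q. - f q) = - v f"
  using T_scale[of v p f "-1"] by (simp add: scaleR_fun_def)

lemma lie_bracket_apply: "f \<in> C \<Longrightarrow> lie_bracket \<A> X Y p f = X p (\<lambda>q. Y q f) - Y p (\<lambda>q. X q f)"
  by (simp add: lie_bracket_def deriv_along_def)

end

locale levi_civita = riemannian \<A> g
  for \<A> :: "('m::{t2_space, second_countable_topology}, 'a::euclidean_space) atlas" and g :: "'m form2" +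
  fixes D :: "'m vfield \<Rightarrow> 'm vfield \<Rightarrow> 'm vfield"
  assumes levi_civita: "levi_civita_connection \<A> g D"
begin

lemma
  shows D_VF: "X \<in> VF \<Longrightarrow> Y \<in> VF \<Longrightarrow> D X Y \<in> VF"
    and D_plus_left: "X \<in> VF \<Longrightarrow> Y \<in> VF \<Longrightarrow> Z \<in> VF \<Longrightarrow> D (X + Y) Z = D X Z + D Y Z"
    and D_plus_right: "X \<in> VF \<Longrightarrow> Y \<in> VF \<Longrightarrow> Z \<in> VF \<Longrightarrow> D X (Y + Z) = D X Y + D X Z"
    and D_fscale_left: "f \<in> C \<Longrightarrow> X \<in> VF \<Longrightarrow> Y \<in> VF \<Longrightarrow> D (f \<cdot> X) Y = f \<cdot> D X Y"
    and D_fscale_right: "f \<in> C \<Longrightarrow> X \<in> VF \<Longrightarrow> Y \<in> VF \<Longrightarrow> D X (f \<cdot> Y) = deriv_along X f \<cdot> Y + f \<cdot> D X Y"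
  using levi_civita unfolding levi_civita_connection_def affine_connection_def by blast+

lemma D_torsion: "X \<in> VF \<Longrightarrow> Y \<in> VF \<Longrightarrow> lie_bracket \<A> X Y p = D X Y p - D Y X p"
  using levi_civita unfolding levi_civita_connection_def by (metis minus_apply)

lemma lie_bracket_T: "X \<in> VF \<Longrightarrow> Y \<in> VF \<Longrightarrow> lie_bracket \<A> X Y p \<in> T p"
  by (simp add: D_torsion T_diff VF_T D_VF)

lemma D_metric:
  assumes "X \<in> VF" "Y \<in> VF" "Z \<in> VF"
  shows "X p (\<lambda>q. g q (Y q) (Z q)) = g p (D X Y p) (Z p) + g p (Y p) (D X Z p)"
proof -
  have "deriv_along X (on_fields2 g Y Z) = on_fields2 g (D X Y) Z + on_fields2 g Y (D X Z)"
    using levi_civita assms unfolding levi_civita_connection_def by blast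
  from fun_cong[OF this, of p] show ?thesis
    by (simp add: deriv_along_def on_fields2_def)
qed

lemma D_zero_left: "Y \<in> VF \<Longrightarrow> D 0 Y = 0"
  using D_plus_left[OF VF_zero VF_zero, of Y] by simp

lemma D_zero_right: "X \<in> VF \<Longrightarrow> D X 0 = 0"
  using D_plus_right[OF _ VF_zero VF_zero, of X] by simp

lemma D_minus_right: "X \<in> VF \<Longrightarrow> Y \<in> VF \<Longrightarrow> D X (- Y) = - D X Y"
  using D_plus_right[of X Y "- Y"] D_zero_right[of X]
  by (simp add: VF_minus eq_neg_iff_add_eq_0 add.commute)

text \<open>The right-hand side involves only the metric and Lie brackets, both of which can be
  compared across a Riemannian submersion; this is the route from \<open>D\<close> to the connection
  of the base.\<close>

lemma koszul:
  assumes "X \<in> VF" "Y \<in> VF" "Z \<in> VF"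
  shows "2 * g p (D X Y p) (Z p) =
    X p (\<lambda>q. g q (Y q) (Z q)) + Y p (\<lambda>q. g q (Z q) (X q)) - Z p (\<lambda>q. g q (X q) (Y q))
    + g p (lie_bracket \<A> X Y p) (Z p) - g p (lie_bracket \<A> X Z p) (Y p) - g p (lie_bracket \<A> Y Z p) (X p)"
proof -
  note T = assms[THEN VF_T, of p]
  have DT: "D U V p \<in> T p" if "U \<in> VF" "V \<in> VF" for U V
    by (rule VF_T[OF D_VF[OF that]])
  show ?thesis
    using assms T g_sym[OF T(1) DT[OF assms(2,3)]] g_sym[OF T(2) DT[OF assms(1,3)]]
      g_sym[OF T(3) DT[OF assms(2,1)]] g_sym[OF T(3) DT[OF assms(1,2)]] g_sym[OF T(1) DT[OF assms(3,2)]]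
      g_sym[OF T(2) DT[OF assms(3,1)]]
    by (simp add: D_metric D_torsion DT g_diff_left)
qed

end

locale lcK = levi_civita \<A> g D
  for \<A> :: "('m::{t2_space, second_countable_topology}, 'a::euclidean_space) atlas" and g :: "'m form2"
    and D :: "'m vfield \<Rightarrow> 'm vfield \<Rightarrow> 'm vfield" +
  fixes J :: "'m endo" and \<omega> :: "'m form1" and B1 :: "'m vfield"
  assumes lcK: "lcK_manifold \<A> g J \<omega>" and lee: "lee_vector_field \<A> g \<omega> B1"
begin

lemma J_complex: "almost_complex_structure \<A> J"
  using lcK unfolding lcK_manifold_def hermitian_manifold_def by blast

lemma J_T: "u \<in> T p \<Longrightarrow> J p u \<in> T p"
  using J_complex unfolding almost_complex_structure_def by blast

lemma J_scale: "u \<in> T p \<Longrightarrow> J p (c *\<^sub>R u) = c *\<^sub>R J p u"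
  using J_complex unfolding almost_complex_structure_def linear_within_def by blast

lemma J_J: "u \<in> T p \<Longrightarrow> J p (J p u) = - u"
  using J_complex unfolding almost_complex_structure_def by blast

lemma J_isometry: "u \<in> T p \<Longrightarrow> v \<in> T p \<Longrightarrow> g p (J p u) (J p v) = g p u v"
  using lcK unfolding lcK_manifold_def hermitian_manifold_def by blast

lemma g_J_right: "u \<in> T p \<Longrightarrow> v \<in> T p \<Longrightarrow> g p u (J p v) = - g p (J p u) v"
  using J_isometry[of "J p u" p v] by (simp add: J_J J_T g_minus_left)

abbreviation JF :: "'m vfield \<Rightarrow> 'm vfield"
  where "JF X \<equiv> on_field J X"

lemma JF_VF: "X \<in> VF \<Longrightarrow> JF X \<in> VF"
  using J_complex unfolding almost_complex_structure_def by blast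

lemma JF_JF: "X \<in> VF \<Longrightarrow> JF (JF X) = - X"
  by (simp add: fun_eq_iff on_field_def J_J VF_T)

lemma B1_VF: "B1 \<in> VF"
  using lee unfolding lee_vector_field_def by blast

lemma omega_eq: "X \<in> VF \<Longrightarrow> \<omega> p (X p) = g p (X p) (B1 p)"
  using lee unfolding lee_vector_field_def on_fields2_def on_field_def by (metis (mono_tags))

lemma omega_C: "X \<in> VF \<Longrightarrow> (\<lambda>p. \<omega> p (X p)) \<in> C"
  using lcK unfolding lcK_manifold_def one_form_def on_field_def by blast

text \<open>This is \<open>g((D\<^sub>X J) Y, Z)\<close>, as \<open>J\<close> is skew.\<close>

definition dJ :: "'m vfield \<Rightarrow> 'm vfield \<Rightarrow> 'm vfield \<Rightarrow> 'm \<Rightarrow> real"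
  where "dJ X Y Z p = g p (D X (JF Y) p) (Z p) + g p (D X Y p) (J p (Z p))"

text \<open>Differentiate g(JY, Z) = - g(Y, JZ) along \<open>X\<close> by metric
  compatibility.\<close>

lemma dJ_skew:
  assumes "X \<in> VF" "Y \<in> VF" "Z \<in> VF"
  shows "dJ X Y Z p = - dJ X Z Y p"
proof -
  have "(\<lambda>q. g q (JF Y q) (Z q)) = (\<lambda>q. - g q (Y q) (JF Z q))"
    using assms by (simp add: on_field_def g_J_right VF_T)
  then have "X p (\<lambda>q. g q (JF Y q) (Z q)) = - X p (\<lambda>q. g q (Y q) (JF Z q))"
    using T_uminus_fun[OF VF_T g_C, OF assms(1,2) JF_VF[OF assms(3)]] by simp
  then show ?thesis
    using assms g_sym[OF VF_T VF_T, OF JF_VF D_VF, of Y X Z p] g_sym[OF VF_T VF_T, OF _ D_VF, of Y X "JF Z" p]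
    by (simp add: D_metric JF_VF dJ_def) (simp add: on_field_def)
qed

text \<open>Differentiating J^2 = -1 shows that D_X J anticommutes with J; since J is an isometry,
  the two occurrences of J leave only a sign.\<close>

lemma dJ_J:
  assumes "X \<in> VF" "Y \<in> VF" "Z \<in> VF"
  shows "dJ X (JF Y) (JF Z) p = - dJ X Y Z p"
proof -
  have "JF Z p = J p (Z p)" by (simp add: on_field_def)
  then show ?thesis
    using assms by (simp add: dJ_def JF_JF D_minus_right g_minus_left g_minus_right D_VF JF_VF VF_T J_J J_T)
qed

text \<open>Torsion-freeness turns the brackets into covariant derivatives, and what remains is the
  alternating sum of (D_X \<Omega>)(Y, Z) = g(Y, (D_X J)Z), which is
  \<open>dJ X Z Y\<close>.\<close>

lemma ext_deriv2_dJ: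
  assumes "X \<in> VF" "Y \<in> VF" "Z \<in> VF"
  shows "ext_deriv2 \<A> (fundamental_form g J) X Y Z p = dJ X Z Y p - dJ Y Z X p + dJ Z Y X p"
proof -
  have *: "on_fields2 (fundamental_form g J) U V = (\<lambda>q. g q (U q) (JF V q))" for U V
    by (simp add: on_fields2_def fundamental_form_def on_field_def)
  have sym: "g p (U p) (D V W p) = g p (D V W p) (U p)" if "U \<in> VF" "V \<in> VF" "W \<in> VF" for U V W
    by (rule g_sym[OF VF_T[OF that(1)] VF_T[OF D_VF[OF that(2,3)]]])
  have br: "g p (lie_bracket \<A> U V p) (JF W p) = g p (D U V p) (JF W p) - g p (D V U p) (JF W p)"
    if "U \<in> VF" "V \<in> VF" "W \<in> VF" for U V W
    using that by (simp add: D_torsion g_diff_left VF_T D_VF JF_VF)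
  have JFp: "JF U p = J p (U p)" for U by (simp add: on_field_def)
  show ?thesis
    unfolding ext_deriv2_def * deriv_along_def
    using assms by (simp add: D_metric JF_VF br sym dJ_def) (simp add: JFp)
qed

lemma nijenhuis_dJ:
  assumes X: "X \<in> VF" and Y: "Y \<in> VF" and Z: "Z \<in> VF"
  shows "dJ (JF Y) (JF Z) X p - dJ (JF Z) (JF Y) X p + dJ Z Y X p - dJ Y Z X p = 0"
proof -
  let ?L = "lie_bracket \<A>"
  have "nijenhuis \<A> J Y Z p = 0"
    using lcK Y Z unfolding lcK_manifold_def hermitian_manifold_def by (metis zero_fun_apply)
  then have N: "?L (JF Y) (JF Z) p - J p (?L (JF Y) Z p) - J p (?L Y (JF Z) p) - ?L Y Z p = 0"
    by (simp add: nijenhuis_def on_field_def)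
  note V = X Y Z JF_VF[OF X] JF_VF[OF Y] JF_VF[OF Z]
  have LT: "?L U W p \<in> T p" if "U \<in> VF" "W \<in> VF" for U W
    using lie_bracket_T[OF that] .
  \<comment> \<open>Pairing with JX rather than X moves the J of the two middle terms away by
    isometry, so that the brackets group into values of \<open>dJ\<close>.\<close>
  have "g p (?L (JF Y) (JF Z) p - J p (?L (JF Y) Z p) - J p (?L Y (JF Z) p) - ?L Y Z p) (J p (X p)) = 0"
    unfolding N using J_T VF_T[OF X] by (simp add: g_zero_left)
  then have "g p (?L (JF Y) (JF Z) p) (J p (X p)) - g p (?L (JF Y) Z p) (X p)
      - g p (?L Y (JF Z) p) (X p) - g p (?L Y Z p) (J p (X p)) = 0"
    using V by (simp add: g_diff_left LT J_T T_diff VF_T J_isometry)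
  moreover have "g p (?L U W p) v = g p (D U W p) v - g p (D W U p) v" if "U \<in> VF" "W \<in> VF" "v \<in> T p" for U W v
    using that by (simp add: D_torsion g_diff_left VF_T D_VF)
  ultimately show ?thesis
    using V by (simp add: dJ_def JF_JF D_minus_right g_minus_left D_VF VF_T J_T)
qed

text \<open>In d\<Omega>(X, JY, JZ) - d\<Omega>(X, Y, Z) the terms with X in the first slot of
  \<open>dJ\<close> add up to \<open>2 * dJ X Y Z\<close>, and the other four are the expression of
  \<open>nijenhuis_dJ\<close>. After inserting d\<Omega> = \<omega> \<and> \<Omega>, the terms with
  \<omega>(X) cancel because \<Omega>(JY, JZ) = \<Omega>(Y, Z).\<close>

lemma dJ_eq:
  assumes X: "X \<in> VF" and Y: "Y \<in> VF" and Z: "Z \<in> VF"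
  shows "2 * dJ X Y Z p = \<omega> p (J p (Y p)) * g p (X p) (Z p) - \<omega> p (J p (Z p)) * g p (X p) (Y p)
    + \<omega> p (Y p) * g p (X p) (J p (Z p)) - \<omega> p (Z p) * g p (X p) (J p (Y p))"
proof -
  let ?\<Omega> = "fundamental_form g J"
  have d: "ext_deriv2 \<A> ?\<Omega> U V W p = wedge12 \<omega> ?\<Omega> U V W p" if "U \<in> VF" "V \<in> VF" "W \<in> VF" for U V W
    using lcK that unfolding lcK_manifold_def by metis
  note V = JF_VF[OF Y] JF_VF[OF Z]
  have "2 * dJ X Y Z p = ext_deriv2 \<A> ?\<Omega> X (JF Y) (JF Z) p - ext_deriv2 \<A> ?\<Omega> X Y Z p"
    using nijenhuis_dJ[OF X Y Z, of p] dJ_J[OF X Z Y, of p] dJ_skew[OF X Y Z, of p]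
    by (simp add: ext_deriv2_dJ X Y Z V)
  also have "\<dots> = wedge12 \<omega> ?\<Omega> X (JF Y) (JF Z) p - wedge12 \<omega> ?\<Omega> X Y Z p"
    by (simp only: d[OF X V] d[OF X Y Z])
  also have "\<dots> = \<omega> p (J p (Y p)) * g p (X p) (Z p) - \<omega> p (J p (Z p)) * g p (X p) (Y p)
    + \<omega> p (Y p) * g p (X p) (J p (Z p)) - \<omega> p (Z p) * g p (X p) (J p (Y p))"
    using X Y Z by (simp add: wedge12_def on_field_def on_fields2_def fundamental_form_def
        J_isometry J_J J_T VF_T g_minus_right g_J_right algebra_simps)
  finally show ?thesis .
qed

lemma nabla_J:
  assumes X: "X \<in> VF" and Y: "Y \<in> VF"
  shows "D X (JF Y) p = J p (D X Y p) + (1/2) *\<^sub>R (\<omega> p (J p (Y p)) *\<^sub>R X p - \<omega> p (Y p) *\<^sub>R J p (X p)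
    - g p (X p) (Y p) *\<^sub>R anti_lee_vector_field J B1 p - g p (X p) (J p (Y p)) *\<^sub>R B1 p)"
proof -
  \<comment> \<open>\<open>R\<close> is the claimed correction, assembled as a global field, and
    \<open>Z\<close> is the error of the formula. Since \<open>Z\<close> is a field,
    \<open>dJ_eq\<close> may be tested against \<open>Z\<close> itself, which gives it length
    zero.\<close>
  define R where "R = (1/2) *\<^sub>R ((\<lambda>q. \<omega> q (JF Y q)) \<cdot> X - (\<lambda>q. \<omega> q (Y q)) \<cdot> JF X
    - (\<lambda>q. g q (X q) (Y q)) \<cdot> - JF B1 - (\<lambda>q. g q (X q) (JF Y q)) \<cdot> B1)"
  define Z where "Z = D X (JF Y) - JF (D X Y) - R"
  have R: "R \<in> VF"
    unfolding R_def by (intro VF_scaleR VF_diff VF_fscale VF_minus JF_VF X Y B1_VF omega_C g_C)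
  have Z: "Z \<in> VF"
    unfolding Z_def by (intro VF_diff D_VF JF_VF X Y R)
  note TT = VF_T[OF X, of p] VF_T[OF Y, of p] VF_T[OF Z, of p] VF_T[OF B1_VF, of p] VF_T[OF D_VF[OF X Y], of p]
    VF_T[OF D_VF[OF X JF_VF[OF Y]], of p]
  have Rp: "R p = (1/2) *\<^sub>R (\<omega> p (J p (Y p)) *\<^sub>R X p - \<omega> p (Y p) *\<^sub>R J p (X p)
    - g p (X p) (Y p) *\<^sub>R (- J p (B1 p)) - g p (X p) (J p (Y p)) *\<^sub>R B1 p)"
    by (simp add: R_def fscale_def on_field_def)
  have "g p (D X (JF Y) p - J p (D X Y p)) (Z p) = dJ X Y Z p"
    using TT by (simp add: dJ_def g_diff_left J_T g_J_right)
  also have "\<dots> = g p (R p) (Z p)"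
  proof -
    have "\<omega> p (Z p) = g p (B1 p) (Z p)" "\<omega> p (J p (Z p)) = - g p (J p (B1 p)) (Z p)"
      using omega_eq[OF Z, of p] omega_eq[OF JF_VF[OF Z], of p] g_sym[OF TT(3,4)] g_sym[OF J_T[OF TT(3)] TT(4)] TT
      by (simp_all add: on_field_def g_J_right)
    then have "2 * g p (R p) (Z p) = 2 * dJ X Y Z p"
      unfolding dJ_eq[OF X Y Z] Rp using TT
      by (simp add: g_simps T_diff T_plus T_scaleR T_minus J_T g_J_right)
    then show ?thesis by simp
  qed
  finally have "g p (Z p) (Z p) = 0"
    using TT VF_T[OF R, of p] by (simp add: Z_def on_field_def g_diff_left J_T T_diff)
  then have "Z p = 0"
    using g_eq_0_iff[OF TT(3)] by simp
  then have "D X (JF Y) p = J p (D X Y p) + R p"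
    by (simp add: Z_def on_field_def algebra_simps)
  then show ?thesis
    unfolding Rp by (simp add: anti_lee_vector_field_def on_field_def)
qed

end

section \<open>Horizontal frames of a Riemannian submersion\<close>

locale riemannian_submersion_lc =
  M: levi_civita \<A> g D + N: levi_civita \<B> g\<^sub>B D\<^sub>B
  for \<A> :: "('m::{t2_space, second_countable_topology}, 'a::euclidean_space) atlas"
    and g :: "'m form2" and D :: "'m vfield \<Rightarrow> 'm vfield \<Rightarrow> 'm vfield"
    and \<B> :: "('n::{t2_space, second_countable_topology}, 'b::euclidean_space) atlas"
    and g\<^sub>B :: "'n form2" and D\<^sub>B :: "'n vfield \<Rightarrow> 'n vfield \<Rightarrow> 'n vfield" +
  fixes \<pi> :: "'m \<Rightarrow> 'n"
    and P :: "'m vfield \<Rightarrow> ('m \<Rightarrow> 'n tvec) \<Rightarrow> ('m \<Rightarrow> 'n tvec)"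
  assumes submersion: "riemannian_submersion \<A> g \<B> g\<^sub>B \<pi>"
    and pullback: "pullback_connection \<A> \<B> \<pi> D\<^sub>B P"
begin

abbreviation "ver \<equiv> vertical_space \<A> \<B> \<pi>"
abbreviation "hor \<equiv> horizontal_space \<A> g \<B> \<pi>"
abbreviation "d \<equiv> differential \<B> \<pi>"

lemma C_compose:
  assumes h: "h \<in> N.C"
  shows "h \<circ> \<pi> \<in> M.C"
proof (rule M.C_infinityI_local)
  fix p
  have sm: "smooth_map \<A> \<B> \<pi>"
    using submersion unfolding riemannian_submersion_def by blast
  obtain U \<phi> where U: "(U, \<phi>) \<in> \<A>" "p \<in> U" by (rule M.chart_at)
  obtain V \<psi> where V: "(V, \<psi>) \<in> \<B>" "\<pi> p \<in> V" by (rule N.chart_at)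
  let ?W = "U \<inter> \<pi> -` V"
  have "open (\<pi> -` V)"
    using sm N.chart_open(1)[OF V(1)] open_vimage unfolding smooth_map_def by blast
  then have W: "open ?W" "open (\<phi> ` ?W)"
    using M.chart_open(1)[OF U(1)] M.chart_image_open[OF U(1)] by auto
  have s: "smooth_on (\<phi> ` ?W) (\<psi> \<circ> \<pi> \<circ> inv_into U \<phi>)"
    using sm U(1) V(1) unfolding smooth_map_def by fast
  have "smooth_on (\<phi> ` ?W) (\<lambda>x. (h \<circ> inv_into V \<psi>) ((\<psi> \<circ> \<pi> \<circ> inv_into U \<phi>) x))"
    by (rule smooth_on_compose[OF W(2) _ N.C_infinity_smooth_on[OF h V(1)] s]) (auto simp: M.chart_inv[OF U(1)])
  then have "smooth_on (\<phi> ` ?W) (h \<circ> \<pi> \<circ> inv_into U \<phi>)"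
    by (rule smooth_on_cong[OF W(2), rotated]) (auto simp: M.chart_inv[OF U(1)] N.chart_inv[OF V(1)])
  then show "\<exists>U \<phi> W. (U, \<phi>) \<in> \<A> \<and> open W \<and> p \<in> W \<and> W \<subseteq> U \<and> smooth_on (\<phi> ` W) (h \<circ> \<pi> \<circ> inv_into U \<phi>)"
    using U V W(1) by blast
qed

lemma d_image: "d ` M.T p = N.T (\<pi> p)"
  using submersion unfolding riemannian_submersion_def by blast

lemma d_T: "v \<in> M.T p \<Longrightarrow> d v \<in> N.T (\<pi> p)"
  using d_image by blast

lemma d_apply: "h \<in> N.C \<Longrightarrow> d v h = v (h \<circ> \<pi>)"
  by (simp add: differential_def)

lemma d_plus: "d (u + v) = d u + d v"
  and d_scaleR: "d (c *\<^sub>R u) = c *\<^sub>R d u"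
  and d_zero: "d 0 = 0"
  by (auto simp: differential_def fun_eq_iff)

lemma d_diff: "d (u - v) = d u - d v"
  by (auto simp: differential_def fun_eq_iff)

lemma d_sum: "d (\<Sum>i\<in>I. c i *\<^sub>R x i) = (\<Sum>i\<in>I. c i *\<^sub>R d (x i))"
  by (induction I rule: infinite_finite_induct) (simp_all only: sum.infinite sum.empty sum.insert d_zero d_plus d_scaleR not_False_eq_True)

lemma
  shows ver_T: "v \<in> ver p \<Longrightarrow> v \<in> M.T p" and ver_d: "v \<in> ver p \<Longrightarrow> d v = 0"
    and hor_T: "k \<in> hor p \<Longrightarrow> k \<in> M.T p"
    and hor_ver: "k \<in> hor p \<Longrightarrow> v \<in> ver p \<Longrightarrow> g p k v = 0"
  by (auto simp: vertical_space_def horizontal_space_def)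

lemma ver_hor: "k \<in> hor p \<Longrightarrow> v \<in> ver p \<Longrightarrow> g p v k = 0"
  using hor_ver M.g_sym ver_T hor_T by metis

lemma ver_I: "v \<in> M.T p \<Longrightarrow> d v = 0 \<Longrightarrow> v \<in> ver p"
  by (simp add: vertical_space_def)

lemma hor_I: "k \<in> M.T p \<Longrightarrow> (\<And>v. v \<in> ver p \<Longrightarrow> g p k v = 0) \<Longrightarrow> k \<in> hor p"
  by (simp add: horizontal_space_def)

lemma ver_subspace: "subspace (ver p)"
  unfolding subspace_def vertical_space_def by (simp add: M.T_zero M.T_plus M.T_scaleR d_plus d_scaleR d_zero)

lemma hor_subspace: "subspace (hor p)"
  unfolding subspace_def
proof (intro conjI ballI allI)
  show "0 \<in> hor p"
    by (intro hor_I) (auto simp: M.T_zero M.g_zero_left ver_T)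
  show "u + v \<in> hor p" if "u \<in> hor p" "v \<in> hor p" for u v
    using that by (intro hor_I) (auto simp: M.T_plus M.g_add_left ver_T hor_T hor_ver)
  show "c *\<^sub>R u \<in> hor p" if "u \<in> hor p" for c u
    using that by (intro hor_I) (auto simp: M.T_scaleR M.g_scale_left ver_T hor_T hor_ver)
qed

lemma ver_hor_zero: "v \<in> ver p \<Longrightarrow> v \<in> hor p \<Longrightarrow> v = 0"
  using M.g_eq_0_iff[OF ver_T] hor_ver by blast

text \<open>Polarisation: the submersion is only assumed to preserve lengths of horizontal
  vectors.\<close>

lemma d_isometry:
  assumes u: "u \<in> hor p" and v: "v \<in> hor p"
  shows "g\<^sub>B (\<pi> p) (d u) (d v) = g p u v"
proof -
  have norm: "g\<^sub>B (\<pi> p) (d k) (d k) = g p k k" if "k \<in> hor p" for k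
    using submersion that unfolding riemannian_submersion_def by blast
  have T: "u \<in> M.T p" "v \<in> M.T p" "d u \<in> N.T (\<pi> p)" "d v \<in> N.T (\<pi> p)"
    using u v hor_T d_T by auto
  have "g\<^sub>B (\<pi> p) (d u + d v) (d u + d v) = g p (u + v) (u + v)"
    using norm[OF subspace_add[OF hor_subspace u v]] by (simp only: d_plus)
  then show ?thesis
    using norm[OF u] norm[OF v] M.g_sym[OF T(1,2)] N.g_sym[OF T(3,4)] T
    by (simp only: M.g_add_left M.g_add_right N.g_add_left N.g_add_right M.T_plus N.T_plus)
qed

text \<open>For vertical v, g(grad (h \<circ> \<pi>), v) = v(h \<circ> \<pi>) = (d v) h = 0. This is
  the supply of horizontal fields.\<close>

lemma grad_hor: "h \<in> N.C \<Longrightarrow> M.grad (h \<circ> \<pi>) p \<in> hor p"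
  using ver_d d_apply by (intro hor_I) (auto simp: M.grad_T C_compose M.g_grad_left ver_T d_apply[symmetric])

lemma sections_I: "X \<in> M.VF \<Longrightarrow> (\<And>p. X p \<in> S p) \<Longrightarrow> X \<in> sections \<A> S"
  by (simp add: sections_def)

lemma sections_D: "X \<in> sections \<A> S \<Longrightarrow> X p \<in> S p" and sections_VF: "X \<in> sections \<A> S \<Longrightarrow> X \<in> M.VF"
  by (simp_all add: sections_def)

lemma submodule_sections:
  assumes "\<And>p. subspace (S p)"
  shows "M.submodule (sections \<A> S)"
  unfolding M.submodule_def sections_def
  using assms by (auto simp: M.VF_plus M.VF_fscale fscale_def[of _ _, THEN fun_cong] subspace_add subspace_scale)

text \<open>Gram-Schmidt applied to gradients of coordinate functions pulled back from the base. The
  last clause lets a property pass from these gradients to the orthogonalised fields.\<close>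

lemma horizontal_frame:
  fixes p :: 'm
  obtains Y :: "'b \<Rightarrow> 'm vfield" where "\<And>i. i \<in> Basis \<Longrightarrow> Y i \<in> sections \<A> hor" "\<And>i. i \<in> Basis \<Longrightarrow> Y i p \<noteq> 0"
    "\<And>q v. \<forall>i\<in>Basis. Y i q \<noteq> 0 \<Longrightarrow> v \<in> M.T q \<Longrightarrow>
      v - (\<Sum>i\<in>Basis. (g q v (Y i q) / g q (Y i q) (Y i q)) *\<^sub>R Y i q) \<in> ver q"
    "\<And>i L. i \<in> Basis \<Longrightarrow> M.submodule L \<Longrightarrow> \<forall>h\<in>N.C. M.grad (h \<circ> \<pi>) \<in> L \<Longrightarrow> Y i \<in> L"
proof -
  obtain x :: "'b \<Rightarrow> 'n vfield" and y :: "'b \<Rightarrow> 'n \<Rightarrow> real"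
    where x: "\<And>i. x i \<in> N.VF" and y: "\<And>i. y i \<in> N.C"
      and xy: "\<And>i j. i \<in> Basis \<Longrightarrow> j \<in> Basis \<Longrightarrow> x i (\<pi> p) (y j) = (if i = j then 1 else 0)"
    by (rule N.coordinate_frame[of "\<pi> p"]) (rule that)
  \<comment> \<open>Lifts of the coordinate vectors at \<pi>(p). Inner products with them are
    functionals dual to the gradients, as Gram-Schmidt demands.\<close>
  have "\<exists>v. v \<in> M.T p \<and> d v = x i (\<pi> p)" for i
    using d_image[of p] N.VF_T[OF x[of i], of "\<pi> p"] by (metis imageE)
  then obtain v where v: "\<And>i. v i \<in> M.T p" "\<And>i. d (v i) = x i (\<pi> p)" by metis
  define X where "X i = M.grad (y i \<circ> \<pi>)" for i
  have XVF: "X i \<in> M.VF" for i unfolding X_def by (rule M.grad_VF[OF C_compose[OF y]])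
  have lin: "linear_within (M.T p) (\<lambda>u. g p u (v i))" for i
    using v(1) by (simp add: linear_within_def M.g_add_left M.g_scale_left)
  have dual: "g p (X j p) (v i) = (if i = j then 1 else 0)" if "i \<in> Basis" "j \<in> Basis" for i j
    using M.g_grad_left[OF C_compose[OF y] v(1), of j i] v(2)[of i] xy[OF that] d_apply[OF y, of "v i" j]
    by (simp add: X_def)
  obtain Y :: "'b \<Rightarrow> 'm vfield" where Y: "\<And>i. i \<in> Basis \<Longrightarrow> Y i \<in> M.VF" "\<And>i. i \<in> Basis \<Longrightarrow> Y i p \<noteq> 0"
    "\<And>i j q. i \<in> Basis \<Longrightarrow> j \<in> Basis \<Longrightarrow> i \<noteq> j \<Longrightarrow> g q (Y i q) (Y j q) = 0"
    "\<And>i L. i \<in> Basis \<Longrightarrow> M.submodule L \<Longrightarrow> X ` Basis \<subseteq> L \<Longrightarrow> Y i \<in> L"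
    by (rule M.gram_schmidt_fields[where I = Basis and X = X and p = p and l = "\<lambda>i u. g p u (v i)",
          OF finite_Basis XVF lin dual], assumption, assumption) (rule that)
  have YL: "Y i \<in> L" if "i \<in> Basis" "M.submodule L" "\<forall>h\<in>N.C. M.grad (h \<circ> \<pi>) \<in> L" for i L
    using that y by (intro Y(4)) (auto simp: X_def)
  have Yh: "Y i \<in> sections \<A> hor" if "i \<in> Basis" for i
    using that by (intro YL submodule_sections hor_subspace ballI sections_I M.grad_VF C_compose grad_hor)
  have dec: "u - (\<Sum>i\<in>Basis. (g q u (Y i q) / g q (Y i q) (Y i q)) *\<^sub>R Y i q) \<in> ver q"
    if nz: "\<forall>i\<in>Basis. Y i q \<noteq> 0" and u: "u \<in> M.T q" for q u
  proof -
    obtain B where B: "finite B" "N.T (\<pi> q) \<subseteq> span B" "card B \<le> DIM('b)"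
      by (rule N.tangent_space_finite_dim)
    define e where "e i = d (Y i q)" for i
    have Yq: "Y i q \<in> hor q" "Y i q \<in> M.T q" if "i \<in> Basis" for i
      using Yh[OF that] sections_D hor_T by blast+
    have gpos: "g q (Y i q) (Y i q) > 0" if "i \<in> Basis" for i
      using M.g_pos[OF Yq(2)[OF that]] nz that by blast
    have ge: "g\<^sub>B (\<pi> q) (e i) (e j) = g q (Y i q) (Y j q)" if "i \<in> Basis" "j \<in> Basis" for i j
      unfolding e_def by (rule d_isometry[OF Yq(1)[OF that(1)] Yq(1)[OF that(2)]])
    have eT: "e i \<in> N.T (\<pi> q)" if "i \<in> Basis" for i
      unfolding e_def by (rule d_T[OF Yq(2)[OF that]])
    have e0: "e i \<noteq> 0" if "i \<in> Basis" for i
    proof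
      assume "e i = 0"
      then have "g\<^sub>B (\<pi> q) (e i) (e i) = 0" using N.g_eq_0_iff[OF eT[OF that]] by simp
      then show False using ge[OF that that] gpos[OF that] by simp
    qed
    define c where "c i = g\<^sub>B (\<pi> q) (d u) (e i) / g\<^sub>B (\<pi> q) (e i) (e i)" for i
    \<comment> \<open>The images of the frame are as many nonzero orthogonal vectors as the
      dimension of the base, so they expand \<open>d u\<close>. The same combination upstairs
      differs from \<open>u\<close> by a vertical vector, which fixes its coefficients by
      orthogonality.\<close>
    have du: "d u = (\<Sum>i\<in>Basis. c i *\<^sub>R e i)"
      unfolding c_def
      by (rule inner_product_within.orthogonal_expansion[OF N.g_inner_product B finite_Basis eT e0 _ d_T[OF u]])
        (simp_all add: ge Y(3))
    define k where "k = (\<Sum>i\<in>Basis. c i *\<^sub>R Y i q)"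
    have k: "k \<in> M.T q"
      unfolding k_def using Yq(2) by (intro subspace_sum[OF M.T_subspace] M.T_scaleR)
    have uk: "u - k \<in> ver q"
      by (rule ver_I[OF M.T_diff[OF u k]]) (simp add: d_diff du k_def d_sum e_def)
    have "c j = g q u (Y j q) / g q (Y j q) (Y j q)" if j: "j \<in> Basis" for j
    proof -
      have "g q (Y j q) k = (\<Sum>i\<in>Basis. c i *\<^sub>R g q (Y j q) (Y i q))"
        unfolding k_def by (rule linear_within_sum[OF M.T_subspace M.g_linear[OF Yq(2)[OF j]] Yq(2)])
      also have "\<dots> = (\<Sum>i\<in>Basis. if i = j then c j * g q (Y j q) (Y j q) else 0)"
        using Y(3) j by (intro sum.cong) auto
      finally have "g q (Y j q) k = c j * g q (Y j q) (Y j q)"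
        using j by simp
      moreover have "g q (Y j q) (u - k) = 0"
        by (rule hor_ver[OF Yq(1)[OF j] uk])
      ultimately have "g q u (Y j q) = c j * g q (Y j q) (Y j q)"
        using M.g_sym[OF u Yq(2)[OF j]] by (simp add: M.g_diff_right Yq(2)[OF j] u k)
      then show ?thesis using gpos[OF j] by simp
    qed
    then show ?thesis using uk by (simp add: k_def)
  qed
  show ?thesis
    by (rule that[of Y]) (fact Yh, fact Y(2), fact dec, fact YL)
qed

text \<open>Together with \<open>ver_hor_zero\<close> this gives meaning to the definite description
  in \<open>ver_proj\<close>.\<close>

lemma decomposition:
  assumes v: "v \<in> M.T p"
  obtains a k where "a \<in> ver p" "k \<in> hor p" "v = a + k"
proof -
  obtain Y :: "'b \<Rightarrow> 'm vfield" where Y: "\<And>i. i \<in> Basis \<Longrightarrow> Y i \<in> sections \<A> hor" "\<And>i. i \<in> Basis \<Longrightarrow> Y i p \<noteq> 0"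
    "\<And>q v. \<forall>i\<in>Basis. Y i q \<noteq> 0 \<Longrightarrow> v \<in> M.T q \<Longrightarrow>
      v - (\<Sum>i\<in>Basis. (g q v (Y i q) / g q (Y i q) (Y i q)) *\<^sub>R Y i q) \<in> ver q"
    by (rule horizontal_frame[of p]) (rule that)
  let ?k = "\<Sum>i\<in>Basis. (g p v (Y i p) / g p (Y i p) (Y i p)) *\<^sub>R Y i p"
  have "?k \<in> hor p"
    using Y(1) by (intro subspace_sum[OF hor_subspace] subspace_scale[OF hor_subspace] sections_D)
  moreover have "v - ?k \<in> ver p"
    using Y(2,3) v by blast
  ultimately show ?thesis
    using that[of "v - ?k" ?k] by simp
qed

text \<open>Every tangent vector of the base is the image of a horizontal one, and on horizontal
  vectors \<open>d\<close> preserves inner products. Hence both sides pair with it to the same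
  derivative of \<open>h\<close>.\<close>

lemma d_grad:
  assumes h: "h \<in> N.C"
  shows "d (M.grad (h \<circ> \<pi>) p) = N.grad h (\<pi> p)"
proof (rule N.g_eqI[OF d_T[OF M.grad_T[OF C_compose[OF h]]] N.grad_T[OF h]])
  fix w
  assume "w \<in> N.T (\<pi> p)"
  then obtain v where v: "v \<in> M.T p" "w = d v"
    using d_image[of p] by blast
  obtain a k where ak: "a \<in> ver p" "k \<in> hor p" "v = a + k"
    by (rule decomposition[OF v(1)])
  have w: "w = d k"
    using v(2) ver_d[OF ak(1)] by (simp add: ak(3) d_plus)
  show "g\<^sub>B (\<pi> p) (d (M.grad (h \<circ> \<pi>) p)) w = g\<^sub>B (\<pi> p) (N.grad h (\<pi> p)) w"
    using d_isometry[OF grad_hor[OF h] ak(2)] M.g_grad_left[OF C_compose[OF h] hor_T[OF ak(2)]]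
      N.g_grad_left[OF h d_T[OF hor_T[OF ak(2)]]] d_apply[OF h]
    by (simp add: w)
qed

lemma grad_compose: "h \<in> N.C \<Longrightarrow> f \<in> N.C \<Longrightarrow> M.grad (h \<circ> \<pi>) p (f \<circ> \<pi>) = N.grad h (\<pi> p) f"
  using d_grad[of h p] d_apply[of f "M.grad (h \<circ> \<pi>) p"] by simp

section \<open>Projections and O'Neill tensors\<close>

lemma ver_proj_eq:
  assumes "a \<in> ver p" "k \<in> hor p"
  shows "ver_proj \<A> g \<B> \<pi> p (a + k) = a"
  unfolding ver_proj_def
proof (rule the_equality)
  show "a \<in> ver p \<and> a + k - a \<in> hor p"
    using assms by simp
next
  fix u
  assume u: "u \<in> ver p \<and> a + k - u \<in> hor p"
  have "a - u \<in> ver p"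
    using assms(1) u by (intro subspace_diff[OF ver_subspace]) auto
  moreover have "(a + k - u) - k \<in> hor p"
    by (rule subspace_diff[OF hor_subspace conjunct2[OF u] assms(2)])
  then have "a - u \<in> hor p" by (simp add: algebra_simps)
  ultimately have "a - u = 0" by (rule ver_hor_zero)
  then show "u = a" by simp
qed

lemma ver_proj_ver: "a \<in> ver p \<Longrightarrow> ver_proj \<A> g \<B> \<pi> p a = a"
  using ver_proj_eq[of a p 0] subspace_0[OF hor_subspace] by simp

lemma ver_proj_hor: "k \<in> hor p \<Longrightarrow> ver_proj \<A> g \<B> \<pi> p k = 0"
  using ver_proj_eq[of 0 p k] subspace_0[OF ver_subspace] by simp

lemma hor_proj_field_0: "on_field (hor_proj \<A> g \<B> \<pi>) 0 = 0"
  by (rule ext) (simp add: on_field_def hor_proj_def ver_proj_ver[OF subspace_0[OF ver_subspace]])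

lemma ver_proj_field_ver: "V \<in> sections \<A> ver \<Longrightarrow> on_field (ver_proj \<A> g \<B> \<pi>) V = V"
  by (rule ext) (simp add: on_field_def ver_proj_ver sections_D[where S = ver])

lemma ver_proj_field_hor: "X \<in> sections \<A> hor \<Longrightarrow> on_field (ver_proj \<A> g \<B> \<pi>) X = 0"
  by (rule ext) (simp add: on_field_def ver_proj_hor sections_D[where S = hor])

lemma hor_proj_field_hor: "X \<in> sections \<A> hor \<Longrightarrow> on_field (hor_proj \<A> g \<B> \<pi>) X = X"
  by (rule ext) (simp add: on_field_def hor_proj_def ver_proj_hor sections_D[where S = hor])

text \<open>The summand with the vertical part of \<open>X\<close> drops out because that part is
  the zero field.\<close>

lemma oneill_T_eq:
  "V \<in> sections \<A> ver \<Longrightarrow> X \<in> sections \<A> hor \<Longrightarrow>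
    oneill_T \<A> g \<B> \<pi> D V X = on_field (ver_proj \<A> g \<B> \<pi>) (D V X)"
  by (simp add: oneill_T_def M.D_zero_right sections_VF ver_proj_field_ver ver_proj_field_hor
      hor_proj_field_hor hor_proj_field_0)

lemma oneill_A_eq:
  "X \<in> sections \<A> hor \<Longrightarrow> Y \<in> sections \<A> hor \<Longrightarrow>
    oneill_A \<A> g \<B> \<pi> D X Y = on_field (ver_proj \<A> g \<B> \<pi>) (D X Y)"
  by (simp add: oneill_A_def M.D_zero_right sections_VF ver_proj_field_hor
      hor_proj_field_hor hor_proj_field_0)

end

section \<open>The second fundamental form of the submersion\<close>

context riemannian_submersion_lc
begin

abbreviation "FA \<equiv> fields_along \<A> \<B> \<pi>"
abbreviation "push \<equiv> push_field \<B> \<pi>"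
abbreviation "sff \<equiv> map_second_fundamental_form \<B> \<pi> D P"

lemma push_FA:
  assumes "F \<in> M.VF"
  shows "push F \<in> FA"
  unfolding fields_along_def push_field_def
  using M.VF_C[OF assms C_compose] by (auto simp: d_T M.VF_T[OF assms] d_apply)

lemma push_plus: "push (F + G) = push F + push G"
  and push_fscale: "push (f \<cdot> F) = f \<cdot> push F"
  by (simp_all add: push_field_def fun_eq_iff fscale_def d_plus d_scaleR)

lemma
  shows P_plus_left: "E \<in> M.VF \<Longrightarrow> F \<in> M.VF \<Longrightarrow> Z \<in> FA \<Longrightarrow> P (E + F) Z = P E Z + P F Z"
    and P_plus_right: "E \<in> M.VF \<Longrightarrow> Y \<in> FA \<Longrightarrow> Z \<in> FA \<Longrightarrow> P E (Y + Z) = P E Y + P E Z"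
    and P_fscale_left: "f \<in> M.C \<Longrightarrow> E \<in> M.VF \<Longrightarrow> Z \<in> FA \<Longrightarrow> P (f \<cdot> E) Z = f \<cdot> P E Z"
    and P_fscale_right: "f \<in> M.C \<Longrightarrow> E \<in> M.VF \<Longrightarrow> Z \<in> FA \<Longrightarrow>
      P E (f \<cdot> Z) = deriv_along E f \<cdot> Z + f \<cdot> P E Z"
  using pullback unfolding pullback_connection_def by blast+

lemma P_compose: "E \<in> M.VF \<Longrightarrow> X \<in> N.VF \<Longrightarrow> Y \<in> N.VF \<Longrightarrow> X (\<pi> p) = d (E p) \<Longrightarrow>
    P E (Y \<circ> \<pi>) p = D\<^sub>B X Y (\<pi> p)"
  using pullback unfolding pullback_connection_def by blast

lemma P_zero:
  assumes "E \<in> M.VF"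
  shows "P E 0 = 0"
proof -
  have "(0 :: 'm \<Rightarrow> 'n tvec) = push 0"
    by (simp add: push_field_def fun_eq_iff d_zero)
  then have "0 \<in> FA"
    using push_FA[OF M.VF_zero] by simp
  from P_plus_right[OF assms this this] show ?thesis by simp
qed

lemma sff_apply: "sff E F p = P E (push F) p - d (D E F p)"
  by (simp add: map_second_fundamental_form_def push_field_def)

section \<open>Tensoriality of the second fundamental form\<close>

lemma sff_plus_left:
  "E \<in> M.VF \<Longrightarrow> E' \<in> M.VF \<Longrightarrow> F \<in> M.VF \<Longrightarrow> sff (E + E') F p = sff E F p + sff E' F p"
  by (simp add: sff_apply P_plus_left push_FA M.D_plus_left d_plus algebra_simps)

lemma sff_plus_right:
  "E \<in> M.VF \<Longrightarrow> F \<in> M.VF \<Longrightarrow> F' \<in> M.VF \<Longrightarrow> sff E (F + F') p = sff E F p + sff E F' p"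
  by (simp add: sff_apply push_plus P_plus_right push_FA M.D_plus_right d_plus algebra_simps)

lemma sff_fscale_left:
  "f \<in> M.C \<Longrightarrow> E \<in> M.VF \<Longrightarrow> F \<in> M.VF \<Longrightarrow> sff (f \<cdot> E) F p = f p *\<^sub>R sff E F p"
  by (simp add: sff_apply P_fscale_left push_FA M.D_fscale_left)
    (simp add: fscale_def d_scaleR scaleR_diff_right)

text \<open>The derivative terms E(f) d(F) from the pullback connection and from \<open>D\<close>
  cancel.\<close>

lemma sff_fscale_right:
  "f \<in> M.C \<Longrightarrow> E \<in> M.VF \<Longrightarrow> F \<in> M.VF \<Longrightarrow> sff E (f \<cdot> F) p = f p *\<^sub>R sff E F p"
  by (simp add: sff_apply push_fscale P_fscale_right push_FA M.D_fscale_right)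
    (simp add: fscale_def push_field_def d_plus d_scaleR scaleR_diff_right)

lemma sff_vertical:
  assumes "E \<in> M.VF" "W \<in> sections \<A> ver"
  shows "sff E W p = - d (D E W p)"
proof -
  have "push W = 0"
    using ver_d[OF sections_D[OF assms(2)]] by (simp add: push_field_def fun_eq_iff)
  then show ?thesis
    by (simp add: sff_apply P_zero[OF assms(1)])
qed

lemma push_grad: "h \<in> N.C \<Longrightarrow> push (M.grad (h \<circ> \<pi>)) = N.grad h \<circ> \<pi>"
  by (simp add: push_field_def fun_eq_iff d_grad)

lemma deriv_compose: "v \<in> M.T p \<Longrightarrow> f \<in> N.C \<Longrightarrow> v (\<lambda>q. f (\<pi> q)) = d v f"
  using d_apply[of f v] by (simp add: o_def)

text \<open>Both fields are related by \<pi> to gradients on the base, so Koszul's formulas for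
  \<open>D\<close> and \<open>D\<^sub>B\<close> agree term by term, and \<open>D X1 X2\<close> is
  mapped to \<open>D\<^sub>B Z1 Z2\<close>.\<close>

lemma sff_grad_grad:
  assumes h1: "h1 \<in> N.C" and h2: "h2 \<in> N.C"
  shows "sff (M.grad (h1 \<circ> \<pi>)) (M.grad (h2 \<circ> \<pi>)) p = 0"
proof -
  define X1 X2 where "X1 = M.grad (h1 \<circ> \<pi>)" and "X2 = M.grad (h2 \<circ> \<pi>)"
  define Z1 Z2 where "Z1 = N.grad h1" and "Z2 = N.grad h2"
  have X: "X1 \<in> M.VF" "X2 \<in> M.VF" and Z: "Z1 \<in> N.VF" "Z2 \<in> N.VF"
    unfolding X1_def X2_def Z1_def Z2_def by (simp_all add: M.grad_VF N.grad_VF C_compose assms)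
  have dX: "d (X1 q) = Z1 (\<pi> q)" "d (X2 q) = Z2 (\<pi> q)" for q
    unfolding X1_def X2_def Z1_def Z2_def by (simp_all add: d_grad assms)
  have "d (D X1 X2 p) = D\<^sub>B Z1 Z2 (\<pi> p)"
  proof
    fix h
    note TD = d_T[OF M.VF_T[OF M.D_VF[OF X]], of p] N.VF_T[OF N.D_VF[OF Z], of "\<pi> p"]
    show "d (D X1 X2 p) h = D\<^sub>B Z1 Z2 (\<pi> p) h"
    proof (cases "h \<in> N.C")
      case False
      then show ?thesis
        using N.T_outside[OF TD(1)] N.T_outside[OF TD(2)] by simp
    next
      case h: True
      \<comment> \<open>The value of a tangent vector on \<open>h\<close> is its inner product with
        the gradient of \<open>h\<close>; a gradient in the third slot of Koszul's formula thus
        recovers the derivation.\<close>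
      define X3 Z3 where "X3 = M.grad (h \<circ> \<pi>)" and "Z3 = N.grad h"
      have X3: "X3 \<in> M.VF" and Z3: "Z3 \<in> N.VF" and dX3: "d (X3 q) = Z3 (\<pi> q)" for q
        unfolding X3_def Z3_def by (simp_all add: M.grad_VF N.grad_VF C_compose h d_grad)
      have hor: "X1 q \<in> hor q" "X2 q \<in> hor q" "X3 q \<in> hor q" for q
        unfolding X1_def X2_def X3_def by (simp_all add: grad_hor assms h)
      \<comment> \<open>Inner products of basic fields are pulled back from the base, so
        differentiating them along \<open>U\<close> is differentiating downstairs along its
        image.\<close>
      have lift: "U p (\<lambda>q. g q (V q) (W q)) = Y (\<pi> p) (\<lambda>x. g\<^sub>B x (V' x) (W' x))"
        if "U \<in> M.VF" "\<And>q. d (U q) = Y (\<pi> q)" "\<And>q. V q \<in> hor q" "\<And>q. d (V q) = V' (\<pi> q)"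
          "\<And>q. W q \<in> hor q" "\<And>q. d (W q) = W' (\<pi> q)" "V' \<in> N.VF" "W' \<in> N.VF"
        for U V W Y V' W'
      proof -
        have "g q (V q) (W q) = g\<^sub>B (\<pi> q) (V' (\<pi> q)) (W' (\<pi> q))" for q
          using d_isometry[OF that(3,5), of q] that(4,6) by simp
        then show ?thesis
          using deriv_compose[OF M.VF_T[OF that(1)] N.g_C[OF that(7,8)], of p] that(2)[of p] by simp
      qed
      \<comment> \<open>Brackets of \<pi>-related fields are \<pi>-related; pairing with a gradient
        means evaluating both brackets on the same function \<open>f\<close>.\<close>
      have br: "g p (lie_bracket \<A> U V p) (M.grad (f \<circ> \<pi>) p) = g\<^sub>B (\<pi> p) (lie_bracket \<B> U' V' (\<pi> p)) (N.grad f (\<pi> p))"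
        if "U \<in> M.VF" "V \<in> M.VF" "\<And>q. d (U q) = U' (\<pi> q)" "\<And>q. d (V q) = V' (\<pi> q)"
          "U' \<in> N.VF" "V' \<in> N.VF" and f: "f \<in> N.C" for U V U' V' f
      proof -
        have *: "U1 q (f \<circ> \<pi>) = U2 (\<pi> q) f" if "\<And>q. d (U1 q) = U2 (\<pi> q)" for U1 U2 q
          using that[of q] d_apply[OF f, of "U1 q"] by simp
        have "lie_bracket \<A> U V p (f \<circ> \<pi>) = lie_bracket \<B> U' V' (\<pi> p) f"
          unfolding M.lie_bracket_apply[OF C_compose[OF f]] N.lie_bracket_apply[OF f] *[of U U', OF that(3)] *[of V V', OF that(4)]
          using deriv_compose[OF M.VF_T[OF that(1)] N.VF_C[OF that(6) f], of p]
            deriv_compose[OF M.VF_T[OF that(2)] N.VF_C[OF that(5) f], of p] that(3,4) by simp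
        then show ?thesis
          by (simp add: M.g_grad_right N.g_grad_right C_compose f M.lie_bracket_T N.lie_bracket_T that(1,2,5,6))
      qed
      have "2 * g p (D X1 X2 p) (X3 p) = 2 * g\<^sub>B (\<pi> p) (D\<^sub>B Z1 Z2 (\<pi> p)) (Z3 (\<pi> p))"
        unfolding M.koszul[OF X X3] N.koszul[OF Z Z3]
          lift[OF X(1) dX(1) hor(2) dX(2) hor(3) dX3 Z(2) Z3] lift[OF X(2) dX(2) hor(3) dX3 hor(1) dX(1) Z3 Z(1)]
          lift[OF X3 dX3 hor(1) dX(1) hor(2) dX(2) Z]
        using br[OF X dX Z h] br[OF X(1) X3 dX(1) dX3 Z(1) Z3 h2] br[OF X(2) X3 dX(2) dX3 Z(2) Z3 h1]
        by (simp add: X1_def[symmetric] X2_def[symmetric] X3_def[symmetric] Z1_def[symmetric] Z2_def[symmetric] Z3_def[symmetric])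
      then show ?thesis
        by (simp add: X3_def Z3_def M.g_grad_right N.g_grad_right C_compose h M.VF_T M.D_VF X N.VF_T N.D_VF Z d_apply)
    qed
  qed
  moreover have "P X1 (push X2) p = D\<^sub>B Z1 Z2 (\<pi> p)"
    using P_compose[OF X(1) Z] dX(1) push_grad[OF h2] by (simp add: X2_def Z2_def)
  ultimately show ?thesis
    by (simp add: sff_apply X1_def[symmetric] X2_def[symmetric])
qed

text \<open>D_V X and D_X V differ by [V, X]. This bracket is vertical: on
  \<open>f \<circ> \<pi>\<close> the field \<open>V\<close> vanishes, and X(f \<circ> \<pi>) is
  again a pullback, which \<open>V\<close> kills.\<close>

lemma sff_vertical_grad:
  assumes V: "V \<in> sections \<A> ver" and h: "h \<in> N.C"
    and DV: "D (M.grad (h \<circ> \<pi>)) V p \<in> ver p"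
  shows "sff V (M.grad (h \<circ> \<pi>)) p = 0"
proof -
  define X where "X = M.grad (h \<circ> \<pi>)"
  have X: "X \<in> M.VF" unfolding X_def by (rule M.grad_VF[OF C_compose[OF h]])
  have VVF: "V \<in> M.VF" by (rule sections_VF[OF V])
  have dV: "d (V q) = 0" for q by (rule ver_d[OF sections_D[OF V]])
  have "P V (push X) p = 0"
    \<comment> \<open>The zero field extends \<open>d (V p) = 0\<close>, so the pullback derivative
      is \<open>D\<^sub>B 0 (N.grad h) = 0\<close>.\<close>
    using P_compose[OF VVF N.VF_zero N.grad_VF[OF h], of p] N.D_zero_left[OF N.grad_VF[OF h]]
    by (simp add: X_def push_grad[OF h] dV)
  moreover have "d (D V X p) = 0"
  proof
    fix f
    show "d (D V X p) f = 0 f"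
    proof (cases "f \<in> N.C")
      case f: True
      have Xf: "(\<lambda>q. X q (f \<circ> \<pi>)) = (\<lambda>q. N.grad h (\<pi> q) f)"
        by (simp add: X_def grad_compose h f)
      have Vf: "(\<lambda>q. V q (f \<circ> \<pi>)) = (\<lambda>q. 0)"
        using dV d_apply[OF f] by (metis zero_fun_apply)
      have "lie_bracket \<A> V X p (f \<circ> \<pi>) = d (V p) (\<lambda>x. N.grad h x f)"
        unfolding M.lie_bracket_apply[OF C_compose[OF f]] Xf Vf
        using deriv_compose[OF M.VF_T[OF VVF] N.VF_C[OF N.grad_VF[OF h] f], of p] M.T_const[OF M.VF_T[OF X]]
        by simp
      then have "D V X p (f \<circ> \<pi>) = D X V p (f \<circ> \<pi>)"
        by (simp add: M.D_torsion[OF VVF X] dV)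
      also have "\<dots> = 0"
        using ver_d[OF DV] d_apply[OF f, of "D X V p"] by (simp add: X_def)
      finally show ?thesis by (simp add: d_apply[OF f])
    qed (simp add: differential_def)
  qed
  ultimately show ?thesis
    by (simp add: sff_apply X_def[symmetric])
qed

text \<open>
  Multiplying by the squared norms of a horizontal frame once clears the denominators of the
  orthogonal expansion, and a second time makes both sides vanish where the frame degenerates.
\<close>

lemma submodule_generated:
  assumes L: "M.submodule L" and F: "F \<in> M.VF"
    and grads: "\<And>h. h \<in> N.C \<Longrightarrow> M.grad (h \<circ> \<pi>) \<in> L" and vers: "sections \<A> ver \<subseteq> L"
  obtains f where "f \<in> M.C" "f p \<noteq> 0" "f \<cdot> F \<in> L"
proof -
  obtain Y :: "'b \<Rightarrow> 'm vfield" where Y: "\<And>i. i \<in> Basis \<Longrightarrow> Y i \<in> sections \<A> hor" "\<And>i. i \<in> Basis \<Longrightarrow> Y i p \<noteq> 0"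
    "\<And>q v. \<forall>i\<in>Basis. Y i q \<noteq> 0 \<Longrightarrow> v \<in> M.T q \<Longrightarrow>
      v - (\<Sum>i\<in>Basis. (g q v (Y i q) / g q (Y i q) (Y i q)) *\<^sub>R Y i q) \<in> ver q"
    "\<And>i L. i \<in> Basis \<Longrightarrow> M.submodule L \<Longrightarrow> \<forall>h\<in>N.C. M.grad (h \<circ> \<pi>) \<in> L \<Longrightarrow> Y i \<in> L"
    by (rule horizontal_frame[of p]) (rule that)
  have YVF: "Y i \<in> M.VF" if "i \<in> Basis" for i by (rule sections_VF[OF Y(1)[OF that]])
  have YL: "Y i \<in> L" if "i \<in> Basis" for i using grads by (intro Y(4)[OF that L]) blast
  define N where "N q = (\<Prod>i\<in>Basis. g q (Y i q) (Y i q))" for q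
  define N' where "N' i q = (\<Prod>j\<in>Basis - {i}. g q (Y j q) (Y j q))" for i q
  define a where "a i q = N q * (N' i q * g q (F q) (Y i q))" for i q
  have NC: "N \<in> M.C" and N'C: "N' i \<in> M.C" for i
    unfolding N_def N'_def using YVF by (auto intro!: M.C_prod M.g_C)
  have NNC: "(\<lambda>q. N q * N q) \<in> M.C" by (rule M.C_mult[OF NC NC])
  have aC: "a i \<in> M.C" if "i \<in> Basis" for i
    unfolding a_def by (rule M.C_mult[OF NC M.C_mult[OF N'C M.g_C[OF F YVF[OF that]]]])
  have Np: "N p \<noteq> 0"
    unfolding N_def using YVF Y(2) M.g_eq_0_iff[OF M.VF_T] by auto
  define S where "S = (\<Sum>i\<in>Basis. a i \<cdot> Y i)"
  define W where "W = (\<lambda>q. N q * N q) \<cdot> F - S"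
  have SL: "S \<in> L"
    unfolding S_def by (rule M.submodule_sum[OF L]) (simp_all add: M.submodule_fscale[OF L aC YL])
  have WVF: "W \<in> M.VF"
    unfolding W_def using SL L by (intro M.VF_diff M.VF_fscale NNC F) (auto simp: M.submodule_def)
  have Sq: "S q = (\<Sum>i\<in>Basis. a i q *\<^sub>R Y i q)" for q
    by (simp add: S_def sum_fun_apply fscale_def)
  have "W q \<in> ver q" for q
  proof (cases "N q = 0")
    case True
    then have "W q = 0"
      by (simp add: W_def Sq fscale_def a_def)
    then show ?thesis using subspace_0[OF ver_subspace] by simp
  next
    case False
    then have nz: "g q (Y i q) (Y i q) \<noteq> 0" if "i \<in> Basis" for i
      using that by (auto simp: N_def)
    then have "\<forall>i\<in>Basis. Y i q \<noteq> 0"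
      using M.g_zero_left[OF M.T_zero] by metis
    then have v: "F q - (\<Sum>i\<in>Basis. (g q (F q) (Y i q) / g q (Y i q) (Y i q)) *\<^sub>R Y i q) \<in> ver q"
      by (rule Y(3)[OF _ M.VF_T[OF F]])
    have "a i q = N q * N q * (g q (F q) (Y i q) / g q (Y i q) (Y i q))" if i: "i \<in> Basis" for i
    proof -
      have "N q = g q (Y i q) (Y i q) * N' i q"
        unfolding N_def N'_def using i by (simp add: prod.remove)
      then show ?thesis using nz[OF i] by (simp add: a_def)
    qed
    then have "W q = (N q * N q) *\<^sub>R (F q - (\<Sum>i\<in>Basis. (g q (F q) (Y i q) / g q (Y i q) (Y i q)) *\<^sub>R Y i q))"
      by (simp add: W_def Sq fscale_def scaleR_diff_right scaleR_sum_right)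
    then show ?thesis
      using subspace_scale[OF ver_subspace v] by simp
  qed
  then have "W \<in> L" using vers sections_I[OF WVF] by blast
  moreover have "(\<lambda>q. N q * N q) \<cdot> F = S + W" by (simp add: W_def)
  ultimately have "(\<lambda>q. N q * N q) \<cdot> F \<in> L"
    using M.submodule_plus[OF L SL] by simp
  then show ?thesis
    using that[OF NNC] Np by simp
qed

text \<open>The second fundamental form is tensorial in both slots, so for the converse it suffices
  that it vanishes on pairs of generators, here gradients of \<open>h \<circ> \<pi>\<close> and
  vertical fields. The slots are then freed one at a time.\<close>

lemma totally_geodesic_iff:
  "totally_geodesic_map \<A> \<B> \<pi> D P \<longleftrightarrow>
    (\<forall>W\<in>sections \<A> ver. \<forall>E\<in>sections \<A> ver \<union> sections \<A> hor. \<forall>p. D E W p \<in> ver p)"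
proof
  assume tg: "totally_geodesic_map \<A> \<B> \<pi> D P"
  show "\<forall>W\<in>sections \<A> ver. \<forall>E\<in>sections \<A> ver \<union> sections \<A> hor. \<forall>p. D E W p \<in> ver p"
  proof (intro ballI allI)
    fix W E p
    assume W: "W \<in> sections \<A> ver" and "E \<in> sections \<A> ver \<union> sections \<A> hor"
    then have E: "E \<in> M.VF" using sections_VF by blast
    have "sff E W = 0"
      using tg E sections_VF[OF W] unfolding totally_geodesic_map_def by blast
    then have "d (D E W p) = 0"
      using sff_vertical[OF E W, of p] by simp
    then show "D E W p \<in> ver p"
      by (rule ver_I[OF M.VF_T[OF M.D_VF[OF E sections_VF[OF W]]]])
  qed
next
  assume v: "\<forall>W\<in>sections \<A> ver. \<forall>E\<in>sections \<A> ver \<union> sections \<A> hor. \<forall>p. D E W p \<in> ver p"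
  have gradVF: "M.grad (h \<circ> \<pi>) \<in> M.VF" if "h \<in> N.C" for h
    by (rule M.grad_VF[OF C_compose[OF that]])
  have gradH: "M.grad (h \<circ> \<pi>) \<in> sections \<A> hor" if "h \<in> N.C" for h
    using that by (intro sections_I gradVF grad_hor)
  let ?gen = "{M.grad (h \<circ> \<pi>) |h. h \<in> N.C} \<union> sections \<A> ver"
  have genVF: "G \<in> M.VF" if "G \<in> ?gen" for G
    using that gradVF sections_VF by blast
  have gen0: "sff G H p = 0" if G: "G \<in> ?gen" and H: "H \<in> ?gen" for G H p
  proof (cases "H \<in> sections \<A> ver")
    case True
    have "G \<in> sections \<A> ver \<union> sections \<A> hor" using G gradH by blast
    then have "d (D G H p) = 0" using v True ver_d by blast
    then show ?thesis using sff_vertical[OF genVF[OF G] True] by simp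
  next
    case False
    then obtain h where h: "h \<in> N.C" "H = M.grad (h \<circ> \<pi>)" using H by blast
    show ?thesis
    proof (cases "G \<in> sections \<A> ver")
      case True
      then show ?thesis
        unfolding h(2) using v gradH[OF h(1)] by (intro sff_vertical_grad h(1)) auto
    next
      case False
      then obtain k where "k \<in> N.C" "G = M.grad (k \<circ> \<pi>)" using G by blast
      then show ?thesis using sff_grad_grad h by simp
    qed
  qed
  have half: "sff G F p = 0" if G: "G \<in> ?gen" and F: "F \<in> M.VF" for G F p
  proof -
    let ?L = "{F \<in> M.VF. \<forall>p. sff G F p = 0}"
    have L: "M.submodule ?L"
      unfolding M.submodule_def
      using genVF[OF G] by (auto simp: M.VF_plus M.VF_fscale sff_plus_right sff_fscale_right)
    \<comment> \<open>Only a multiple of \<open>F\<close> is generated globally, but its factor is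
      nonzero at \<open>p\<close> and comes out of the tensor.\<close>
    obtain f where f: "f \<in> M.C" "f p \<noteq> 0" "f \<cdot> F \<in> ?L"
      by (rule submodule_generated[OF L F, of p]) (use gen0[OF G] genVF in blast)+
    then have "f p *\<^sub>R sff G F p = 0"
      using sff_fscale_right[OF f(1) genVF[OF G] F, of p] by simp
    then show ?thesis using f(2) by (metis scaleR_eq_0_iff)
  qed
  have "sff E F p = 0" if E: "E \<in> M.VF" and F: "F \<in> M.VF" for E F p
  proof -
    let ?L = "{E \<in> M.VF. \<forall>p. sff E F p = 0}"
    have L: "M.submodule ?L"
      unfolding M.submodule_def
      using F by (auto simp: M.VF_plus M.VF_fscale sff_plus_left sff_fscale_left)
    obtain f where f: "f \<in> M.C" "f p \<noteq> 0" "f \<cdot> E \<in> ?L"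
      by (rule submodule_generated[OF L E, of p]) (use half[OF _ F] genVF in blast)+
    then have "f p *\<^sub>R sff E F p = 0"
      using sff_fscale_left[OF f(1) E F, of p] by simp
    then show ?thesis using f(2) by (metis scaleR_eq_0_iff)
  qed
  then show "totally_geodesic_map \<A> \<B> \<pi> D P"
    unfolding totally_geodesic_map_def by (auto simp: fun_eq_iff)
qed

end

section \<open>Lagrangian submersions\<close>

locale lcK_lagrangian_submersion =
  M: lcK \<A> g D J \<omega> B1 + riemannian_submersion_lc \<A> g D \<B> g\<^sub>B D\<^sub>B \<pi> P
  for \<A> :: "('m::{t2_space, second_countable_topology}, 'a::euclidean_space) atlas"
    and g :: "'m form2" and D :: "'m vfield \<Rightarrow> 'm vfield \<Rightarrow> 'm vfield"
    and J :: "'m endo" and \<omega> :: "'m form1" and B1 :: "'m vfield"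
    and \<B> :: "('n::{t2_space, second_countable_topology}, 'b::euclidean_space) atlas"
    and g\<^sub>B :: "'n form2" and D\<^sub>B :: "'n vfield \<Rightarrow> 'n vfield \<Rightarrow> 'n vfield"
    and \<pi> :: "'m \<Rightarrow> 'n" and P :: "'m vfield \<Rightarrow> ('m \<Rightarrow> 'n tvec) \<Rightarrow> ('m \<Rightarrow> 'n tvec)" +
  assumes lagrangian: "\<And>p. J p ` ver p = hor p"
    and B1_ver: "B1 \<in> sections \<A> ver"
begin

abbreviation "A \<equiv> anti_lee_vector_field J B1"

section \<open>J exchanges vertical and horizontal vectors\<close>

lemma J_ver: "u \<in> ver p \<Longrightarrow> J p u \<in> hor p"
  using lagrangian by blast

lemma J_hor:
  assumes "k \<in> hor p"
  shows "J p k \<in> ver p"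
proof -
  obtain u where u: "u \<in> ver p" "k = J p u"
    using assms lagrangian by blast
  then have "J p k = (-1) *\<^sub>R u"
    using M.J_J[OF ver_T] by simp
  then show ?thesis
    using subspace_scale[OF ver_subspace u(1)] by metis
qed

lemma J_hor_D:
  assumes "v \<in> M.T p" "J p v \<in> hor p"
  shows "v \<in> ver p"
proof -
  have "(-1) *\<^sub>R J p (J p v) \<in> ver p"
    by (rule subspace_scale[OF ver_subspace J_hor[OF assms(2)]])
  then show ?thesis using M.J_J[OF assms(1)] by simp
qed

lemma JF_ver:
  assumes W: "W \<in> sections \<A> ver"
  shows "M.JF W \<in> sections \<A> hor"
proof (rule sections_I)
  show "M.JF W \<in> M.VF" by (rule M.JF_VF[OF sections_VF[OF W]])
  show "M.JF W p \<in> hor p" for p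
    unfolding on_field_def by (rule J_ver[OF sections_D[OF W]])
qed

lemma A_hor: "A p \<in> hor p"
  using subspace_scale[OF hor_subspace J_ver[OF sections_D[OF B1_ver, of p]], of "-1"]
  by (simp add: anti_lee_vector_field_def on_field_def)

text \<open>\<omega>(JW) = g(JW, B1), and a horizontal vector is orthogonal to the vertical B1.
  Verticality of B1 thus removes the term with \<omega> \<circ> J from the formula for D J on
  vertical fields.\<close>

lemma omega_J_ver:
  assumes "W \<in> sections \<A> ver"
  shows "\<omega> p (J p (W p)) = 0"
  using M.omega_eq[OF M.JF_VF[OF sections_VF[OF assms]], of p] hor_ver[OF J_ver sections_D[OF B1_ver]] sections_D[OF assms]
  by (simp add: on_field_def)

section \<open>Derivatives and O'Neill tensors of J-images of vertical fields\<close>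

lemma D_JF_ver_ver:
  assumes V: "V \<in> sections \<A> ver" and W: "W \<in> sections \<A> ver"
  shows "D V (M.JF W) p = J p (D V W p) - (1/2) *\<^sub>R (\<omega> p (W p) *\<^sub>R J p (V p) + g p (V p) (W p) *\<^sub>R A p)"
proof -
  have "g p (V p) (J p (W p)) = 0"
    by (rule ver_hor[OF J_ver[OF sections_D[OF W]] sections_D[OF V]])
  then show ?thesis
    unfolding M.nabla_J[OF sections_VF[OF V] sections_VF[OF W]] omega_J_ver[OF W]
    by (simp add: algebra_simps)
qed

lemma D_JF_hor_ver:
  assumes X: "X \<in> sections \<A> hor" and W: "W \<in> sections \<A> ver"
  shows "D X (M.JF W) p = J p (D X W p) - (1/2) *\<^sub>R (\<omega> p (W p) *\<^sub>R J p (X p) + g p (X p) (J p (W p)) *\<^sub>R B1 p)"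
proof -
  have "g p (X p) (W p) = 0"
    by (rule hor_ver[OF sections_D[OF X] sections_D[OF W]])
  then show ?thesis
    unfolding M.nabla_J[OF sections_VF[OF X] sections_VF[OF W]] omega_J_ver[OF W]
    by (simp add: algebra_simps)
qed

lemma oneill_T_JF:
  "V \<in> sections \<A> ver \<Longrightarrow> W \<in> sections \<A> ver \<Longrightarrow>
    oneill_T \<A> g \<B> \<pi> D V (M.JF W) p = ver_proj \<A> g \<B> \<pi> p (D V (M.JF W) p)"
  by (simp only: oneill_T_eq[OF _ JF_ver]) (simp only: on_field_def[of "ver_proj \<A> g \<B> \<pi>"])

lemma oneill_A_JF:
  "X \<in> sections \<A> hor \<Longrightarrow> W \<in> sections \<A> ver \<Longrightarrow>
    oneill_A \<A> g \<B> \<pi> D X (M.JF W) p = ver_proj \<A> g \<B> \<pi> p (D X (M.JF W) p)"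
  by (simp only: oneill_A_eq[OF _ JF_ver]) (simp only: on_field_def[of "ver_proj \<A> g \<B> \<pi>"])

text \<open>For a vertical direction the correction term is horizontal, so the vertical projection
  in T does not see it. For a horizontal direction it is vertical and survives in A; hence the two
  equations behave differently.\<close>

lemma nabla_J_ver_hor:
  assumes "V \<in> sections \<A> ver"
  shows "(1/2) *\<^sub>R (\<omega> p (W p) *\<^sub>R J p (V p) + g p (V p) (W p) *\<^sub>R A p) \<in> hor p"
  by (intro subspace_scale[OF hor_subspace] subspace_add[OF hor_subspace] A_hor J_ver sections_D[OF assms])

lemma nabla_J_hor_ver:
  assumes "X \<in> sections \<A> hor"
  shows "(1/2) *\<^sub>R (\<omega> p (W p) *\<^sub>R J p (X p) + g p (X p) (J p (W p)) *\<^sub>R B1 p) \<in> ver p"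
  by (intro subspace_scale[OF ver_subspace] subspace_add[OF ver_subspace] J_hor sections_D[OF assms] sections_D[OF B1_ver])

lemma ver_D_if_A_eq:
  assumes X: "X \<in> sections \<A> hor" and W: "W \<in> sections \<A> ver"
    and eq: "oneill_A \<A> g \<B> \<pi> D X (M.JF W) p
      + (1/2) *\<^sub>R (\<omega> p (W p) *\<^sub>R J p (X p) + g p (X p) (J p (W p)) *\<^sub>R B1 p) = 0" (is "_ + ?U = 0")
  shows "D X W p \<in> ver p"
proof -
  note DT = M.VF_T[OF M.D_VF[OF sections_VF[OF X] sections_VF[OF W]], of p]
  \<comment> \<open>As J exchanges the two distributions, \<open>a\<close> is J of the horizontal
    part of \<open>D X W p\<close>; so \<open>a = 0\<close> is the goal in disguise.\<close>
  obtain a k where ak: "a \<in> ver p" "k \<in> hor p" "J p (D X W p) = a + k"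
    by (rule decomposition[OF M.J_T[OF DT]])
  have "D X (M.JF W) p = (a - ?U) + k"
    unfolding D_JF_hor_ver[OF X W] ak(3) by simp
  then have "oneill_A \<A> g \<B> \<pi> D X (M.JF W) p = a - ?U"
    using ver_proj_eq[OF subspace_diff[OF ver_subspace ak(1) nabla_J_hor_ver[OF X]] ak(2)]
    by (simp only: oneill_A_JF[OF X W])
  then have "a = 0" using eq by simp
  then show ?thesis
    using J_hor_D[OF DT] ak by simp
qed

lemma ver_D_if_T_eq:
  assumes V: "V \<in> sections \<A> ver" and W: "W \<in> sections \<A> ver"
    and eq: "oneill_T \<A> g \<B> \<pi> D V (M.JF W) p
      + (1/2) *\<^sub>R (\<omega> p (W p) *\<^sub>R J p (V p) + g p (V p) (W p) *\<^sub>R A p) = 0" (is "_ + ?H = 0")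
  shows "D V W p \<in> ver p"
proof -
  note DT = M.VF_T[OF M.D_VF[OF sections_VF[OF V] sections_VF[OF W]], of p]
  obtain a k where ak: "a \<in> ver p" "k \<in> hor p" "J p (D V W p) = a + k"
    by (rule decomposition[OF M.J_T[OF DT]])
  have "D V (M.JF W) p = a + (k - ?H)"
    unfolding D_JF_ver_ver[OF V W] ak(3) by simp
  then have "oneill_T \<A> g \<B> \<pi> D V (M.JF W) p = a"
    using ver_proj_eq[OF ak(1) subspace_diff[OF hor_subspace ak(2) nabla_J_ver_hor[OF V]]]
    by (simp only: oneill_T_JF[OF V W])
  \<comment> \<open>Here the vertical \<open>a\<close> equals a horizontal vector, so both
    vanish.\<close>
  then have "a = (-1) *\<^sub>R ?H" using eq by (simp add: eq_neg_iff_add_eq_0)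
  then have "a \<in> hor p"
    using subspace_scale[OF hor_subspace nabla_J_ver_hor[OF V]] by metis
  then have "a = 0" by (rule ver_hor_zero[OF ak(1)])
  then show ?thesis
    using J_hor_D[OF DT] ak by simp
qed

lemma A_eq_if_ver_D:
  assumes X: "X \<in> sections \<A> hor" and W: "W \<in> sections \<A> ver" and DW: "D X W p \<in> ver p"
  shows "oneill_A \<A> g \<B> \<pi> D X (M.JF W) p
      + (1/2) *\<^sub>R (\<omega> p (W p) *\<^sub>R J p (X p) + g p (X p) (J p (W p)) *\<^sub>R B1 p) = 0" (is "_ + ?U = 0")
proof -
  have "D X (M.JF W) p = (0 - ?U) + J p (D X W p)"
    unfolding D_JF_hor_ver[OF X W] by simp
  then have "oneill_A \<A> g \<B> \<pi> D X (M.JF W) p = 0 - ?U"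
    using ver_proj_eq[OF subspace_diff[OF ver_subspace subspace_0[OF ver_subspace] nabla_J_hor_ver[OF X]] J_ver[OF DW]]
    by (simp only: oneill_A_JF[OF X W])
  then show ?thesis by simp
qed

text \<open>
  If horizontal derivatives of vertical fields are vertical, then by metric compatibility the
  vertical part of \<open>D\<^sub>X (J W)\<close> is orthogonal to itself.
\<close>

lemma nabla_J_hor_ver_zero:
  assumes X: "X \<in> sections \<A> hor" and W: "W \<in> sections \<A> ver"
    and DV: "\<And>V. V \<in> sections \<A> ver \<Longrightarrow> D X V p \<in> ver p"
  shows "\<omega> p (W p) *\<^sub>R J p (X p) + g p (X p) (J p (W p)) *\<^sub>R B1 p = 0"
proof -
  \<comment> \<open>The correction term is needed as a vertical field, not just as a vector at
    \<open>p\<close>, so that \<open>DV\<close> applies to it and g(JW, U) = 0 can be differentiated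
    along \<open>X\<close>.\<close>
  define U where "U = (1/2) *\<^sub>R ((\<lambda>q. \<omega> q (W q)) \<cdot> M.JF X + (\<lambda>q. g q (X q) (M.JF W q)) \<cdot> B1)"
  note VF = sections_VF[OF X] sections_VF[OF W] M.JF_VF[OF sections_VF[OF W]]
  have Uq: "U q = (1/2) *\<^sub>R (\<omega> q (W q) *\<^sub>R J q (X q) + g q (X q) (J q (W q)) *\<^sub>R B1 q)" for q
    by (simp add: U_def fscale_def on_field_def)
  have UVF: "U \<in> M.VF"
    unfolding U_def by (intro M.VF_scaleR M.VF_plus M.VF_fscale M.omega_C M.g_C M.JF_VF M.B1_VF VF)
  have U: "U \<in> sections \<A> ver"
    by (rule sections_I[OF UVF]) (simp only: Uq nabla_J_hor_ver[OF X])
  have JW: "M.JF W q \<in> hor q" for q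
    by (rule sections_D[OF JF_ver[OF W]])
  have zero: "(\<lambda>q. g q (M.JF W q) (U q)) = (\<lambda>q. 0)"
    using hor_ver[OF JW sections_D[OF U]] by simp
  have "g p (D X (M.JF W) p) (U p) + g p (M.JF W p) (D X U p) = 0"
    using M.D_metric[OF VF(1,3) UVF, of p] M.T_const[OF M.VF_T[OF VF(1)]] unfolding zero by simp
  then have "g p (D X (M.JF W) p) (U p) = 0"
    using hor_ver[OF JW DV[OF U]] by simp
  moreover have "D X (M.JF W) p = J p (D X W p) - U p"
    unfolding Uq by (rule D_JF_hor_ver[OF X W])
  moreover have "g p (J p (D X W p)) (U p) = 0"
    by (rule hor_ver[OF J_ver[OF DV[OF W]] sections_D[OF U]])
  ultimately have "g p (U p) (U p) = 0"
    using M.g_diff_left[OF hor_T[OF J_ver[OF DV[OF W]]] M.VF_T[OF UVF] M.VF_T[OF UVF]] by simp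
  then have "U p = 0"
    using M.g_eq_0_iff[OF M.VF_T[OF UVF]] by simp
  then show ?thesis by (simp only: Uq scaleR_eq_0_iff) simp
qed

lemma T_eq_if_ver_D:
  assumes V: "V \<in> sections \<A> ver" and W: "W \<in> sections \<A> ver"
    and D: "\<And>U E. U \<in> sections \<A> ver \<Longrightarrow> E \<in> sections \<A> ver \<union> sections \<A> hor \<Longrightarrow> D E U p \<in> ver p"
  shows "oneill_T \<A> g \<B> \<pi> D V (M.JF W) p
      + (1/2) *\<^sub>R (\<omega> p (W p) *\<^sub>R J p (V p) + g p (V p) (W p) *\<^sub>R A p) = 0" (is "_ + (1/2) *\<^sub>R ?H = 0")
proof -
  note T = ver_T[OF sections_D[OF V]] ver_T[OF sections_D[OF W]] ver_T[OF sections_D[OF B1_ver]]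
  \<comment> \<open>With JV as the horizontal field the identity reads - \<omega>(W) V + g(V, W) B1
    = 0. Applying J and using A = - J B1 turns it into the vanishing of the horizontal
    terms.\<close>
  have "\<omega> p (W p) *\<^sub>R J p (M.JF V p) + g p (M.JF V p) (J p (W p)) *\<^sub>R B1 p = 0"
    using D JF_ver[OF V] by (intro nabla_J_hor_ver_zero[OF JF_ver[OF V] W]) auto
  then have "g p (V p) (W p) *\<^sub>R B1 p = \<omega> p (W p) *\<^sub>R V p"
    using T by (simp add: on_field_def M.J_J M.J_isometry)
  then have "J p (g p (V p) (W p) *\<^sub>R B1 p) = J p (\<omega> p (W p) *\<^sub>R V p)" by simp
  then have H: "?H = 0"
    using T by (simp add: M.J_scale anti_lee_vector_field_def on_field_def)
  have DVW: "D V W p \<in> ver p" using D V W by blast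
  have "D V (M.JF W) p = J p (D V W p)"
    unfolding D_JF_ver_ver[OF V W] H by simp
  then show ?thesis
    unfolding H using ver_proj_hor[OF J_ver[OF DVW]]
    by (simp only: oneill_T_JF[OF V W]) simp
qed

lemma totally_geodesic_iff_oneill:
  "totally_geodesic_map \<A> \<B> \<pi> D P \<longleftrightarrow>
    (\<forall>V\<in>sections \<A> ver. \<forall>W\<in>sections \<A> ver. \<forall>p. oneill_T \<A> g \<B> \<pi> D V (M.JF W) p
      + (1/2) *\<^sub>R (\<omega> p (W p) *\<^sub>R J p (V p) + g p (V p) (W p) *\<^sub>R A p) = 0) \<and>
    (\<forall>X\<in>sections \<A> hor. \<forall>W\<in>sections \<A> ver. \<forall>p. oneill_A \<A> g \<B> \<pi> D X (M.JF W) p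
      + (1/2) *\<^sub>R (\<omega> p (W p) *\<^sub>R J p (X p) + g p (X p) (J p (W p)) *\<^sub>R B1 p) = 0)"
    (is "_ \<longleftrightarrow> ?T \<and> ?A")
proof
  assume "totally_geodesic_map \<A> \<B> \<pi> D P"
  then have D: "D E W p \<in> ver p" if "W \<in> sections \<A> ver" "E \<in> sections \<A> ver \<union> sections \<A> hor" for E W p
    using that unfolding totally_geodesic_iff by blast
  then show "?T \<and> ?A"
    by (intro conjI ballI allI T_eq_if_ver_D A_eq_if_ver_D) auto
next
  assume eqs: "?T \<and> ?A"
  show "totally_geodesic_map \<A> \<B> \<pi> D P"
    unfolding totally_geodesic_iff
  proof (intro ballI allI)
    fix W E p
    assume W: "W \<in> sections \<A> ver" and "E \<in> sections \<A> ver \<union> sections \<A> hor"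
    then consider "E \<in> sections \<A> ver" | "E \<in> sections \<A> hor" by blast
    then show "D E W p \<in> ver p"
    proof cases
      case 1
      then show ?thesis using eqs W by (intro ver_D_if_T_eq) blast+
    next
      case 2
      then show ?thesis using eqs W by (intro ver_D_if_A_eq) blast+
    qed
  qed
qed

end

theorem theorem4p6:
  fixes \<A> :: "('m::{t2_space, second_countable_topology}, 'a::euclidean_space) atlas"
    and g :: "'m form2" and J :: "'m endo" and \<omega> :: "'m form1" and B1 :: "'m vfield"
    and \<B> :: "('n::{t2_space, second_countable_topology}, 'b::euclidean_space) atlas"
    and g\<^sub>B :: "'n form2" and \<pi> :: "'m \<Rightarrow> 'n"
    and D :: "'m vfield \<Rightarrow> 'm vfield \<Rightarrow> 'm vfield"
    and D\<^sub>B :: "'n vfield \<Rightarrow> 'n vfield \<Rightarrow> 'n vfield"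
    and P :: "'m vfield \<Rightarrow> ('m \<Rightarrow> 'n tvec) \<Rightarrow> ('m \<Rightarrow> 'n tvec)"
  defines "ver \<equiv> vertical_space \<A> \<B> \<pi>"
    and "hor \<equiv> horizontal_space \<A> g \<B> \<pi>"
    and "\<Omega> \<equiv> fundamental_form g J"
    and "A \<equiv> anti_lee_vector_field J B1"
  assumes "lcK_manifold \<A> g J \<omega>"
    and "lee_vector_field \<A> g \<omega> B1"
    and "riemannian_manifold \<B> g\<^sub>B"
    and "lagrangian_riemannian_submersion \<A> g J \<B> g\<^sub>B \<pi>"
    and "levi_civita_connection \<A> g D"
    and "levi_civita_connection \<B> g\<^sub>B D\<^sub>B"
    and "pullback_connection \<A> \<B> \<pi> D\<^sub>B P"
    and "B1 \<in> sections \<A> ver"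
  shows "totally_geodesic_map \<A> \<B> \<pi> D P \<longleftrightarrow>
    (\<forall>V \<in> sections \<A> ver. \<forall>W \<in> sections \<A> ver.
       oneill_T \<A> g \<B> \<pi> D V (on_field J W)
       + (1/2) *\<^sub>R (on_field \<omega> W \<cdot> on_field J V)
       + (1/2) *\<^sub>R (on_fields2 g V W \<cdot> A) = 0) \<and>
    (\<forall>X \<in> sections \<A> hor. \<forall>W \<in> sections \<A> ver.
       oneill_A \<A> g \<B> \<pi> D X (on_field J W)
       + (1/2) *\<^sub>R (on_field \<omega> W \<cdot> on_field J X)
       + (1/2) *\<^sub>R (on_fields2 \<Omega> X W \<cdot> B1) = 0)"
proof -
  interpret lcK_lagrangian_submersion \<A> g D J \<omega> B1 \<B> g\<^sub>B D\<^sub>B \<pi> P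
    using assms
    by unfold_locales
      (auto simp: lcK_manifold_def hermitian_manifold_def riemannian_manifold_def
        lagrangian_riemannian_submersion_def)
  \<comment> \<open>Converts the equations between fields into pointwise ones with the factor 1/2
    taken out, the shape in which the correction term of D J appears.\<close>
  have field_eq: "F + (1/2) *\<^sub>R (f \<cdot> G) + (1/2) *\<^sub>R (h \<cdot> H) = 0 \<longleftrightarrow>
      (\<forall>p. F p + (1/2) *\<^sub>R (f p *\<^sub>R G p + h p *\<^sub>R H p) = 0)"
    for F G H :: "'m vfield" and f h :: "'m \<Rightarrow> real"
  proof -
    have "(F + (1/2) *\<^sub>R (f \<cdot> G) + (1/2) *\<^sub>R (h \<cdot> H)) p = F p + (1/2) *\<^sub>R (f p *\<^sub>R G p + h p *\<^sub>R H p)" for p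
      by (simp add: fscale_def algebra_simps)
    then show ?thesis
      by (simp only: fun_eq_iff[of _ "0 :: 'm vfield"] zero_fun_apply)
  qed
  show ?thesis
    using totally_geodesic_iff_oneill
    unfolding ver_def hor_def \<Omega>_def A_def field_eq on_field_def on_fields2_def fundamental_form_def .
qed

end
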